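(* Let $\Omega$ be a hyperbolic simply connected domain in $\mathbb{C}$. Then $\Omega$ is a visibility domain if and only if $\partial\Omega$ is locally connected.
   Context: $\partial\Omega$ is the boundary of $\Omega$ in $\mathbb{C}$. For a domain $\Omega\subset\mathbb{C}$, $\mathsf{k}_\Omega$ is the Kobayashi (pseudo)distance and $\kappa_\Omega(z;v)$ the Kobayashi--Royden (pseudo)metric; $\Omega$ is hyperbolic if $\mathsf{k}_\Omega$ is a distance (in the plane, $\mathsf{k}_\Omega$ is then the hyperbolic distance). Almost-geodesics: for $\lambda\ge1,\kappa\ge0$ and an interval $I\subset\mathbb{R}$, a map $\sigma:I\to\Omega$ is a $(\lambda,\kappa)$-almost-geodesic if (i) $\frac1\lambda|s-t|-\kappa\le \mathsf{k}_\Omega(\sigma(s),\sigma(t))\le\lambda|s-t|+\kappa$ for all $s,t\in I$; (ii) $\sigma$ is absolutely continuous and $\kappa_\Omega(\sigma(t);\sigma'(t))\le\lambda$ for a.e. $t\in I$. End compactification: if $\Omega$ is bounded, $\overline{\Omega}^{End}:=\overline{\Omega}$. If $\Omega$ is unbounded, fix an exhaustion $(K_j)_{j\ge1}$ of $\overline\Omega$ by compact sets with $K_j$ contained in the interior (in $\overline\Omega$) of $K_{j+1}$. An end of $\overline\Omega$ is a sequence $(F_j)_{j\ge1}$ with $F_j$ a connected component of $\overline\Omega\setminus K_j$ and $F_{j+1}\subset F_j$. As a set, $\overline{\Omega}^{End}$ is $\overline\Omega$ together with all ends. Points of $\overline\Omega$ have their Euclidean neighbourhoods in $\overline\Omega$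 as neighbourhood basis; an end $(F_j)_j$ has the neighbourhood basis $(\widehat F_j)_j$, where $\widehat F_j$ is $F_j$ together with all ends $(G_\nu)_\nu$ with $G_\nu=F_\nu$ for $\nu=1,\dots,j$. (Up to natural homeomorphism this does not depend on the exhaustion.) $\partial\overline{\Omega}^{End}:=\overline{\Omega}^{End}\setminus\Omega$. Visibility: distinct $\zeta,\eta\in\partial\overline{\Omega}^{End}$ satisfy the $(\lambda,\kappa)$-visibility property if there exist neighbourhoods $V_\zeta$, $V_\eta$ of $\zeta,\eta$ in $\overline{\Omega}^{End}$ with $\overline{V_\zeta}\cap\overline{V_\eta}=\emptyset$ and a compact $K\subset\Omega$ such that every $(\lambda,\kappa)$-almost-geodesic $\sigma:[0,T]\to\Omega$ with $\sigma(0)\in V_\zeta$, $\sigma(T)\in V_\eta$ satisfies $\sigma([0,T])\cap K\ne\emptyset$. A hyperbolic domain $\Omega$ is a visibility domain if for all $\lambda\ge1$ and $\kappa>0$ every pair of distinct points of $\partial\overline{\Omega}^{End}$ satisfies the $(\lambda,\kappa)$-visibility property. *)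

theory Defs
  imports "HOL-Complex_Analysis.Complex_Analysis"
begin

section \<open>Kobayashi distance and Kobayashi--Royden metric\<close>

text \<open>Normalisation: the Poincare metric of the unit disc is
  \<open>\<bar>v\<bar> / (1 - \<bar>z\<bar>\<^sup>2)\<close>, so that its distance from \<open>0\<close> to \<open>z\<close> is \<open>artanh \<bar>z\<bar>\<close>.\<close>

definition poincare_dist :: "complex \<Rightarrow> complex \<Rightarrow> real" where
  "poincare_dist a b = artanh (cmod ((a - b) / (1 - cnj b * a)))"

definition hol_discs :: "complex set \<Rightarrow> (complex \<Rightarrow> complex) set" where
  "hol_discs \<Omega> = {f. f holomorphic_on ball 0 1 \<and> f ` ball 0 1 \<subseteq> \<Omega>}"

text \<open>The infimum over all chains of holomorphic discs joining \<open>z\<close> to \<open>w\<close>.\<close>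

definition kobayashi_dist :: "complex set \<Rightarrow> complex \<Rightarrow> complex \<Rightarrow> real" where
  "kobayashi_dist \<Omega> z w =
     Inf {(\<Sum>i<n. poincare_dist (a i) (b i)) | (n::nat) p f a b.
            0 < n \<and> p 0 = z \<and> p n = w \<and>
            (\<forall>i<n. f i \<in> hol_discs \<Omega> \<and> a i \<in> ball 0 1 \<and> b i \<in> ball 0 1 \<and>
                   f i (a i) = p i \<and> f i (b i) = p (Suc i))}"

definition kobayashi_metric :: "complex set \<Rightarrow> complex \<Rightarrow> complex \<Rightarrow> real" where
  "kobayashi_metric \<Omega> z v =
     Inf {\<alpha>::real. 0 < \<alpha> \<and> (\<exists>f\<in>hol_discs \<Omega>. f 0 = z \<and> of_real \<alpha> * deriv f 0 = v)}"

text \<open>On a domain \<^const>\<open>kobayashi_dist\<close> is always a pseudodistance, so it is a distance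
  precisely when it separates points.\<close>

definition hyperbolic_domain :: "complex set \<Rightarrow> bool" where
  "hyperbolic_domain \<Omega> \<longleftrightarrow> open \<Omega> \<and> connected \<Omega> \<and> \<Omega> \<noteq> {} \<and>
     (\<forall>z\<in>\<Omega>. \<forall>w\<in>\<Omega>. kobayashi_dist \<Omega> z w = 0 \<longrightarrow> z = w)"


section \<open>Almost-geodesics\<close>

text \<open>A pair \<open>(a, b)\<close> in \<open>D\<close> stands for the interval from \<open>a\<close> to \<open>b\<close>.\<close>

definition abs_continuous_on :: "real set \<Rightarrow> (real \<Rightarrow> complex) \<Rightarrow> bool" where
  "abs_continuous_on I \<sigma> \<longleftrightarrow>
     (\<forall>\<epsilon>>0. \<exists>\<delta>>0. \<forall>D :: (real \<times> real) set.
        finite D \<and> (\<forall>(a, b)\<in>D. a < b \<and> a \<in> I \<and> b \<in> I) \<and>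
        pairwise (\<lambda>p q. disjnt {fst p<..<snd p} {fst q<..<snd q}) D \<and>
        (\<Sum>(a, b)\<in>D. b - a) < \<delta>
        \<longrightarrow> (\<Sum>(a, b)\<in>D. dist (\<sigma> a) (\<sigma> b)) < \<epsilon>)"

definition almost_geodesic ::
    "complex set \<Rightarrow> real \<Rightarrow> real \<Rightarrow> real set \<Rightarrow> (real \<Rightarrow> complex) \<Rightarrow> bool" where
  "almost_geodesic \<Omega> L \<kappa> I \<sigma> \<longleftrightarrow>
     \<sigma> ` I \<subseteq> \<Omega> \<and>
     (\<forall>s\<in>I. \<forall>t\<in>I.
        1 / L * \<bar>s - t\<bar> - \<kappa> \<le> kobayashi_dist \<Omega> (\<sigma> s) (\<sigma> t) \<and>
        kobayashi_dist \<Omega> (\<sigma> s) (\<sigma> t) \<le> L * \<bar>s - t\<bar> + \<kappa>) \<and>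
     abs_continuous_on I \<sigma> \<and>
     (AE t in lebesgue_on I.
        \<exists>v. (\<sigma> has_vector_derivative v) (at t within I) \<and> kobayashi_metric \<Omega> (\<sigma> t) v \<le> L)"


section \<open>End compactification\<close>

text \<open>The exhaustion \<open>K\<close> is kept as a parameter, indexed from \<open>0\<close>.\<close>

definition compact_exhaustion :: "complex set \<Rightarrow> (nat \<Rightarrow> complex set) \<Rightarrow> bool" where
  "compact_exhaustion X K \<longleftrightarrow>
     (\<forall>j. compact (K j) \<and> K j \<subseteq> top_of_set X interior_of K (Suc j)) \<and> (\<Union>j. K j) = X"

definition ends :: "complex set \<Rightarrow> (nat \<Rightarrow> complex set) \<Rightarrow> (nat \<Rightarrow> complex set) set" where
  "ends X K = {F. \<forall>j. F j \<in> components (X - K j) \<and> F (Suc j) \<subseteq> F j}"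

datatype end_point = Pt complex | End "nat \<Rightarrow> complex set"

definition end_carrier :: "complex set \<Rightarrow> (nat \<Rightarrow> complex set) \<Rightarrow> end_point set" where
  "end_carrier \<Omega> K =
     (if bounded \<Omega> then Pt ` closure \<Omega> else Pt ` closure \<Omega> \<union> End ` ends (closure \<Omega>) K)"

definition end_nbhd ::
    "complex set \<Rightarrow> (nat \<Rightarrow> complex set) \<Rightarrow> (nat \<Rightarrow> complex set) \<Rightarrow> nat \<Rightarrow> end_point set" where
  "end_nbhd \<Omega> K F j = Pt ` F j \<union> End ` {G \<in> ends (closure \<Omega>) K. \<forall>\<nu>\<le>j. G \<nu> = F \<nu>}"

text \<open>A set is open if it contains a basic neighbourhood of each of its points.\<close>

definition end_open :: "complex set \<Rightarrow> (nat \<Rightarrow> complex set) \<Rightarrow> end_point set \<Rightarrow> bool" where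
  "end_open \<Omega> K U \<longleftrightarrow> U \<subseteq> end_carrier \<Omega> K \<and>
     (\<forall>z. Pt z \<in> U \<longrightarrow> (\<exists>r>0. Pt ` (ball z r \<inter> closure \<Omega>) \<subseteq> U)) \<and>
     (\<forall>F. End F \<in> U \<longrightarrow> (\<exists>j. end_nbhd \<Omega> K F j \<subseteq> U))"

definition end_topology :: "complex set \<Rightarrow> (nat \<Rightarrow> complex set) \<Rightarrow> end_point topology" where
  "end_topology \<Omega> K = topology (end_open \<Omega> K)"

lemma end_nbhd_antimono:
  assumes "F \<in> ends (closure \<Omega>) K" "i \<le> j"
  shows "end_nbhd \<Omega> K F j \<subseteq> end_nbhd \<Omega> K F i"
proof -
  have "F (Suc n) \<subseteq> F n" for n
    using assms(1) by (simp add: ends_def)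
  then have "F j \<subseteq> F i"
    using assms(2) by (rule lift_Suc_antimono_le)
  moreover have "{G \<in> ends (closure \<Omega>) K. \<forall>\<nu>\<le>j. G \<nu> = F \<nu>} \<subseteq> {G \<in> ends (closure \<Omega>) K. \<forall>\<nu>\<le>i. G \<nu> = F \<nu>}"
    using assms(2) by auto
  ultimately show ?thesis
    unfolding end_nbhd_def by (intro Un_mono image_mono)
qed

lemma istopology_end_open: "istopology (end_open \<Omega> K)"
  unfolding istopology_def
proof (intro conjI allI impI)
  fix S T assume S: "end_open \<Omega> K S" and T: "end_open \<Omega> K T"
  show "end_open \<Omega> K (S \<inter> T)"
    unfolding end_open_def
  proof (intro conjI allI impI)
    show "S \<inter> T \<subseteq> end_carrier \<Omega> K"
      using S by (auto simp: end_open_def)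
  next
    fix z assume "Pt z \<in> S \<inter> T"
    then have "Pt z \<in> S" "Pt z \<in> T" by auto
    obtain r where r: "r > 0" "Pt ` (ball z r \<inter> closure \<Omega>) \<subseteq> S"
      using S \<open>Pt z \<in> S\<close> unfolding end_open_def by blast
    obtain s where s: "s > 0" "Pt ` (ball z s \<inter> closure \<Omega>) \<subseteq> T"
      using T \<open>Pt z \<in> T\<close> unfolding end_open_def by blast
    have "Pt ` (ball z (min r s) \<inter> closure \<Omega>) \<subseteq> S \<inter> T"
      using r(2) s(2) by (auto simp: image_subset_iff)
    with r(1) s(1) show "\<exists>r>0. Pt ` (ball z r \<inter> closure \<Omega>) \<subseteq> S \<inter> T"
      by (intro exI[of _ "min r s"]) simp
  next
    fix F assume F: "End F \<in> S \<inter> T"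
    then have "End F \<in> S" "End F \<in> T" by auto
    obtain i where i: "end_nbhd \<Omega> K F i \<subseteq> S"
      using S \<open>End F \<in> S\<close> unfolding end_open_def by blast
    obtain j where j: "end_nbhd \<Omega> K F j \<subseteq> T"
      using T \<open>End F \<in> T\<close> unfolding end_open_def by blast
    have "End F \<in> end_carrier \<Omega> K"
      using F S by (auto simp: end_open_def)
    then have "F \<in> ends (closure \<Omega>) K"
      by (auto simp: end_carrier_def split: if_splits)
    then have "end_nbhd \<Omega> K F (max i j) \<subseteq> S \<inter> T"
      using i j end_nbhd_antimono[of F \<Omega> K i "max i j"] end_nbhd_antimono[of F \<Omega> K j "max i j"]
      by (meson Int_greatest max.cobounded1 max.cobounded2 order_trans)
    then show "\<exists>j. end_nbhd \<Omega> K F j \<subseteq> S \<inter> T" by blast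
  qed
next
  fix \<K> assume *: "\<forall>S\<in>\<K>. end_open \<Omega> K S"
  show "end_open \<Omega> K (\<Union>\<K>)"
    unfolding end_open_def
  proof (intro conjI allI impI)
    show "\<Union>\<K> \<subseteq> end_carrier \<Omega> K"
      using * by (auto simp: end_open_def)
  next
    fix z assume "Pt z \<in> \<Union>\<K>"
    then obtain S where S: "S \<in> \<K>" "Pt z \<in> S" by blast
    have "end_open \<Omega> K S"
      using * S(1) by blast
    with S(2) obtain r where "r > 0" "Pt ` (ball z r \<inter> closure \<Omega>) \<subseteq> S"
      unfolding end_open_def by blast
    with S(1) show "\<exists>r>0. Pt ` (ball z r \<inter> closure \<Omega>) \<subseteq> \<Union>\<K>" by blast
  next
    fix F assume "End F \<in> \<Union>\<K>"
    then obtain S where S: "S \<in> \<K>" "End F \<in> S" by blast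
    have "end_open \<Omega> K S"
      using * S(1) by blast
    with S(2) obtain j where "end_nbhd \<Omega> K F j \<subseteq> S"
      unfolding end_open_def by blast
    with S(1) show "\<exists>j. end_nbhd \<Omega> K F j \<subseteq> \<Union>\<K>" by blast
  qed
qed

lemma openin_end_topology: "openin (end_topology \<Omega> K) U \<longleftrightarrow> end_open \<Omega> K U"
  by (simp add: end_topology_def istopology_end_open topology_inverse')

lemma topspace_end_topology: "topspace (end_topology \<Omega> K) = end_carrier \<Omega> K"
proof
  show "topspace (end_topology \<Omega> K) \<subseteq> end_carrier \<Omega> K"
    using openin_topspace[of "end_topology \<Omega> K"]
    unfolding openin_end_topology by (simp add: end_open_def)
  have "end_open \<Omega> K (end_carrier \<Omega> K)"
    unfolding end_open_def
  proof (intro conjI allI impI)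
    fix z :: complex
    show "\<exists>r>0. Pt ` (ball z r \<inter> closure \<Omega>) \<subseteq> end_carrier \<Omega> K"
      by (intro exI[of _ 1]) (auto simp: end_carrier_def)
  next
    fix F assume "End F \<in> end_carrier \<Omega> K"
    then have F: "F \<in> ends (closure \<Omega>) K" and unb: "\<not> bounded \<Omega>"
      by (auto simp: end_carrier_def split: if_splits)
    have "F 0 \<in> components (closure \<Omega> - K 0)"
      using F by (simp add: ends_def)
    then have "F 0 \<subseteq> closure \<Omega>"
      using in_components_subset by fastforce
    then have "end_nbhd \<Omega> K F 0 \<subseteq> end_carrier \<Omega> K"
      using unb by (auto simp: end_nbhd_def end_carrier_def)
    then show "\<exists>j. end_nbhd \<Omega> K F j \<subseteq> end_carrier \<Omega> K" by blast
  qed simp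
  then show "end_carrier \<Omega> K \<subseteq> topspace (end_topology \<Omega> K)"
    using openin_end_topology openin_subset by blast
qed

definition end_boundary :: "complex set \<Rightarrow> (nat \<Rightarrow> complex set) \<Rightarrow> end_point set" where
  "end_boundary \<Omega> K = end_carrier \<Omega> K - Pt ` \<Omega>"


section \<open>Visibility\<close>

definition is_nbhd :: "'a topology \<Rightarrow> 'a \<Rightarrow> 'a set \<Rightarrow> bool" where
  "is_nbhd X x V \<longleftrightarrow> V \<subseteq> topspace X \<and> (\<exists>U. openin X U \<and> x \<in> U \<and> U \<subseteq> V)"

definition visible_pair ::
    "complex set \<Rightarrow> (nat \<Rightarrow> complex set) \<Rightarrow> real \<Rightarrow> real \<Rightarrow> end_point \<Rightarrow> end_point \<Rightarrow> bool" where
  "visible_pair \<Omega> K L \<kappa> \<zeta> \<eta> \<longleftrightarrow>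
     (\<exists>V W C. is_nbhd (end_topology \<Omega> K) \<zeta> V \<and> is_nbhd (end_topology \<Omega> K) \<eta> W \<and>
        (end_topology \<Omega> K closure_of V) \<inter> (end_topology \<Omega> K closure_of W) = {} \<and>
        compact C \<and> C \<subseteq> \<Omega> \<and>
        (\<forall>T\<ge>0. \<forall>\<sigma>. almost_geodesic \<Omega> L \<kappa> {0..T} \<sigma> \<and> Pt (\<sigma> 0) \<in> V \<and> Pt (\<sigma> T) \<in> W
           \<longrightarrow> \<sigma> ` {0..T} \<inter> C \<noteq> {}))"

definition visibility_domain :: "complex set \<Rightarrow> (nat \<Rightarrow> complex set) \<Rightarrow> bool" where
  "visibility_domain \<Omega> K \<longleftrightarrow> hyperbolic_domain \<Omega> \<and>
     (\<forall>L\<ge>1. \<forall>\<kappa>>0. \<forall>\<zeta>\<in>end_boundary \<Omega> K. \<forall>\<eta>\<in>end_boundary \<Omega> K.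
        \<zeta> \<noteq> \<eta> \<longrightarrow> visible_pair \<Omega> K L \<kappa> \<zeta> \<eta>)"

end

theory Submission
  imports Defs
begin

text \<open>
  Let \<open>f\<close> be a Riemann map from the disc onto \<open>\<Omega>\<close>; to treat infinity like any other boundary point,
  consider \<open>g = 1 / (f - f 0)\<close>. By the Schwarz--Pick lemma the Kobayashi distance is the Poincare
  distance of the disc, and the boundary is locally connected if and only if \<open>g\<close> extends continuously
  to the circle.

  If the boundary is locally connected, a length-area argument gives short crosscuts around each
  \<open>\<xi>\<close> on the circle, and Janiszewski's theorem shows that what lies beyond them has a small image
  (Caratheodory's theorem). An almost-geodesic that stays close to the circle has small Euclidean
  diameter in the disc, so a sequence of almost-geodesics escaping all compact sets has images
  converging to a single boundary point, or running to infinity within a single end.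

  Conversely, if \<open>g\<close> has no limit at \<open>\<xi>\<close>, its cluster set there is a nondegenerate continuum, and the
  hyperbolic geodesics joining points that converge to \<open>\<xi>\<close>, with images converging to two different
  finite boundary points, escape all compact sets and contradict visibility.
\<close>

subsection \<open>The Poincare distance\<close>


text \<open>The obstacle is infinity. Local connectedness of the boundary of \<Omega> is a condition
  at finite points, whereas the compactness arguments take place on the sphere and also need it at
  the point \<open>0\<close> of the inverted picture. Simple connectedness supplies it: the boundary
  of an unbounded simply connected open set has no bounded components, and this makes the inverted
  boundary connected im kleinen at \<open>0\<close>. Moreover the sphere has one point at infinity
  but \<Omega> may have many ends, so convergence to \<open>0\<close> does not tell two ends apart.
  Here uniform convergence along whole curves helps: a connected curve that avoids
  \<open>K \<nu>\<close> stays in one component of the complement. In the converse direction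
  infinity is harmless for another reason: once visibility leaves at most one cluster value besides
  \<open>0\<close>, connectedness reduces the cluster set to a point.\<close>

lemma disc_mult_cnj_neq_1:
  fixes w z :: complex
  assumes "cmod w < 1" "cmod z < 1"
  shows "1 - cnj w * z \<noteq> 0"
proof
  assume "1 - cnj w * z = 0"
  then have "cmod (cnj w * z) = 1" by simp
  moreover have "cmod (cnj w * z) < 1"
    using norm_mult_less[of "cnj w" 1 z 1] assms by simp
  ultimately show False by simp
qed

text \<open>Ties the pseudohyperbolic distance to the distances of both points from the circle. The
  triangle inequality, the exponential estimates and the speed of geodesics rest on it.\<close>

lemma Moebius_function_norm_sq:
  assumes "cmod w < 1" "cmod z < 1"
  shows "1 - (cmod (Moebius_function 0 w z))\<^sup>2
           = (1 - (cmod w)\<^sup>2) * (1 - (cmod z)\<^sup>2) / (cmod (1 - cnj w * z))\<^sup>2"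
proof -
  have nz: "(cmod (1 - cnj w * z))\<^sup>2 \<noteq> 0"
    using disc_mult_cnj_neq_1[OF assms] by simp
  have "(cmod (1 - cnj w * z))\<^sup>2 - (cmod (z - w))\<^sup>2 = (1 - (cmod w)\<^sup>2) * (1 - (cmod z)\<^sup>2)"
    unfolding cmod_power2 by (simp add: power2_eq_square algebra_simps)
  with nz show ?thesis
    by (simp add: Moebius_function_simple norm_divide power_divide field_simps)
qed

lemma poincare_dist_Moebius: "poincare_dist a b = artanh (cmod (Moebius_function 0 b a))"
  by (simp add: poincare_dist_def Moebius_function_simple)

lemma artanh_mono:
  fixes x y :: real
  assumes "0 \<le> x" "x \<le> y" "y < 1"
  shows "artanh x \<le> artanh y"
proof -
  have "(1 + x) / (1 - x) \<le> (1 + y) / (1 - y)" "0 < (1 + x) / (1 - x)"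
    using assms by (auto simp: field_simps)
  then show ?thesis by (simp add: artanh_def ln_mono)
qed

lemma artanh_nonneg:
  fixes x :: real
  assumes "0 \<le> x" "x < 1"
  shows "0 \<le> artanh x"
  using artanh_mono[of 0 x] assms by simp

text \<open>This turns the extremal pseudohyperbolic distance \<open>(r + s) / (1 + r * s)\<close>
  of two points on opposite sides of \<open>0\<close> into a sum of hyperbolic distances.\<close>

lemma artanh_add:
  fixes x y :: real
  assumes "0 \<le> x" "x < 1" "0 \<le> y" "y < 1"
  shows "artanh x + artanh y = artanh ((x + y) / (1 + x * y))"
proof -
  have p: "0 \<le> x * y" using assms by simp
  have nz: "1 + x * y \<noteq> 0" using p by linarith
  have *: "(1 - x) * (1 - y) > 0" using assms by simp
  have "1 + (x + y) / (1 + x * y) = (1 + x) * (1 + y) / (1 + x * y)"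
       "1 - (x + y) / (1 + x * y) = (1 - x) * (1 - y) / (1 + x * y)"
    using nz by (simp_all add: field_simps)
  then have "(1 + (x + y) / (1 + x * y)) / (1 - (x + y) / (1 + x * y))
      = ((1 + x) / (1 - x)) * ((1 + y) / (1 - y))"
    using nz * assms by simp
  then have "artanh ((x + y) / (1 + x * y)) = ln ((1 + x) / (1 - x) * ((1 + y) / (1 - y))) / 2"
    by (simp only: artanh_def)
  also have "\<dots> = (ln ((1 + x) / (1 - x)) + ln ((1 + y) / (1 - y))) / 2"
    using assms by (subst ln_mult_pos) auto
  finally show ?thesis by (simp only: artanh_def add_divide_distrib)
qed

lemma poincare_dist_nonneg:
  assumes "cmod a < 1" "cmod b < 1"
  shows "0 \<le> poincare_dist a b"
  unfolding poincare_dist_Moebius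
  using Moebius_function_norm_lt_1[OF assms(2,1)] by (intro artanh_nonneg) auto

text \<open>Automorphisms of the disc move \<open>b\<close> and \<open>f b\<close> to
  \<open>0\<close>, which reduces the claim to the Schwarz lemma.\<close>

lemma Schwarz_Pick:
  assumes f: "f holomorphic_on ball 0 1" "f ` ball 0 1 \<subseteq> ball 0 1"
    and a: "cmod a < 1" and b: "cmod b < 1"
  shows "poincare_dist (f a) (f b) \<le> poincare_dist a b"
proof -
  have fb: "cmod (f b) < 1" using f(2) b by (auto simp: image_subset_iff)
  define F where "F = Moebius_function 0 (f b) \<circ> f \<circ> Moebius_function 0 (-b)"
  have im: "Moebius_function 0 (-b) ` ball 0 1 \<subseteq> ball 0 1"
    using Moebius_function_norm_lt_1[of "-b"] b by auto
  have "F holomorphic_on ball 0 1"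
    unfolding F_def
  proof (intro holomorphic_on_compose_gen[where t = "ball 0 1"])
    show "Moebius_function 0 (-b) holomorphic_on ball 0 1" "Moebius_function 0 (f b) holomorphic_on ball 0 1"
      using b fb by (auto intro: Moebius_function_holomorphic)
  qed (use f im in auto)
  moreover have "F 0 = 0" by (simp add: F_def Moebius_function_of_zero Moebius_function_eq_zero)
  moreover have "cmod (F z) < 1" if "cmod z < 1" for z
    unfolding F_def o_def
    using f(2) im that fb by (intro Moebius_function_norm_lt_1) (auto simp: image_subset_iff)
  moreover have m: "cmod (Moebius_function 0 b a) < 1"
    using Moebius_function_norm_lt_1 a b by blast
  ultimately have "cmod (F (Moebius_function 0 b a)) \<le> cmod (Moebius_function 0 b a)"
    by (intro Schwarz_Lemma(1))
  moreover have "F (Moebius_function 0 b a) = Moebius_function 0 (f b) (f a)"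
    using Moebius_function_compose[of b "-b" a] Moebius_function_compose[of "-b" b a] a b by (simp add: F_def)
  ultimately show ?thesis
    unfolding poincare_dist_Moebius using m by (intro artanh_mono) auto
qed

lemma Moebius_function_has_field_derivative:
  assumes "cmod w < 1" "cmod z < 1"
  shows "(Moebius_function 0 w has_field_derivative
           (1 - cnj w * w) / (1 - cnj w * z)\<^sup>2) (at z)"
proof -
  have "((\<lambda>z. (z - w) / (1 - cnj w * z)) has_field_derivative
           (1 - cnj w * w) / (1 - cnj w * z)\<^sup>2) (at z)"
    using disc_mult_cnj_neq_1[OF assms]
    by (auto intro!: derivative_eq_intros simp: power2_eq_square field_simps)
  moreover have "Moebius_function 0 w = (\<lambda>z. (z - w) / (1 - cnj w * z))"
    by (rule ext) (rule Moebius_function_simple)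
  ultimately show ?thesis by simp
qed

text \<open>The infinitesimal form of Schwarz--Pick. Only \<open>f 0\<close> has to be moved to
  \<open>0\<close>, because the discs that compete in \<open>kobayashi_metric\<close> are centred at
  \<open>0\<close>.\<close>

lemma cmod_deriv_le_disc:
  assumes f: "f holomorphic_on ball 0 1" "f ` ball 0 1 \<subseteq> ball 0 1"
  shows "cmod (deriv f 0) \<le> 1 - (cmod (f 0))\<^sup>2"
proof -
  have f0: "cmod (f 0) < 1" using f(2) by (auto simp: image_subset_iff)
  define F where "F = Moebius_function 0 (f 0) \<circ> f"
  have "F holomorphic_on ball 0 1"
    unfolding F_def
    by (rule holomorphic_on_compose_gen[where t = "ball 0 1"])
       (use f f0 in \<open>auto intro: Moebius_function_holomorphic\<close>)
  moreover have "F 0 = 0" by (simp add: F_def Moebius_function_eq_zero)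
  moreover have "cmod (F z) < 1" if "cmod z < 1" for z
    unfolding F_def o_def using f(2) that f0 by (intro Moebius_function_norm_lt_1) (auto simp: image_subset_iff)
  ultimately have F': "cmod (deriv F 0) \<le> 1" by (intro Schwarz_Lemma(2)[where \<xi> = 0]) auto
  define q where "q = 1 - (cmod (f 0))\<^sup>2"
  have e: "1 - cnj (f 0) * f 0 = of_real q"
    using complex_norm_square[of "f 0"] by (simp add: mult.commute q_def)
  have q: "q > 0" using f0 by (simp add: abs_square_less_1 q_def)
  have "(f has_field_derivative deriv f 0) (at 0)"
    using f(1) by (intro holomorphic_derivI[where S = "ball 0 1"]) auto
  then have "(F has_field_derivative of_real q / (of_real q)\<^sup>2 * deriv f 0) (at 0)"
    unfolding F_def using Moebius_function_has_field_derivative[OF f0 f0] unfolding e by (rule DERIV_chain[rotated])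
  then have "deriv F 0 = of_real q / (of_real q)\<^sup>2 * deriv f 0" by (rule DERIV_imp_deriv)
  also have "\<dots> = deriv f 0 / of_real q" using q by (simp add: power2_eq_square)
  finally have "cmod (deriv F 0) = cmod (deriv f 0) / q"
    using q by (simp add: norm_divide)
  with F' q show ?thesis by (simp add: field_simps flip: q_def)
qed

lemma poincare_dist_commute:
  assumes "cmod a < 1" "cmod b < 1"
  shows "poincare_dist a b = poincare_dist b a"
proof -
  have "cmod (1 - cnj b * a) = cmod (cnj (1 - cnj b * a))" by (simp only: complex_mod_cnj)
  also have "\<dots> = cmod (1 - cnj a * b)" by (simp add: mult.commute)
  finally show ?thesis by (simp add: poincare_dist_def norm_divide norm_minus_commute)
qed

lemma poincare_dist_0: "poincare_dist a 0 = artanh (cmod a)"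
  by (simp add: poincare_dist_def)

text \<open>For given moduli \<open>r\<close> and \<open>s\<close> the distance is largest when
  \<open>0\<close> lies between the points on a diameter, where the denominator
  \<open>cmod (1 - cnj w * z)\<close> takes its maximal value \<open>1 + r * s\<close>. Moebius
  invariance then yields the general triangle inequality.\<close>

lemma poincare_dist_triangle_0:
  assumes z: "cmod z < 1" and w: "cmod w < 1"
  shows "poincare_dist z w \<le> poincare_dist z 0 + poincare_dist 0 w"
proof -
  define r s where "r = cmod z" and "s = cmod w"
  have rs: "0 \<le> r" "r < 1" "0 \<le> s" "s < 1" using z w by (auto simp: r_def s_def)
  have p: "0 \<le> r * s" using rs by simp
  then have pp: "0 < 1 + r * s" by linarith
  let ?m = "cmod (Moebius_function 0 w z)"
  have a: "cmod (1 - cnj w * z) \<le> 1 + r * s"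
    using norm_triangle_ineq4[of 1 "cnj w * z"] by (simp add: r_def s_def norm_mult mult.commute)
  have nz: "cmod (1 - cnj w * z) > 0" using disc_mult_cnj_neq_1[OF w z] by simp
  have "1 - ((r + s) / (1 + r * s))\<^sup>2 = (1 - s\<^sup>2) * (1 - r\<^sup>2) / (1 + r * s)\<^sup>2"
    using p by (simp add: power_divide field_simps) (simp add: power2_eq_square algebra_simps)
  also have "\<dots> \<le> (1 - s\<^sup>2) * (1 - r\<^sup>2) / (cmod (1 - cnj w * z))\<^sup>2"
    using a nz rs p by (intro divide_left_mono power_mono mult_nonneg_nonneg mult_pos_pos zero_less_power pp)
      (auto simp: abs_square_le_1)
  also have "\<dots> = 1 - ?m\<^sup>2"
    using Moebius_function_norm_sq[OF w z] by (simp add: r_def s_def)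
  finally have "?m\<^sup>2 \<le> ((r + s) / (1 + r * s))\<^sup>2" by simp
  then have m: "?m \<le> (r + s) / (1 + r * s)"
  proof (rule power2_le_imp_le)
    show "0 \<le> (r + s) / (1 + r * s)" using rs(1,3) pp by (intro divide_nonneg_pos) auto
  qed
  have "r + s < 1 + r * s"
  proof -
    have "(1 - r) * (1 - s) > 0" using rs by simp
    then show ?thesis by (simp add: algebra_simps)
  qed
  then have "(r + s) / (1 + r * s) < 1" using p by simp
  then have "poincare_dist z w \<le> artanh ((r + s) / (1 + r * s))"
    unfolding poincare_dist_Moebius using m by (intro artanh_mono) auto
  also have "\<dots> = artanh r + artanh s" using rs by (simp add: artanh_add)
  also have "\<dots> = poincare_dist z 0 + poincare_dist 0 w"
    using poincare_dist_commute[of 0 w] w by (simp add: poincare_dist_0 r_def s_def)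
  finally show ?thesis .
qed

text \<open>Schwarz--Pick applied to the automorphism and to its inverse.\<close>

lemma poincare_dist_Moebius_image:
  assumes c: "cmod c < 1" and z: "cmod z < 1" and w: "cmod w < 1"
  shows "poincare_dist (Moebius_function 0 c z) (Moebius_function 0 c w) = poincare_dist z w"
proof (rule antisym)
  let ?m = "Moebius_function 0 c" and ?n = "Moebius_function 0 (-c)"
  have h: "Moebius_function 0 d holomorphic_on ball 0 1" "Moebius_function 0 d ` ball 0 1 \<subseteq> ball 0 1"
    if "cmod d < 1" for d
    using that Moebius_function_norm_lt_1 by (auto intro: Moebius_function_holomorphic)
  show "poincare_dist (?m z) (?m w) \<le> poincare_dist z w"
    using h[OF c] z w by (intro Schwarz_Pick) auto
  have "poincare_dist (?n (?m z)) (?n (?m w)) \<le> poincare_dist (?m z) (?m w)"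
    using h[of "-c"] c z w Moebius_function_norm_lt_1 by (intro Schwarz_Pick) auto
  then show "poincare_dist z w \<le> poincare_dist (?m z) (?m w)"
    using Moebius_function_compose[of "-c" c] c z w by simp
qed

lemma poincare_dist_triangle:
  assumes a: "cmod a < 1" and b: "cmod b < 1" and c: "cmod c < 1"
  shows "poincare_dist a c \<le> poincare_dist a b + poincare_dist b c"
proof -
  let ?m = "Moebius_function 0 b"
  have "poincare_dist (?m a) (?m c) \<le> poincare_dist (?m a) (?m b) + poincare_dist (?m b) (?m c)"
    unfolding Moebius_function_eq_zero
    using a b c by (intro poincare_dist_triangle_0 Moebius_function_norm_lt_1)
  with a b c show ?thesis by (simp add: poincare_dist_Moebius_image)
qed

text \<open>With \<open>m\<close> the pseudohyperbolic distance, the exponential is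
  \<open>(1 + m) / (1 - m)\<close>, that is \<open>(1 + m)\<^sup>2 / (1 - m\<^sup>2)\<close>, and
  \<open>1 + m \<le> 2\<close>. The cross term on the right is kept because it tends to
  \<open>0\<close> when both points approach the same point of the circle.\<close>

lemma exp_poincare_dist_le_cross:
  assumes z: "cmod z < 1" and w: "cmod w < 1"
  shows "exp (2 * poincare_dist z w) * ((1 - (cmod z)\<^sup>2) * (1 - (cmod w)\<^sup>2)) \<le> 4 * (cmod (1 - cnj w * z))\<^sup>2"
proof -
  let ?m = "cmod (Moebius_function 0 w z)" and ?n = "cmod (1 - cnj w * z)"
  let ?d = "(1 - (cmod w)\<^sup>2) * (1 - (cmod z)\<^sup>2)"
  have m: "0 \<le> ?m" "?m < 1" using Moebius_function_norm_lt_1[OF w z] by auto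
  have n: "?n > 0" using disc_mult_cnj_neq_1[OF w z] by simp
  have d: "?d > 0" using z w by (simp add: abs_square_less_1)
  have "exp (2 * poincare_dist z w) = (1 + ?m) / (1 - ?m)"
    using m by (simp add: poincare_dist_Moebius artanh_def add_pos_nonneg)
  also have "\<dots> = (1 + ?m)\<^sup>2 / (1 - ?m\<^sup>2)"
  proof -
    have "1 - ?m\<^sup>2 = (1 - ?m) * (1 + ?m)" by (simp add: power2_eq_square algebra_simps)
    then show ?thesis using m by (simp add: power2_eq_square)
  qed
  also have "\<dots> = (1 + ?m)\<^sup>2 * ?n\<^sup>2 / ?d"
    using Moebius_function_norm_sq[OF w z] by simp
  finally have "exp (2 * poincare_dist z w) * ?d = (1 + ?m)\<^sup>2 * ?n\<^sup>2"
    using d by (subst (asm) nonzero_eq_divide_eq) auto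
  also have "\<dots> \<le> 2\<^sup>2 * ?n\<^sup>2" using m by (intro mult_right_mono power_mono) auto
  finally show ?thesis by (simp add: mult.commute)
qed

text \<open>Here the cross term is only bounded by \<open>2\<close>. Two points at large distance
  cannot both be far from the circle, which is what forces almost-geodesics towards it.\<close>

lemma exp_poincare_dist_le:
  assumes z: "cmod z < 1" and w: "cmod w < 1"
  shows "exp (2 * poincare_dist z w) * ((1 - (cmod z)\<^sup>2) * (1 - (cmod w)\<^sup>2)) \<le> 16"
proof -
  have "cmod (1 - cnj w * z) \<le> 1 + cmod (cnj w * z)" using norm_triangle_ineq4[of 1 "cnj w * z"] by simp
  also have "\<dots> \<le> 2" using norm_mult_less[of "cnj w" 1 z 1] z w by simp
  finally have "(cmod (1 - cnj w * z))\<^sup>2 \<le> 2\<^sup>2" by (intro power_mono) auto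
  then show ?thesis using exp_poincare_dist_le_cross[OF assms] by simp
qed


subsection \<open>Absolutely continuous curves\<close>

lemma abs_continuous_on_subset:
  assumes "abs_continuous_on I \<sigma>" "J \<subseteq> I"
  shows "abs_continuous_on J \<sigma>"
  unfolding abs_continuous_on_def
proof (intro allI impI)
  fix e :: real assume "e > 0"
  then obtain d where "d > 0" and d: "\<And>D :: (real \<times> real) set. finite D \<Longrightarrow> (\<forall>(a, b)\<in>D. a < b \<and> a \<in> I \<and> b \<in> I) \<Longrightarrow>
        pairwise (\<lambda>p q. disjnt {fst p<..<snd p} {fst q<..<snd q}) D \<Longrightarrow>
        (\<Sum>(a, b)\<in>D. b - a) < d \<Longrightarrow> (\<Sum>(a, b)\<in>D. dist (\<sigma> a) (\<sigma> b)) < e"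
    using assms(1) unfolding abs_continuous_on_def by meson
  show "\<exists>\<delta>>0. \<forall>D :: (real \<times> real) set.
        finite D \<and> (\<forall>(a, b)\<in>D. a < b \<and> a \<in> J \<and> b \<in> J) \<and>
        pairwise (\<lambda>p q. disjnt {fst p<..<snd p} {fst q<..<snd q}) D \<and>
        (\<Sum>(a, b)\<in>D. b - a) < \<delta>
        \<longrightarrow> (\<Sum>(a, b)\<in>D. dist (\<sigma> a) (\<sigma> b)) < e"
    using \<open>d > 0\<close> assms(2) by (intro exI[of _ d] conjI allI impI d) auto
qed

lemma abs_continuous_on_imp_continuous_on:
  assumes "abs_continuous_on I \<sigma>"
  shows "continuous_on I \<sigma>"
  unfolding continuous_on_iff
proof (intro ballI allI impI)
  fix x e :: real assume "x \<in> I" "e > 0"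
  then obtain d where "d > 0" and d: "\<And>D :: (real \<times> real) set. finite D \<Longrightarrow> (\<forall>(a, b)\<in>D. a < b \<and> a \<in> I \<and> b \<in> I) \<Longrightarrow>
        pairwise (\<lambda>p q. disjnt {fst p<..<snd p} {fst q<..<snd q}) D \<Longrightarrow>
        (\<Sum>(a, b)\<in>D. b - a) < d \<Longrightarrow> (\<Sum>(a, b)\<in>D. dist (\<sigma> a) (\<sigma> b)) < e"
    using assms(1) unfolding abs_continuous_on_def by meson
  have "dist (\<sigma> y) (\<sigma> x) < e" if "y \<in> I" "dist y x < d" for y
    using d[of "{(min x y, max x y)}"] that \<open>x \<in> I\<close> \<open>e > 0\<close>
    by (cases x y rule: linorder_cases) (auto simp: dist_real_def dist_commute)
  with \<open>d > 0\<close> show "\<exists>d>0. \<forall>x'\<in>I. dist x' x < d \<longrightarrow> dist (\<sigma> x') (\<sigma> x) < e" by blast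
qed

text \<open>A Lipschitz bound at small scales is enough, since a small sum of increments has small
  terms. Holomorphic maps on an open set offer no more than such a bound near a compact
  curve.\<close>

lemma abs_continuous_on_lipschitz_image:
  assumes \<sigma>: "abs_continuous_on I \<sigma>" and "d > 0" "B > 0"
    and lip: "\<And>s t. s \<in> I \<Longrightarrow> t \<in> I \<Longrightarrow> dist (\<sigma> s) (\<sigma> t) < d \<Longrightarrow> dist (\<tau> s) (\<tau> t) \<le> B * dist (\<sigma> s) (\<sigma> t)"
  shows "abs_continuous_on I \<tau>"
  unfolding abs_continuous_on_def
proof (intro allI impI)
  fix e :: real assume "e > 0"
  \<comment> \<open>The bound \<open>d\<close> brings every single increment into the range of
    \<open>lip\<close>; \<open>e / B\<close> controls the sum after multiplication by
    \<open>B\<close>.\<close>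
  define e' where "e' = min d (e / B)"
  have "e' > 0" using \<open>e > 0\<close> assms(2,3) by (simp add: e'_def)
  then obtain \<delta> where "\<delta> > 0" and \<delta>: "\<And>D :: (real \<times> real) set. finite D \<Longrightarrow> (\<forall>(a, b)\<in>D. a < b \<and> a \<in> I \<and> b \<in> I) \<Longrightarrow>
        pairwise (\<lambda>p q. disjnt {fst p<..<snd p} {fst q<..<snd q}) D \<Longrightarrow>
        (\<Sum>(a, b)\<in>D. b - a) < \<delta> \<Longrightarrow> (\<Sum>(a, b)\<in>D. dist (\<sigma> a) (\<sigma> b)) < e'"
    using \<sigma> unfolding abs_continuous_on_def by meson
  show "\<exists>\<delta>>0. \<forall>D :: (real \<times> real) set.
        finite D \<and> (\<forall>(a, b)\<in>D. a < b \<and> a \<in> I \<and> b \<in> I) \<and>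
        pairwise (\<lambda>p q. disjnt {fst p<..<snd p} {fst q<..<snd q}) D \<and>
        (\<Sum>(a, b)\<in>D. b - a) < \<delta>
        \<longrightarrow> (\<Sum>(a, b)\<in>D. dist (\<tau> a) (\<tau> b)) < e"
  proof (intro exI[of _ \<delta>] conjI allI impI)
    fix D :: "(real \<times> real) set"
    assume D: "finite D \<and> (\<forall>(a, b)\<in>D. a < b \<and> a \<in> I \<and> b \<in> I) \<and>
        pairwise (\<lambda>p q. disjnt {fst p<..<snd p} {fst q<..<snd q}) D \<and> (\<Sum>(a, b)\<in>D. b - a) < \<delta>"
    have less: "(\<Sum>(a, b)\<in>D. dist (\<sigma> a) (\<sigma> b)) < e'" using D by (intro \<delta>) auto
    have "dist (\<tau> a) (\<tau> b) \<le> B * dist (\<sigma> a) (\<sigma> b)" if "(a, b) \<in> D" for a b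
    proof (rule lip)
      show "a \<in> I" "b \<in> I" using D that by auto
      have "(case (a, b) of (a, b) \<Rightarrow> dist (\<sigma> a) (\<sigma> b)) \<le> (\<Sum>(a, b)\<in>D. dist (\<sigma> a) (\<sigma> b))"
        by (rule member_le_sum) (use D that in auto)
      with less show "dist (\<sigma> a) (\<sigma> b) < d" by (simp add: e'_def)
    qed
    then have "(\<Sum>(a, b)\<in>D. dist (\<tau> a) (\<tau> b)) \<le> (\<Sum>(a, b)\<in>D. B * dist (\<sigma> a) (\<sigma> b))"
      by (intro sum_mono) auto
    also have "\<dots> = B * (\<Sum>(a, b)\<in>D. dist (\<sigma> a) (\<sigma> b))"
      by (simp add: sum_distrib_left case_prod_unfold)
    also have "\<dots> < B * e'" using less \<open>B > 0\<close> by simp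
    also have "\<dots> \<le> B * (e / B)" using \<open>B > 0\<close> by (intro mult_left_mono) (auto simp: e'_def)
    finally show "(\<Sum>(a, b)\<in>D. dist (\<tau> a) (\<tau> b)) < e" using \<open>B > 0\<close> by simp
  qed (fact \<open>\<delta> > 0\<close>)
qed

lemma abs_continuous_on_lipschitz:
  assumes lip: "\<And>s t. s \<in> I \<Longrightarrow> t \<in> I \<Longrightarrow> dist (\<tau> s) (\<tau> t) \<le> B * dist s t" and "B > 0"
  shows "abs_continuous_on I \<tau>"
proof (rule abs_continuous_on_lipschitz_image[where \<sigma> = complex_of_real and d = 1])
  show "abs_continuous_on I complex_of_real"
    unfolding abs_continuous_on_def
  proof (intro allI impI)
    fix e :: real assume "e > 0"
    have "(\<Sum>(a, b)\<in>D. dist (complex_of_real a) (complex_of_real b)) = (\<Sum>(a, b)\<in>D. b - a)"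
      if "\<forall>(a, b)\<in>D. a < b \<and> a \<in> I \<and> b \<in> I" for D
      by (rule sum.cong) (use that in \<open>auto simp: dist_real_def\<close>)
    with \<open>e > 0\<close> show "\<exists>\<delta>>0. \<forall>D :: (real \<times> real) set.
        finite D \<and> (\<forall>(a, b)\<in>D. a < b \<and> a \<in> I \<and> b \<in> I) \<and>
        pairwise (\<lambda>p q. disjnt {fst p<..<snd p} {fst q<..<snd q}) D \<and>
        (\<Sum>(a, b)\<in>D. b - a) < \<delta>
        \<longrightarrow> (\<Sum>(a, b)\<in>D. dist (complex_of_real a) (complex_of_real b)) < e"
      by (intro exI[of _ e]) simp
  qed
qed (use assms in \<open>auto simp: dist_of_real\<close>)

text \<open>The derivative of \<open>h\<close> is bounded on a compact neighbourhood
  \<open>C'\<close> of the curve. It contains a closed disc around each point of the curve, and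
  these are convex, so the mean value inequality gives a Lipschitz bound at scale
  \<open>e/2\<close>.\<close>

lemma abs_continuous_on_holomorphic_image:
  assumes \<sigma>: "abs_continuous_on {a..b} \<sigma>" "\<sigma> ` {a..b} \<subseteq> \<Omega>"
    and h: "open \<Omega>" "h holomorphic_on \<Omega>"
  shows "abs_continuous_on {a..b} (\<lambda>t. h (\<sigma> t))"
proof -
  define C where "C = \<sigma> ` {a..b}"
  have C: "compact C" unfolding C_def
    by (intro compact_continuous_image abs_continuous_on_imp_continuous_on \<sigma>(1)) auto
  obtain e where "e > 0" and e: "(\<Union>x\<in>C. ball x e) \<subseteq> \<Omega>"
    using compact_subset_open_imp_ball_epsilon_subset[OF C h(1)] \<sigma>(2) unfolding C_def by metis
  define C' where "C' = {x + y | x y. x \<in> C \<and> y \<in> cball 0 (e/2)}"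
  have "compact C'" unfolding C'_def by (intro compact_sums C) auto
  have cb: "cball x (e/2) \<subseteq> C'" if "x \<in> C" for x
  proof
    fix y assume "y \<in> cball x (e/2)"
    then have "y = x + (y - x)" "y - x \<in> cball 0 (e/2)" by (auto simp: dist_norm norm_minus_commute)
    with that show "y \<in> C'" unfolding C'_def by blast
  qed
  have C'\<Omega>: "C' \<subseteq> \<Omega>"
  proof
    fix z assume "z \<in> C'"
    then obtain x y where "x \<in> C" "z = x + y" "norm y \<le> e/2" by (auto simp: C'_def)
    then have "z \<in> ball x e" using \<open>e > 0\<close> by (auto simp: dist_norm)
    with e \<open>x \<in> C\<close> show "z \<in> \<Omega>" by blast
  qed
  have "compact (deriv h ` C')"
    using \<open>compact C'\<close> C'\<Omega> h
    by (intro compact_continuous_image) (auto intro: holomorphic_on_imp_continuous_on holomorphic_deriv holomorphic_on_subset)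
  then obtain B where "B > 0" and B: "\<And>x. x \<in> C' \<Longrightarrow> cmod (deriv h x) \<le> B"
    using compact_imp_bounded[of "deriv h ` C'"] unfolding bounded_pos by auto
  show ?thesis
  proof (rule abs_continuous_on_lipschitz_image[OF \<sigma>(1)])
    show "e/2 > 0" "B > 0" using \<open>e > 0\<close> \<open>B > 0\<close> by auto
    fix s t assume st: "s \<in> {a..b}" "t \<in> {a..b}" "dist (\<sigma> s) (\<sigma> t) < e/2"
    then have "\<sigma> s \<in> C" by (auto simp: C_def)
    have "cmod (h (\<sigma> s) - h (\<sigma> t)) \<le> B * cmod (\<sigma> s - \<sigma> t)"
    proof (rule field_differentiable_bound[of "cball (\<sigma> s) (e/2)" h "deriv h"])
      fix z assume z: "z \<in> cball (\<sigma> s) (e/2)"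
      then have "z \<in> C'" using cb \<open>\<sigma> s \<in> C\<close> by blast
      then show "cmod (deriv h z) \<le> B" "(h has_field_derivative deriv h z) (at z within cball (\<sigma> s) (e / 2))"
        using B C'\<Omega> h by (auto intro: holomorphic_derivI)
    qed (use st \<open>e > 0\<close> in auto)
    then show "dist (h (\<sigma> s)) (h (\<sigma> t)) \<le> B * dist (\<sigma> s) (\<sigma> t)" by (simp add: dist_norm)
  qed
qed

lemma has_vector_derivative_imp_local_bound:
  fixes \<sigma> :: "real \<Rightarrow> 'a :: real_normed_vector"
  assumes "(\<sigma> has_vector_derivative v) (at x within S)" "e > 0"
  shows "\<exists>d>0. \<forall>y\<in>S. \<bar>y - x\<bar> < d \<longrightarrow> norm (\<sigma> y - \<sigma> x - (y - x) *\<^sub>R v) \<le> e * \<bar>y - x\<bar>"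
  using assms by (simp add: has_vector_derivative_def has_derivative_within_alt)

lemma sum_length_le_measure:
  fixes D :: "(real \<times> real) set"
  assumes D: "finite D" "\<And>c d. (c, d) \<in> D \<Longrightarrow> c < d \<and> {c<..<d} \<subseteq> T"
    and disj: "pairwise (\<lambda>p q. disjnt {fst p<..<snd p} {fst q<..<snd q}) D"
    and T: "T \<in> lmeasurable"
  shows "(\<Sum>(c, d)\<in>D. d - c) \<le> measure lebesgue T"
proof -
  have "(\<Sum>(c, d)\<in>D. d - c) = (\<Sum>p\<in>D. measure lebesgue {fst p<..<snd p})"
    by (rule sum.cong) (use D(2) in \<open>force+\<close>)
  also have "\<dots> = measure lebesgue (\<Union>p\<in>D. {fst p<..<snd p})"
    using D(1) disj by (subst measure_UNION') (auto simp: lmeasurable_box[where 'a = real, simplified])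
  also have "\<dots> \<le> measure lebesgue T"
  proof (intro measure_mono_fmeasurable sets.finite_UN)
    show "(\<Union>p\<in>D. {fst p<..<snd p}) \<subseteq> T"
    proof (rule UN_least)
      fix p assume "p \<in> D"
      then show "{fst p<..<snd p} \<subseteq> T" using D(2)[of "fst p" "snd p"] by simp
    qed
  qed (use D(1) T in \<open>simp_all add: fmeasurableD\<close>)
  finally show ?thesis .
qed

text \<open>The null set where the derivative bound fails is covered by an open set \<open>T\<close> of small
  measure. Subdivision intervals around such points lie in \<open>T\<close>, so that absolute continuity makes
  their total contribution small.\<close>

lemma abs_continuous_on_dist_le:
  fixes \<sigma> :: "real \<Rightarrow> complex"
  assumes "a \<le> b" and ac: "abs_continuous_on {a..b} \<sigma>"
    and \<phi>: "\<And>t. t \<in> {a..b} \<Longrightarrow> (\<phi> has_real_derivative \<phi>' t) (at t)" "\<And>t. t \<in> {a..b} \<Longrightarrow> 0 \<le> \<phi>' t"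
    and ae: "AE t in lebesgue. t \<in> {a..b} \<longrightarrow>
        (\<exists>v. (\<sigma> has_vector_derivative v) (at t within {a..b}) \<and> cmod v \<le> \<phi>' t)"
  shows "dist (\<sigma> a) (\<sigma> b) \<le> \<phi> b - \<phi> a"
proof (rule field_le_epsilon)
  fix e0 :: real assume "e0 > 0"
  \<comment> \<open>The exceptional intervals contribute \<open>e\<close> in total and the others
    \<open>2 * e * (b - a)\<close>.\<close>
  define e where "e = e0 / (1 + 2 * (b - a))"
  have p: "1 + 2 * (b - a) > 0" using \<open>a \<le> b\<close> by simp
  then have "e > 0" using \<open>e0 > 0\<close> by (simp add: e_def)
  define Q where "Q t \<longleftrightarrow> t \<in> {a..b} \<longrightarrow>
        (\<exists>v. (\<sigma> has_vector_derivative v) (at t within {a..b}) \<and> cmod v \<le> \<phi>' t)" for t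
  have "AE t in lebesgue. Q t" using ae unfolding Q_def .
  then obtain N where N: "N \<in> null_sets lebesgue" and N': "{t \<in> space lebesgue. \<not> Q t} \<subseteq> N"
    unfolding eventually_ae_filter by blast
  have Nb: "\<exists>v. (\<sigma> has_vector_derivative v) (at t within {a..b}) \<and> cmod v \<le> \<phi>' t"
    if "t \<in> {a..b}" "t \<notin> N" for t
    using N' that by (auto simp: Q_def)
  obtain \<delta> where "\<delta> > 0" and \<delta>: "\<And>D :: (real \<times> real) set. finite D \<Longrightarrow> (\<forall>(c, d)\<in>D. c < d \<and> c \<in> {a..b} \<and> d \<in> {a..b}) \<Longrightarrow>
        pairwise (\<lambda>p q. disjnt {fst p<..<snd p} {fst q<..<snd q}) D \<Longrightarrow>
        (\<Sum>(c, d)\<in>D. d - c) < \<delta> \<Longrightarrow> (\<Sum>(c, d)\<in>D. dist (\<sigma> c) (\<sigma> d)) < e"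
    using ac \<open>e > 0\<close> unfolding abs_continuous_on_def by meson
  obtain T where T: "open T" "N \<subseteq> T" "T - N \<in> lmeasurable" "emeasure lebesgue (T - N) < ennreal \<delta>"
    using sets_lebesgue_outer_open[OF null_setsD2[OF N] \<open>\<delta> > 0\<close>] .
  have Teq: "T = (T - N) \<union> N" using T(2) by auto
  have "(T - N) \<union> N \<in> lmeasurable" by (intro fmeasurable.Un T(3) fmeasurableI_null_sets N)
  then have Tm: "T \<in> lmeasurable" using Teq by simp
  have "emeasure lebesgue ((T - N) \<union> N) = emeasure lebesgue (T - N)"
    by (rule emeasure_Un_null_set[OF fmeasurableD[OF T(3)] N])
  then have "emeasure lebesgue T = emeasure lebesgue (T - N)" using Teq by simp
  then have "ennreal (measure lebesgue T) < ennreal \<delta>"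
    using T(4) emeasure_eq_measure2[OF Tm] by simp
  then have mT: "measure lebesgue T < \<delta>" by (simp add: ennreal_less_iff)
  \<comment> \<open>\<open>P\<close> is made for bisection: it passes from two adjacent intervals to
    their union and holds on short intervals. \<open>D\<close> collects the intervals around
    exceptional points; elsewhere the differentials of \<sigma> and \<phi> each leave an error of
    \<open>e\<close> times the length. The premise disposes of short intervals that stick out of
    \<open>{a..b}\<close>.\<close>
  define P where "P u v \<longleftrightarrow> (a \<le> u \<and> v \<le> b \<longrightarrow> (\<exists>D. finite D \<and> (\<forall>(c, d)\<in>D. c < d \<and> {c<..<d} \<subseteq> T \<and> u \<le> c \<and> d \<le> v) \<and>
      pairwise (\<lambda>p q. disjnt {fst p<..<snd p} {fst q<..<snd q}) D \<and>
      dist (\<sigma> u) (\<sigma> v) \<le> (\<Sum>(c, d)\<in>D. dist (\<sigma> c) (\<sigma> d)) + (\<phi> v - \<phi> u) + 2 * e * (v - u)))" for u v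
  have mono: "\<phi> u \<le> \<phi> v" if "a \<le> u" "u \<le> v" "v \<le> b" for u v
  proof (rule DERIV_nonneg_imp_nondecreasing[OF \<open>u \<le> v\<close>])
    fix x assume "u \<le> x" "x \<le> v"
    then have "x \<in> {a..b}" using that by simp
    with \<phi> show "\<exists>y. (\<phi> has_real_derivative y) (at x) \<and> 0 \<le> y" by blast
  qed
  have "P a b"
    using \<open>a \<le> b\<close>
  proof (induct rule: Bolzano)
    case (trans u v w)
    show ?case unfolding P_def
    proof (intro impI)
      assume uw: "a \<le> u \<and> w \<le> b"
      obtain D1 where D1: "finite D1" "\<forall>(c, d)\<in>D1. c < d \<and> {c<..<d} \<subseteq> T \<and> u \<le> c \<and> d \<le> v"
        "pairwise (\<lambda>p q. disjnt {fst p<..<snd p} {fst q<..<snd q}) D1"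
        "dist (\<sigma> u) (\<sigma> v) \<le> (\<Sum>(c, d)\<in>D1. dist (\<sigma> c) (\<sigma> d)) + (\<phi> v - \<phi> u) + 2 * e * (v - u)"
        using trans(1,4) uw unfolding P_def by auto
      obtain D2 where D2: "finite D2" "\<forall>(c, d)\<in>D2. c < d \<and> {c<..<d} \<subseteq> T \<and> v \<le> c \<and> d \<le> w"
        "pairwise (\<lambda>p q. disjnt {fst p<..<snd p} {fst q<..<snd q}) D2"
        "dist (\<sigma> v) (\<sigma> w) \<le> (\<Sum>(c, d)\<in>D2. dist (\<sigma> c) (\<sigma> d)) + (\<phi> w - \<phi> v) + 2 * e * (w - v)"
        using trans(2,3) uw unfolding P_def by auto
      have cross: "disjnt {fst p<..<snd p} {fst q<..<snd q}" if "p \<in> D1" "q \<in> D2" for p q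
        using that D1(2) D2(2) by (fastforce simp: disjnt_iff)
      have "pairwise (\<lambda>p q. disjnt {fst p<..<snd p} {fst q<..<snd q}) (D1 \<union> D2)"
        unfolding pairwise_def
      proof (intro ballI impI)
        fix p q assume "p \<in> D1 \<union> D2" "q \<in> D1 \<union> D2" "p \<noteq> q"
        then show "disjnt {fst p<..<snd p} {fst q<..<snd q}"
          using D1(3) D2(3) cross[of p q] cross[of q p] by (auto simp: pairwise_def disjnt_sym)
      qed
      moreover have "D1 \<inter> D2 = {}" using D1(2) D2(2) by fastforce
      then have "(\<Sum>(c, d)\<in>D1 \<union> D2. dist (\<sigma> c) (\<sigma> d)) = (\<Sum>(c, d)\<in>D1. dist (\<sigma> c) (\<sigma> d)) + (\<Sum>(c, d)\<in>D2. dist (\<sigma> c) (\<sigma> d))"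
        using D1(1) D2(1) by (intro sum.union_disjoint)
      then have "dist (\<sigma> u) (\<sigma> w) \<le> (\<Sum>(c, d)\<in>D1 \<union> D2. dist (\<sigma> c) (\<sigma> d)) + (\<phi> w - \<phi> u) + 2 * e * (w - u)"
        using D1(4) D2(4) dist_triangle[of "\<sigma> u" "\<sigma> w" "\<sigma> v"] by (simp add: algebra_simps)
      moreover have "\<forall>(c, d)\<in>D1 \<union> D2. c < d \<and> {c<..<d} \<subseteq> T \<and> u \<le> c \<and> d \<le> w"
        using D1(2) D2(2) trans(3,4) by fastforce
      ultimately show "\<exists>D. finite D \<and> (\<forall>(c, d)\<in>D. c < d \<and> {c<..<d} \<subseteq> T \<and> u \<le> c \<and> d \<le> w) \<and>
        pairwise (\<lambda>p q. disjnt {fst p<..<snd p} {fst q<..<snd q}) D \<and>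
        dist (\<sigma> u) (\<sigma> w) \<le> (\<Sum>(c, d)\<in>D. dist (\<sigma> c) (\<sigma> d)) + (\<phi> w - \<phi> u) + 2 * e * (w - u)"
        using D1(1) D2(1) by (intro exI[of _ "D1 \<union> D2"]) auto
    qed
  next
    case (local x)
    show ?case
    proof (cases "x \<in> N")
      case True
      then obtain r where r: "r > 0" "ball x r \<subseteq> T" using T(1,2) openE by blast
      have "P u v" if "u \<le> x" "x \<le> v" "v - u < r" for u v
      proof (cases "u < v")
        case True
        show ?thesis unfolding P_def
        proof (intro impI exI[of _ "{(u, v)}"] conjI)
          show "\<forall>(c, d)\<in>{(u, v)}. c < d \<and> {c<..<d} \<subseteq> T \<and> u \<le> c \<and> d \<le> v"
            using True r(2) that by (auto simp: subset_eq dist_real_def)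
          assume "a \<le> u \<and> v \<le> b"
          then show "dist (\<sigma> u) (\<sigma> v) \<le> (\<Sum>(c, d)\<in>{(u, v)}. dist (\<sigma> c) (\<sigma> d)) + (\<phi> v - \<phi> u) + 2 * e * (v - u)"
          proof -
            have "0 \<le> 2 * e * (v - u)" using True \<open>e > 0\<close> by (intro mult_nonneg_nonneg) auto
            moreover have "\<phi> u \<le> \<phi> v" using mono[of u v] True \<open>a \<le> u \<and> v \<le> b\<close> by simp
            ultimately show ?thesis by simp
          qed
        qed auto
      next
        case False
        then have "u = v" using that by simp
        then show ?thesis unfolding P_def by (intro impI exI[of _ "{}"]) auto
      qed
      with r(1) show ?thesis by blast
    next
      case False
      then obtain w where w: "(\<sigma> has_vector_derivative w) (at x within {a..b})" "cmod w \<le> \<phi>' x"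
        using Nb local by force
      have \<phi>v: "(\<phi> has_vector_derivative \<phi>' x) (at x within {a..b})"
        using \<phi>(1)[of x] local has_real_derivative_iff_has_vector_derivative has_vector_derivative_at_within by auto
      obtain d1 where d1: "d1 > 0" "\<And>y. y \<in> {a..b} \<Longrightarrow> \<bar>y - x\<bar> < d1 \<Longrightarrow> cmod (\<sigma> y - \<sigma> x - (y - x) *\<^sub>R w) \<le> e * \<bar>y - x\<bar>"
        using has_vector_derivative_imp_local_bound[OF w(1) \<open>e > 0\<close>] by blast
      obtain d2 where d2: "d2 > 0" "\<And>y. y \<in> {a..b} \<Longrightarrow> \<bar>y - x\<bar> < d2 \<Longrightarrow> \<bar>\<phi> y - \<phi> x - (y - x) * \<phi>' x\<bar> \<le> e * \<bar>y - x\<bar>"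
        using has_vector_derivative_imp_local_bound[OF \<phi>v \<open>e > 0\<close>] by auto
      have pt: "dist (\<sigma> y) (\<sigma> x) \<le> \<bar>\<phi> y - \<phi> x\<bar> + 2 * e * \<bar>y - x\<bar>" if y: "y \<in> {a..b}" "\<bar>y - x\<bar> < min d1 d2" for y
      proof -
        have "dist (\<sigma> y) (\<sigma> x) = cmod ((\<sigma> y - \<sigma> x - (y - x) *\<^sub>R w) + (y - x) *\<^sub>R w)" by (simp add: dist_norm)
        also have "\<dots> \<le> e * \<bar>y - x\<bar> + \<bar>y - x\<bar> * cmod w"
          using d1(2)[OF y(1)] y(2) norm_triangle_ineq[of "\<sigma> y - \<sigma> x - (y - x) *\<^sub>R w" "(y - x) *\<^sub>R w"] by simp
        also have "\<bar>y - x\<bar> * cmod w \<le> \<bar>y - x\<bar> * \<phi>' x" using w(2) by (intro mult_left_mono) auto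
        also have "\<bar>y - x\<bar> * \<phi>' x = \<bar>(y - x) * \<phi>' x\<bar>" using \<phi>(2)[of x] local by (simp add: abs_mult)
        also have "\<dots> \<le> \<bar>\<phi> y - \<phi> x\<bar> + e * \<bar>y - x\<bar>" using d2(2)[OF y(1)] y(2) by linarith
        finally show ?thesis by simp
      qed
      have "P u v" if uv: "u \<le> x" "x \<le> v" "v - u < min d1 d2" for u v
        unfolding P_def
      proof (intro impI exI[of _ "{}"] conjI)
        assume ab: "a \<le> u \<and> v \<le> b"
        have "dist (\<sigma> u) (\<sigma> x) \<le> (\<phi> x - \<phi> u) + 2 * e * (x - u)"
          using pt[of u] mono[of u x] ab uv by auto
        moreover have "dist (\<sigma> v) (\<sigma> x) \<le> (\<phi> v - \<phi> x) + 2 * e * (v - x)"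
          using pt[of v] mono[of x v] ab uv by auto
        ultimately show "dist (\<sigma> u) (\<sigma> v) \<le> (\<Sum>(c, d)\<in>{}. dist (\<sigma> c) (\<sigma> d)) + (\<phi> v - \<phi> u) + 2 * e * (v - u)"
          using dist_triangle2[of "\<sigma> u" "\<sigma> v" "\<sigma> x"] by (simp add: algebra_simps)
      qed auto
      moreover have "min d1 d2 > 0" using d1(1) d2(1) by simp
      ultimately show ?thesis by blast
    qed
  qed
  then obtain D where D: "finite D" "\<And>c d. (c, d) \<in> D \<Longrightarrow> c < d \<and> {c<..<d} \<subseteq> T \<and> a \<le> c \<and> d \<le> b"
      "pairwise (\<lambda>p q. disjnt {fst p<..<snd p} {fst q<..<snd q}) D"
      "dist (\<sigma> a) (\<sigma> b) \<le> (\<Sum>(c, d)\<in>D. dist (\<sigma> c) (\<sigma> d)) + (\<phi> b - \<phi> a) + 2 * e * (b - a)"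
    unfolding P_def by fast
  have "(\<Sum>(c, d)\<in>D. d - c) \<le> measure lebesgue T"
    using D(2) by (intro sum_length_le_measure D(1,3) Tm) auto
  then have "(\<Sum>(c, d)\<in>D. d - c) < \<delta>" using mT by simp
  moreover have "\<forall>(c, d)\<in>D. c < d \<and> c \<in> {a..b} \<and> d \<in> {a..b}"
    using D(2) by force
  ultimately have "(\<Sum>(c, d)\<in>D. dist (\<sigma> c) (\<sigma> d)) < e"
    by (intro \<delta> D(1,3))
  with D(4) have "dist (\<sigma> a) (\<sigma> b) \<le> (\<phi> b - \<phi> a) + e * (1 + 2 * (b - a))" by (simp add: algebra_simps)
  also have "e * (1 + 2 * (b - a)) = e0" using p by (simp add: e_def)
  finally show "dist (\<sigma> a) (\<sigma> b) \<le> \<phi> b - \<phi> a + e0" .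
qed


subsection \<open>Almost-geodesics under a Riemann map\<close>

text \<open>Along an almost-geodesic \<open>1 - \<bar>\<tau> t\<bar>\<^sup>2\<close> decays exponentially in the distance of \<open>t\<close> from the
  time \<open>t\<^sub>0\<close> at which it is maximal. Taking the geometric mean of this bound with the uniform
  bound \<open>e\<close> gives an integrable bound for the speed that is small with \<open>e\<close>.\<close>

lemma disc_almost_geodesic_diameter:
  fixes \<tau> :: "real \<Rightarrow> complex"
  assumes "L \<ge> 1" and ac: "abs_continuous_on {0..T} \<tau>"
    and disc: "\<And>t. t \<in> {0..T} \<Longrightarrow> cmod (\<tau> t) < 1"
    and dist: "\<And>s t. s \<in> {0..T} \<Longrightarrow> t \<in> {0..T} \<Longrightarrow> 1 / L * \<bar>s - t\<bar> - \<kappa> \<le> poincare_dist (\<tau> s) (\<tau> t)"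
    and ae: "AE t in lebesgue. t \<in> {0..T} \<longrightarrow>
        (\<exists>v. (\<tau> has_vector_derivative v) (at t within {0..T}) \<and> cmod v \<le> L * (1 - (cmod (\<tau> t))\<^sup>2))"
    and e: "\<And>t. t \<in> {0..T} \<Longrightarrow> 1 - (cmod (\<tau> t))\<^sup>2 \<le> e"
    and st: "s \<in> {0..T}" "t \<in> {0..T}"
  shows "dist (\<tau> s) (\<tau> t) \<le> 8 * L\<^sup>2 * sqrt (e * exp \<kappa>)"
proof -
  define \<delta> where "\<delta> t = 1 - (cmod (\<tau> t))\<^sup>2" for t
  have \<delta>pos: "\<delta> t > 0" if "t \<in> {0..T}" for t
    using disc[OF that] by (simp add: \<delta>_def abs_square_less_1)
  have "continuous_on {0..T} \<delta>"
    unfolding \<delta>_def using abs_continuous_on_imp_continuous_on[OF ac] by (intro continuous_intros)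
  then obtain t0 where t0: "t0 \<in> {0..T}" "\<And>t. t \<in> {0..T} \<Longrightarrow> \<delta> t \<le> \<delta> t0"
    using continuous_attains_sup[of "{0..T}" \<delta>] st by auto
  \<comment> \<open>\<open>A\<close> and the rate \<open>c\<close> below come from the geometric
    mean of the bounds \<open>e\<close> and
    \<open>4 * exp \<kappa> * exp (- \<bar>t - t0\<bar> / L)\<close>.\<close>
  define A where "A = 2 * sqrt (e * exp \<kappa>)"
  define c where "c = 1 / (2 * L)"
  have c: "c > 0" "2 * L * c = 1" using \<open>L \<ge> 1\<close> by (auto simp: c_def)
  have e0: "e > 0" using \<delta>pos[OF t0(1)] e[OF t0(1)] by (simp add: \<delta>_def)
  then have A: "A \<ge> 0" by (simp add: A_def)
  have bound: "\<delta> t \<le> A * exp (- c * \<bar>t - t0\<bar>)" if t: "t \<in> {0..T}" for t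
  proof -
    define E where "E = exp (2 * poincare_dist (\<tau> t) (\<tau> t0))"
    define X where "X = 1 / L * \<bar>t - t0\<bar> - \<kappa>"
    have El: "exp (2 * X) \<le> E" using dist[OF t t0(1)] by (simp add: E_def X_def)
    have "exp (2 * X) * (\<delta> t * \<delta> t) \<le> E * (\<delta> t * \<delta> t)"
      using El by (intro mult_right_mono) auto
    \<comment> \<open>Maximality at \<open>t0\<close> lets a bound on the product
      \<open>\<delta> t * \<delta> t0\<close> control the square of
      \<open>\<delta> t\<close>.\<close>
    also have "\<dots> \<le> E * (\<delta> t * \<delta> t0)"
      using t0(2)[OF t] \<delta>pos[OF t] by (intro mult_left_mono) (auto simp: E_def)
    also have "\<dots> \<le> 16"
      using exp_poincare_dist_le[OF disc[OF t] disc[OF t0(1)]] by (simp add: \<delta>_def E_def)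
    finally have "exp (2 * X) * (\<delta> t * \<delta> t) \<le> 16" .
    moreover have "exp (2 * X) * (\<delta> t * \<delta> t) = (exp X * \<delta> t)\<^sup>2"
      unfolding exp_double by (simp add: power_mult_distrib power2_eq_square)
    ultimately have "(exp X * \<delta> t)\<^sup>2 \<le> 4\<^sup>2" by simp
    then have "exp X * \<delta> t \<le> 4" by (rule power2_le_imp_le) simp
    then have "\<delta> t \<le> 4 * exp (- X)" by (simp add: exp_minus field_simps)
    also have "- X = \<kappa> + - (2 * c * \<bar>t - t0\<bar>)" by (simp add: c_def X_def)
    finally have "\<delta> t \<le> 4 * (exp \<kappa> * exp (- (2 * c * \<bar>t - t0\<bar>)))" by (simp only: exp_add)
    then have "\<delta> t * \<delta> t \<le> e * (4 * (exp \<kappa> * exp (- (2 * c * \<bar>t - t0\<bar>))))"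
      using e[OF t] \<delta>pos[OF t] e0 by (intro mult_mono) (auto simp: \<delta>_def)
    also have "exp (- (2 * c * \<bar>t - t0\<bar>)) = (exp (- c * \<bar>t - t0\<bar>))\<^sup>2"
      using exp_double[of "- c * \<bar>t - t0\<bar>"] by (simp add: algebra_simps)
    also have "e * (4 * (exp \<kappa> * (exp (- c * \<bar>t - t0\<bar>))\<^sup>2)) = (A * exp (- c * \<bar>t - t0\<bar>))\<^sup>2"
      using e0 by (simp add: A_def power_mult_distrib)
    finally have "(\<delta> t)\<^sup>2 \<le> (A * exp (- c * \<bar>t - t0\<bar>))\<^sup>2" by (simp add: power2_eq_square)
    then show ?thesis by (rule power2_le_imp_le) (use A in simp)
  qed
  have LA: "L * A / c = 4 * L\<^sup>2 * sqrt (e * exp \<kappa>)"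
    using \<open>L \<ge> 1\<close> by (simp add: A_def c_def power2_eq_square)
  have LA0: "L * A \<ge> 0" using A \<open>L \<ge> 1\<close> by simp
  have main: "dist (\<tau> t) (\<tau> t0) \<le> L * A / c" if t: "t \<in> {0..T}" for t
  proof -
    \<comment> \<open>Between \<open>t\<close> and \<open>t0\<close> the sign of
      \<open>u - t0\<close> is constant, so that with \<open>sg\<close> the exponential bound
      becomes a smooth function with the explicit antiderivative \<phi>. Its total increase is at
      most \<open>L * A / c\<close>.\<close>
    define sg where "sg = (if t \<le> t0 then -1 else 1 :: real)"
    define \<phi> where "\<phi> u = - sg * (L * A / c) * exp (- c * (sg * (u - t0)))" for u
    define a b where "a = min t t0" and "b = max t t0"
    have sub: "{a..b} \<subseteq> {0..T}" using t t0(1) by (auto simp: a_def b_def)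
    have sg: "sg * (u - t0) = \<bar>u - t0\<bar>" if "u \<in> {a..b}" for u
      using that by (auto simp: sg_def a_def b_def min_def max_def split: if_splits)
    have sg2: "sg * sg = 1" by (simp add: sg_def)
    have "dist (\<tau> a) (\<tau> b) \<le> \<phi> b - \<phi> a"
    proof (rule abs_continuous_on_dist_le[where \<phi>' = "\<lambda>u. L * A * exp (- c * (sg * (u - t0)))"])
      show "a \<le> b" by (simp add: a_def b_def)
      show "abs_continuous_on {a..b} \<tau>" by (rule abs_continuous_on_subset[OF ac sub])
      show "(\<phi> has_real_derivative L * A * exp (- c * (sg * (u - t0)))) (at u)" for u
      proof -
        have "(\<phi> has_real_derivative - sg * (L * A / c) * (exp (- c * (sg * (u - t0))) * (- c * sg))) (at u)"
          unfolding \<phi>_def by (auto intro!: derivative_eq_intros)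
        moreover have "- sg * (L * A / c) * (exp (- c * (sg * (u - t0))) * (- c * sg))
            = (sg * sg) * (L * A) * exp (- c * (sg * (u - t0)))"
          using c(1) by simp
        ultimately show ?thesis by (simp only: sg2 mult_1)
      qed
      show "0 \<le> L * A * exp (- c * (sg * (u - t0)))" for u using LA0 by simp
      show "AE u in lebesgue. u \<in> {a..b} \<longrightarrow> (\<exists>v. (\<tau> has_vector_derivative v) (at u within {a..b}) \<and>
          cmod v \<le> L * A * exp (- c * (sg * (u - t0))))"
        using ae
      proof eventually_elim
        case (elim u)
        show ?case
        proof
          assume u: "u \<in> {a..b}"
          then have u': "u \<in> {0..T}" using sub by blast
          with elim obtain v where v: "(\<tau> has_vector_derivative v) (at u within {0..T})" "cmod v \<le> L * \<delta> u"
            by (auto simp: \<delta>_def)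
          have "L * \<delta> u \<le> L * (A * exp (- c * \<bar>u - t0\<bar>))"
            using bound[OF u'] \<open>L \<ge> 1\<close> by (intro mult_left_mono) auto
          then have "cmod v \<le> L * A * exp (- c * (sg * (u - t0)))" using v(2) sg[OF u] by (simp add: mult.assoc)
          with has_vector_derivative_within_subset[OF v(1) sub]
          show "\<exists>v. (\<tau> has_vector_derivative v) (at u within {a..b}) \<and> cmod v \<le> L * A * exp (- c * (sg * (u - t0)))"
            by blast
        qed
      qed
    qed
    also have "\<phi> b - \<phi> a \<le> L * A / c"
    proof -
      have "L * A / c * exp (- c * \<bar>t - t0\<bar>) \<ge> 0" using LA0 c by simp
      then show ?thesis by (auto simp: \<phi>_def sg_def a_def b_def min_def max_def algebra_simps)
    qed
    finally show ?thesis by (simp add: a_def b_def min_def max_def dist_commute split: if_splits)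
  qed
  \<comment> \<open>The detour over \<open>t0\<close> doubles the factor \<open>4\<close> in
    \<open>LA\<close> to the \<open>8\<close> of the claim.\<close>
  have "dist (\<tau> s) (\<tau> t) \<le> dist (\<tau> s) (\<tau> t0) + dist (\<tau> t) (\<tau> t0)" by (rule dist_triangle2)
  also have "\<dots> \<le> L * A / c + L * A / c" by (rule add_mono[OF main[OF st(1)] main[OF st(2)]])
  finally show ?thesis unfolding LA by (simp add: mult_ac)
qed

section \<open>The Kobayashi distance and metric in disc coordinates\<close>

locale riemann_map =
  fixes \<Omega> :: "complex set" and f h :: "complex \<Rightarrow> complex"
  assumes open_domain: "open \<Omega>"
    and hol_f: "f holomorphic_on ball 0 1" and hol_h: "h holomorphic_on \<Omega>"
    and f_in: "\<And>z. cmod z < 1 \<Longrightarrow> f z \<in> \<Omega>" and h_f: "\<And>z. cmod z < 1 \<Longrightarrow> h (f z) = z"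
    and h_in: "\<And>z. z \<in> \<Omega> \<Longrightarrow> cmod (h z) < 1" and f_h: "\<And>z. z \<in> \<Omega> \<Longrightarrow> f (h z) = z"
begin

lemma f_image: "f ` ball 0 1 = \<Omega>"
proof
  show "\<Omega> \<subseteq> f ` ball 0 1"
  proof
    fix z assume "z \<in> \<Omega>"
    then have "z = f (h z)" "h z \<in> ball 0 1" using f_h h_in by auto
    then show "z \<in> f ` ball 0 1" by (rule image_eqI)
  qed
qed (auto simp: f_in)

lemma inj_f: "inj_on f (ball 0 1)"
  by (rule inj_on_inverseI[where g = h]) (simp add: h_f)

lemma hol_discs_comp: "F \<in> hol_discs \<Omega> \<Longrightarrow> (h \<circ> F) holomorphic_on ball 0 1 \<and> (h \<circ> F) ` ball 0 1 \<subseteq> ball 0 1"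
proof
  assume F: "F \<in> hol_discs \<Omega>"
  then show "(h \<circ> F) holomorphic_on ball 0 1"
    unfolding hol_discs_def by (intro holomorphic_on_compose_gen[OF _ hol_h]) auto
  show "(h \<circ> F) ` ball 0 1 \<subseteq> ball 0 1"
    using F h_in unfolding hol_discs_def by (auto simp: image_subset_iff)
qed

text \<open>By Schwarz--Pick for \<open>h \<circ> F i\<close> no link of a chain is shorter than the
  distance of its end points seen in the disc, and the triangle inequality sums the links up. The
  one-link chain given by \<open>f\<close> attains the bound.\<close>

lemma kobayashi_dist_eq:
  assumes z: "z \<in> \<Omega>" and w: "w \<in> \<Omega>"
  shows "kobayashi_dist \<Omega> z w = poincare_dist (h z) (h w)"
proof -
  let ?S = "{(\<Sum>i<n. poincare_dist (a i) (b i)) | (n::nat) p F a b.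
            0 < n \<and> p 0 = z \<and> p n = w \<and>
            (\<forall>i<n. F i \<in> hol_discs \<Omega> \<and> a i \<in> ball 0 1 \<and> b i \<in> ball 0 1 \<and>
                   F i (a i) = p i \<and> F i (b i) = p (Suc i))}"
  have "Inf ?S = poincare_dist (h z) (h w)"
  proof (rule cInf_eq_minimum)
    have "f \<in> hol_discs \<Omega>" unfolding hol_discs_def using hol_f f_image by auto
    then show "poincare_dist (h z) (h w) \<in> ?S"
      using z w h_in f_h
      by (intro CollectI exI[of _ "1::nat"] exI[of _ "\<lambda>i. if i = 0 then z else w"] exI[of _ "\<lambda>_. f"]
          exI[of _ "\<lambda>_. h z"] exI[of _ "\<lambda>_. h w"]) auto
  next
    fix x assume "x \<in> ?S"
    then obtain n :: nat and p F a b where n: "0 < n" "p 0 = z" "p n = w"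
      and x: "x = (\<Sum>i<n. poincare_dist (a i) (b i))"
      and F: "\<And>i. i < n \<Longrightarrow> F i \<in> hol_discs \<Omega> \<and> a i \<in> ball 0 1 \<and> b i \<in> ball 0 1 \<and> F i (a i) = p i \<and> F i (b i) = p (Suc i)"
      by blast
    have p\<Omega>: "p i \<in> \<Omega>" if "i \<le> n" for i
    proof (cases "i = n")
      case False
      then have Fi: "F i \<in> hol_discs \<Omega>" "a i \<in> ball 0 1" "F i (a i) = p i" using F[of i] that by simp_all
      then have "F i (a i) \<in> \<Omega>" unfolding hol_discs_def image_subset_iff by blast
      with Fi(3) show ?thesis by simp
    qed (use n w in simp)
    have "poincare_dist (h (p 0)) (h (p k)) \<le> (\<Sum>i<k. poincare_dist (a i) (b i))" if "k \<le> n" for k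
      using that
    proof (induction k)
      case 0
      then show ?case by (simp add: poincare_dist_def)
    next
      case (Suc k)
      then have "k < n" by simp
      note Fk = F[OF this]
      have "cmod (a k) < 1" "cmod (b k) < 1" using Fk by simp_all
      with hol_discs_comp[of "F k"] Fk
      have "poincare_dist ((h \<circ> F k) (a k)) ((h \<circ> F k) (b k)) \<le> poincare_dist (a k) (b k)"
        by (intro Schwarz_Pick[of "h \<circ> F k"]) blast+
      then have "poincare_dist (h (p k)) (h (p (Suc k))) \<le> poincare_dist (a k) (b k)" using Fk by simp
      moreover have "poincare_dist (h (p 0)) (h (p (Suc k)))
          \<le> poincare_dist (h (p 0)) (h (p k)) + poincare_dist (h (p k)) (h (p (Suc k)))"
        using Suc.prems by (intro poincare_dist_triangle h_in p\<Omega>) auto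
      ultimately show ?case using Suc by simp
    qed
    from this[of n] show "poincare_dist (h z) (h w) \<le> x" using n x by simp
  qed
  then show ?thesis by (simp add: kobayashi_dist_def)
qed

text \<open>Each competing disc \<open>F\<close> gives a self-map \<open>h \<circ> F\<close> of the
  unit disc, whose derivative at \<open>0\<close> is bounded by \<open>cmod_deriv_le_disc\<close>.
  An affine disc in a small ball shows that there are competitors, so that the infimum is
  meaningful.\<close>

lemma cmod_deriv_h_le:
  assumes z: "z \<in> \<Omega>"
  shows "cmod (deriv h z * v) \<le> (1 - (cmod (h z))\<^sup>2) * kobayashi_metric \<Omega> z v"
proof -
  let ?S = "{\<alpha>::real. 0 < \<alpha> \<and> (\<exists>F\<in>hol_discs \<Omega>. F 0 = z \<and> of_real \<alpha> * deriv F 0 = v)}"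
  define q where "q = 1 - (cmod (h z))\<^sup>2"
  have q: "q > 0" using h_in[OF z] by (simp add: q_def abs_square_less_1)
  have "cmod (deriv h z * v) / q \<le> Inf ?S"
  proof (rule cInf_greatest)
    obtain r where r: "r > 0" "ball z r \<subseteq> \<Omega>" using open_domain z openE by blast
    \<comment> \<open>The summand \<open>1\<close> keeps \<alpha> positive for \<open>v = 0\<close>
      and makes the radius \<open>cmod v / \<alpha>\<close> of the affine disc strictly less than
      \<open>r\<close>.\<close>
    define \<alpha> where "\<alpha> = (cmod v + 1) / r"
    have \<alpha>: "\<alpha> > 0" unfolding \<alpha>_def using r(1) by (intro divide_pos_pos add_nonneg_pos) auto
    define F where "F w = z + v / of_real \<alpha> * w" for w
    have "cmod (v / of_real \<alpha>) < r"
    proof -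
      have "cmod (v / of_real \<alpha>) = cmod v / \<alpha>" using \<alpha> by (simp add: norm_divide)
      also have "\<dots> = cmod v * (r / (cmod v + 1))" by (simp add: \<alpha>_def)
      also have "\<dots> < (cmod v + 1) * (r / (cmod v + 1))"
        using r(1) by (intro mult_strict_right_mono divide_pos_pos add_nonneg_pos) auto
      also have "\<dots> = r" using add_nonneg_pos[OF norm_ge_zero[of v] zero_less_one] by simp
      finally show ?thesis .
    qed
    moreover have "cmod (v / of_real \<alpha> * w) \<le> cmod (v / of_real \<alpha>)" if "cmod w < 1" for w
      using that mult_left_mono[of "cmod w" 1 "cmod (v / of_real \<alpha>)"] by (simp only: norm_mult) simp
    ultimately have Fr: "cmod (v / of_real \<alpha> * w) < r" if "cmod w < 1" for w
      using that by (meson le_less_trans)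
    have "F ` ball 0 1 \<subseteq> ball z r"
    proof (rule image_subsetI)
      fix w :: complex assume "w \<in> ball 0 1"
      then show "F w \<in> ball z r" using Fr[of w] by (simp add: F_def dist_norm)
    qed
    then have "F ` ball 0 1 \<subseteq> \<Omega>" using r(2) by blast
    then have "F \<in> hol_discs \<Omega>" unfolding hol_discs_def F_def by (auto intro!: holomorphic_intros)
    moreover have "(F has_field_derivative 0 + v / of_real \<alpha> * 1) (at 0)"
      unfolding F_def by (intro DERIV_add DERIV_const DERIV_cmult DERIV_ident)
    then have "(F has_field_derivative v / of_real \<alpha>) (at 0)" by simp
    then have "deriv F 0 = v / of_real \<alpha>" by (rule DERIV_imp_deriv)
    then have "of_real \<alpha> * deriv F 0 = v" using \<alpha> by auto
    moreover have "F 0 = z" by (simp add: F_def)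
    ultimately have "\<alpha> \<in> ?S" using \<alpha> by blast
    then show "?S \<noteq> {}" by blast
  next
    fix \<alpha> assume "\<alpha> \<in> ?S"
    then obtain F where \<alpha>: "0 < \<alpha>" and F: "F \<in> hol_discs \<Omega>" "F 0 = z" "of_real \<alpha> * deriv F 0 = v" by blast
    note hF = hol_discs_comp[OF F(1)]
    have "(F has_field_derivative deriv F 0) (at 0)"
      using F(1) by (intro holomorphic_derivI[where S = "ball 0 1"]) (auto simp: hol_discs_def)
    moreover have "(h has_field_derivative deriv h z) (at (F 0))"
      using holomorphic_derivI[OF hol_h open_domain z] F(2) by simp
    ultimately have "((h \<circ> F) has_field_derivative deriv h z * deriv F 0) (at 0)"
      by (rule DERIV_chain[rotated])
    then have "deriv (h \<circ> F) 0 = deriv h z * deriv F 0" by (rule DERIV_imp_deriv)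
    then have "cmod (deriv h z * deriv F 0) \<le> q"
      using cmod_deriv_le_disc[of "h \<circ> F"] hF F(2) by (simp add: q_def)
    then have "\<alpha> * cmod (deriv h z * deriv F 0) \<le> \<alpha> * q" using \<alpha> by simp
    then have "cmod (deriv h z * v) \<le> \<alpha> * q"
      using \<alpha> unfolding F(3)[symmetric] by (simp add: norm_mult mult_ac)
    then show "cmod (deriv h z * v) / q \<le> \<alpha>" using q by (simp add: field_simps)
  qed
  then show ?thesis using q by (simp add: kobayashi_metric_def q_def field_simps)
qed

text \<open>The competitor is \<open>f\<close> after the automorphism that sends \<open>0\<close> to
  \<open>c\<close>. A preceding rotation by \<open>sgn u\<close> gives its derivative the direction
  required by a positive real factor \<alpha>.\<close>

lemma kobayashi_metric_le:
  assumes c: "cmod c < 1" and u: "u \<noteq> 0"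
  shows "kobayashi_metric \<Omega> (f c) (deriv f c * u) \<le> cmod u / (1 - (cmod c)\<^sup>2)"
proof -
  define q where "q = 1 - (cmod c)\<^sup>2"
  have q: "q > 0" using c by (simp add: q_def abs_square_less_1)
  define m where "m = Moebius_function 0 (- c)"
  define F where "F = f \<circ> (m \<circ> (\<lambda>w. sgn u * w))"
  have sgn: "cmod (sgn u) = 1" using u by (simp add: norm_sgn)
  have rot: "(\<lambda>w. sgn u * w) holomorphic_on ball 0 1" "(\<lambda>w. sgn u * w) ` ball 0 1 \<subseteq> ball 0 1"
    using sgn by (auto intro!: holomorphic_intros simp: norm_mult)
  have m: "m holomorphic_on ball 0 1" "m ` ball 0 1 \<subseteq> ball 0 1"
    using c Moebius_function_norm_lt_1[of "-c"] by (auto simp: m_def intro: Moebius_function_holomorphic)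
  have mr: "(m \<circ> (\<lambda>w. sgn u * w)) holomorphic_on ball 0 1" "(m \<circ> (\<lambda>w. sgn u * w)) ` ball 0 1 \<subseteq> ball 0 1"
    using holomorphic_on_compose_gen[OF rot(1) m(1) rot(2)] image_mono[OF rot(2), of m] m(2)
    by (simp_all only: image_comp[symmetric])
  have "F holomorphic_on ball 0 1"
    unfolding F_def by (rule holomorphic_on_compose_gen[OF mr(1) hol_f mr(2)])
  moreover have "F ` ball 0 1 \<subseteq> \<Omega>"
    using mr(2) f_image unfolding F_def image_comp[symmetric] by blast
  ultimately have "F \<in> hol_discs \<Omega>" by (simp add: hol_discs_def)
  moreover have m0: "m 0 = c" by (simp add: m_def Moebius_function_of_zero)
  then have "F 0 = f c" by (simp add: F_def)
  moreover have "of_real (cmod u / q) * deriv F 0 = deriv f c * u"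
  proof -
    have "(m has_field_derivative (1 - cnj (-c) * (-c)) / (1 - cnj (-c) * 0)\<^sup>2) (at 0)"
      unfolding m_def by (rule Moebius_function_has_field_derivative) (use c in auto)
    moreover have "1 - cnj (-c) * (-c) = of_real q"
      using complex_norm_square[of c] by (simp add: q_def mult.commute)
    ultimately have m': "(m has_field_derivative of_real q) (at (sgn u * 0))" by simp
    have r': "((\<lambda>w. sgn u * w) has_field_derivative sgn u) (at 0)" by (auto intro!: derivative_eq_intros)
    have "(f has_field_derivative deriv f c) (at ((m \<circ> (\<lambda>w. sgn u * w)) 0))"
      using holomorphic_derivI[OF hol_f, of c] c by (simp add: m0)
    then have "(F has_field_derivative deriv f c * (of_real q * sgn u)) (at 0)"
      unfolding F_def by (intro DERIV_chain m' r')
    then have "deriv F 0 = deriv f c * (of_real q * sgn u)" by (rule DERIV_imp_deriv)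
    then show ?thesis using q u by (simp add: sgn_eq)
  qed
  ultimately have "cmod u / q \<in> {\<alpha>::real. 0 < \<alpha> \<and> (\<exists>F\<in>hol_discs \<Omega>. F 0 = f c \<and> of_real \<alpha> * deriv F 0 = deriv f c * u)}"
    using q u by auto
  then have "Inf {\<alpha>::real. 0 < \<alpha> \<and> (\<exists>F\<in>hol_discs \<Omega>. F 0 = f c \<and> of_real \<alpha> * deriv F 0 = deriv f c * u)} \<le> cmod u / q"
    by (rule cInf_lower) (auto intro!: bdd_belowI[of _ 0])
  then show ?thesis by (simp add: kobayashi_metric_def q_def)
qed

text \<open>In the disc coordinate the Kobayashi speed bound \<open>L\<close> becomes a Euclidean
  speed bound of \<open>L\<close> times \<open>1 - (cmod (h (\<sigma> t)))\<^sup>2\<close>, so the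
  estimate for the disc applies to \<open>h \<circ> \<sigma>\<close>.\<close>

lemma almost_geodesic_diameter:
  assumes \<sigma>: "almost_geodesic \<Omega> L \<kappa> {0..T} \<sigma>" and "L \<ge> 1"
    and e: "\<And>t. t \<in> {0..T} \<Longrightarrow> 1 - (cmod (h (\<sigma> t)))\<^sup>2 \<le> e"
    and st: "s \<in> {0..T}" "t \<in> {0..T}"
  shows "dist (h (\<sigma> s)) (h (\<sigma> t)) \<le> 8 * L\<^sup>2 * sqrt (e * exp \<kappa>)"
proof (rule disc_almost_geodesic_diameter[where T = T, OF \<open>L \<ge> 1\<close>])
  have im: "\<sigma> ` {0..T} \<subseteq> \<Omega>" and ac: "abs_continuous_on {0..T} \<sigma>" using \<sigma> by (auto simp: almost_geodesic_def)
  then have \<sigma>in: "\<sigma> u \<in> \<Omega>" if "u \<in> {0..T}" for u using that by auto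
  show "abs_continuous_on {0..T} (\<lambda>t. h (\<sigma> t))"
    by (rule abs_continuous_on_holomorphic_image[OF ac im open_domain hol_h])
  show "cmod (h (\<sigma> u)) < 1" if "u \<in> {0..T}" for u using h_in \<sigma>in that by blast
  show "1 / L * \<bar>u - v\<bar> - \<kappa> \<le> poincare_dist (h (\<sigma> u)) (h (\<sigma> v))" if "u \<in> {0..T}" "v \<in> {0..T}" for u v
    using \<sigma> that kobayashi_dist_eq[OF \<sigma>in \<sigma>in, OF that] unfolding almost_geodesic_def by metis
  have "AE t in lebesgue_on {0..T}.
        \<exists>v. (\<sigma> has_vector_derivative v) (at t within {0..T}) \<and> kobayashi_metric \<Omega> (\<sigma> t) v \<le> L"
    using \<sigma> by (simp add: almost_geodesic_def)
  then have "AE t in lebesgue. t \<in> {0..T} \<longrightarrow>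
        (\<exists>v. (\<sigma> has_vector_derivative v) (at t within {0..T}) \<and> kobayashi_metric \<Omega> (\<sigma> t) v \<le> L)"
    by (subst (asm) AE_restrict_space_iff) auto
  then show "AE t in lebesgue. t \<in> {0..T} \<longrightarrow> (\<exists>v. ((\<lambda>t. h (\<sigma> t)) has_vector_derivative v) (at t within {0..T}) \<and>
      cmod v \<le> L * (1 - (cmod (h (\<sigma> t)))\<^sup>2))"
  proof eventually_elim
    case (elim u)
    show ?case
    proof
      assume u: "u \<in> {0..T}"
      then obtain v where v: "(\<sigma> has_vector_derivative v) (at u within {0..T})" "kobayashi_metric \<Omega> (\<sigma> u) v \<le> L"
        using elim by blast
      have "(h has_field_derivative deriv h (\<sigma> u)) (at (\<sigma> u))"
        by (rule holomorphic_derivI[OF hol_h open_domain \<sigma>in[OF u]])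
      then have "((h \<circ> \<sigma>) has_vector_derivative v * deriv h (\<sigma> u)) (at u within {0..T})"
        by (intro field_vector_diff_chain_within v(1)) (auto intro: has_field_derivative_at_within)
      moreover have "cmod (v * deriv h (\<sigma> u)) \<le> L * (1 - (cmod (h (\<sigma> u)))\<^sup>2)"
      proof -
        have "cmod (deriv h (\<sigma> u) * v) \<le> (1 - (cmod (h (\<sigma> u)))\<^sup>2) * kobayashi_metric \<Omega> (\<sigma> u) v"
          by (rule cmod_deriv_h_le[OF \<sigma>in[OF u]])
        also have "\<dots> \<le> (1 - (cmod (h (\<sigma> u)))\<^sup>2) * L"
          using v(2) h_in[OF \<sigma>in[OF u]] by (intro mult_left_mono) (auto simp: abs_square_le_1)
        finally show ?thesis by (simp add: mult.commute)
      qed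
      ultimately show "\<exists>v. ((\<lambda>t. h (\<sigma> t)) has_vector_derivative v) (at u within {0..T}) \<and>
          cmod v \<le> L * (1 - (cmod (h (\<sigma> u)))\<^sup>2)"
        by (auto simp: o_def)
    qed
  qed
qed (use e st in auto)

end


subsection \<open>The length-area argument\<close>

text \<open>By Bloch's theorem the image of each disc contains a disc of comparable radius, and these are
  disjoint. This replaces the area formula.\<close>

lemma sum_deriv_squares_le:
  fixes G :: "complex \<Rightarrow> complex" and \<zeta> :: "'i \<Rightarrow> complex"
  assumes hol: "G holomorphic_on S" and inj: "inj_on G S"
    and bd: "\<And>w. w \<in> S \<Longrightarrow> cmod (G w) \<le> R" and "R \<ge> 0"
    and I: "finite I" and \<rho>: "\<rho> > 0" and sub: "\<And>i. i \<in> I \<Longrightarrow> ball (\<zeta> i) \<rho> \<subseteq> S"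
    and disj: "\<And>i j. i \<in> I \<Longrightarrow> j \<in> I \<Longrightarrow> i \<noteq> j \<Longrightarrow> ball (\<zeta> i) \<rho> \<inter> ball (\<zeta> j) \<rho> = {}"
  shows "(\<Sum>i\<in>I. (\<rho> * cmod (deriv G (\<zeta> i)) / 12)\<^sup>2) \<le> R\<^sup>2"
proof -
  \<comment> \<open>The constant \<open>1/12\<close> is that of the theorem
    \<open>Bloch\<close>.\<close>
  define r where "r i = \<rho> * cmod (deriv G (\<zeta> i)) / 12" for i
  have r0: "r i \<ge> 0" for i using \<rho> by (simp add: r_def)
  have "\<exists>b. ball b (r i) \<subseteq> G ` ball (\<zeta> i) \<rho>" if "i \<in> I" for i
    using Bloch[of G "\<zeta> i" \<rho> "r i"] holomorphic_on_subset[OF hol sub[OF that]] \<rho>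
    by (metis r_def order_refl)
  then obtain b where b: "\<And>i. i \<in> I \<Longrightarrow> ball (b i) (r i) \<subseteq> G ` ball (\<zeta> i) \<rho>" by metis
  have dj: "disjnt (ball (b i) (r i)) (ball (b j) (r j))" if "i \<in> I" "j \<in> I" "i \<noteq> j" for i j
  proof -
    have "G ` ball (\<zeta> i) \<rho> \<inter> G ` ball (\<zeta> j) \<rho> = G ` (ball (\<zeta> i) \<rho> \<inter> ball (\<zeta> j) \<rho>)"
      using inj_on_image_Int[OF inj sub[OF that(1)] sub[OF that(2)]] by simp
    also have "\<dots> = {}" using disj[OF that] by simp
    finally show ?thesis using b[OF that(1)] b[OF that(2)] unfolding disjnt_def by blast
  qed
  let ?V = "unit_ball_vol 2"
  have "?V * (\<Sum>i\<in>I. (r i)\<^sup>2) = (\<Sum>i\<in>I. measure lebesgue (ball (b i) (r i)))"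
    unfolding sum_distrib_left by (rule sum.cong) (use content_ball[OF r0, where 'a = complex] in auto)
  also have "\<dots> = measure lebesgue (\<Union>i\<in>I. ball (b i) (r i))"
    using I dj by (subst measure_UNION') (auto simp: pairwise_def)
  also have "\<dots> \<le> measure lebesgue (cball (0::complex) R)"
  proof (rule measure_mono_fmeasurable)
    show "(\<Union>i\<in>I. ball (b i) (r i)) \<subseteq> cball 0 R"
    proof (rule UN_least)
      fix i assume "i \<in> I"
      then have "ball (b i) (r i) \<subseteq> G ` S" using b[of i] sub[of i] by blast
      also have "\<dots> \<subseteq> cball 0 R" using bd by auto
      finally show "ball (b i) (r i) \<subseteq> cball 0 R" .
    qed
    show "(\<Union>i\<in>I. ball (b i) (r i)) \<in> sets lebesgue" by (rule sets.finite_UN) (use I in auto)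
  qed auto
  also have "\<dots> = ?V * R\<^sup>2" using content_cball[OF \<open>R \<ge> 0\<close>, of "0::complex"] by simp
  finally show ?thesis
    by (subst (asm) mult_le_cancel_left_pos) (auto simp: r_def)
qed

lemma nat_floor_divide:
  fixes x h :: real
  assumes "0 \<le> x" "0 < h"
  shows "real (nat \<lfloor>x / h\<rfloor>) * h \<le> x" "x < real (nat \<lfloor>x / h\<rfloor>) * h + h"
proof -
  have "0 \<le> x / h" using assms by simp
  then have "real (nat \<lfloor>x / h\<rfloor>) = of_int \<lfloor>x / h\<rfloor>" by simp
  then have "real (nat \<lfloor>x / h\<rfloor>) \<le> x / h" "x / h < real (nat \<lfloor>x / h\<rfloor>) + 1" by linarith+
  then show "real (nat \<lfloor>x / h\<rfloor>) * h \<le> x" "x < real (nat \<lfloor>x / h\<rfloor>) * h + h"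
    using assms(2) by (simp_all add: pos_le_divide_eq pos_divide_less_eq algebra_simps)
qed

text \<open>A sum over \<open>k\<close> pieces of length \<open>h\<close> takes the place of the
  integral of \<open>cmod (deriv G z)\<close>. The sample points, where the derivative is largest on
  each piece, will be centres of discs to which Bloch's theorem applies. The factor \<open>2\<close>
  arises because two points are compared through the lower end of the segment.\<close>

lemma vertical_segment_variation:
  fixes G :: "complex \<Rightarrow> complex"
  assumes hol: "G holomorphic_on S" "open S" and h: "h > 0"
    and sub: "\<And>y. a \<le> y \<Longrightarrow> y \<le> a + real k * h \<Longrightarrow> Complex x y \<in> S"
  obtains \<eta> :: "nat \<Rightarrow> real"
  where "\<And>j. j < k \<Longrightarrow> a + real j * h \<le> \<eta> j \<and> \<eta> j \<le> a + real (Suc j) * h"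
    "\<And>y y'. a \<le> y \<Longrightarrow> y \<le> a + real k * h \<Longrightarrow> a \<le> y' \<Longrightarrow> y' \<le> a + real k * h \<Longrightarrow>
       cmod (G (Complex x y) - G (Complex x y')) \<le> 2 * (h * (\<Sum>j<k. cmod (deriv G (Complex x (\<eta> j)))))"
proof -
  have cont: "continuous_on S (deriv G)"
    using hol by (intro holomorphic_on_imp_continuous_on holomorphic_deriv)
  have cv: "continuous_on A (\<lambda>y. Complex x y)" for A
    unfolding Complex_eq by (intro continuous_intros)
  have "\<exists>e. a + real j * h \<le> e \<and> e \<le> a + real (Suc j) * h \<and>
      (\<forall>y. a + real j * h \<le> y \<longrightarrow> y \<le> a + real (Suc j) * h \<longrightarrow>
         cmod (deriv G (Complex x y)) \<le> cmod (deriv G (Complex x e)))" if "j < k" for j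
  proof -
    let ?J = "{a + real j * h..a + real (Suc j) * h}"
    have "real (Suc j) * h \<le> real k * h" "0 \<le> real j * h" using that h by (auto intro!: mult_right_mono)
    then have "Complex x y \<in> S" if "y \<in> ?J" for y using that sub[of y] by auto
    then have "continuous_on ?J (\<lambda>y. cmod (deriv G (Complex x y)))"
      by (intro continuous_on_norm continuous_on_compose2[OF cont cv]) auto
    moreover have "?J \<noteq> {}" using h by (auto simp: algebra_simps)
    ultimately obtain e where "e \<in> ?J" "\<forall>y\<in>?J. cmod (deriv G (Complex x y)) \<le> cmod (deriv G (Complex x e))"
      using continuous_attains_sup[of ?J "\<lambda>y. cmod (deriv G (Complex x y))"] by auto
    then show ?thesis by (intro exI[of _ e]) auto
  qed
  then obtain \<eta> where \<eta>: "\<And>j. j < k \<Longrightarrow> a + real j * h \<le> \<eta> j \<and> \<eta> j \<le> a + real (Suc j) * h \<and>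
      (\<forall>y. a + real j * h \<le> y \<longrightarrow> y \<le> a + real (Suc j) * h \<longrightarrow>
         cmod (deriv G (Complex x y)) \<le> cmod (deriv G (Complex x (\<eta> j))))"
    by metis
  define m where "m j = cmod (deriv G (Complex x (\<eta> j)))" for j
  have m0: "m j \<ge> 0" for j by (simp add: m_def)
  have step: "cmod (G (Complex x y) - G (Complex x (a + real j * h))) \<le> h * m j"
    if j: "j < k" and y: "a + real j * h \<le> y" "y \<le> a + real (Suc j) * h" for j y
  proof -
    have jk: "real (Suc j) * h \<le> real k * h" "0 \<le> real j * h" using j h by (auto intro!: mult_right_mono)
    let ?a = "Complex x (a + real j * h)" and ?b = "Complex x y"
    have seg: "\<exists>t. z = Complex x t \<and> a + real j * h \<le> t \<and> t \<le> y" if z: "z \<in> closed_segment ?a ?b" for z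
    proof -
      obtain u where u: "0 \<le> u" "u \<le> 1" "z = (1 - u) *\<^sub>R ?a + u *\<^sub>R ?b" using z by (auto simp: in_segment)
      define t where "t = a + real j * h + u * (y - (a + real j * h))"
      have "z = Complex x t" unfolding u(3) t_def by (simp add: complex_eq_iff algebra_simps)
      moreover have "0 \<le> u * (y - (a + real j * h))" "u * (y - (a + real j * h)) \<le> 1 * (y - (a + real j * h))"
        using u(1) y(1) by (simp, intro mult_right_mono u(2)) (use y(1) in simp)
      ultimately show ?thesis by (intro exI[of _ t]) (auto simp: t_def)
    qed
    have "cmod (G ?b - G ?a) \<le> m j * cmod (?b - ?a)"
    proof (rule field_differentiable_bound[of "closed_segment ?a ?b" G "deriv G"])
      fix z assume "z \<in> closed_segment ?a ?b"
      then obtain t where t: "z = Complex x t" "a + real j * h \<le> t" "t \<le> y" using seg by blast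
      then have "z \<in> S" using sub[of t] jk y by auto
      then show "(G has_field_derivative deriv G z) (at z within closed_segment ?a ?b)"
        using hol by (auto intro: holomorphic_derivI)
      show "cmod (deriv G z) \<le> m j" using \<eta>[OF j] t y by (auto simp: m_def)
    qed auto
    also have "cmod (?b - ?a) = y - (a + real j * h)" using y by (simp add: cmod_def)
    also have "m j * (y - (a + real j * h)) \<le> m j * h"
      using y m0 by (intro mult_left_mono) (auto simp: algebra_simps)
    finally show ?thesis by (simp add: mult.commute)
  qed
  have base: "cmod (G (Complex x (a + real j * h)) - G (Complex x a)) \<le> h * (\<Sum>i<j. m i)" if "j \<le> k" for j
    using that
  proof (induction j)
    case (Suc j)
    have "cmod (G (Complex x (a + real (Suc j) * h)) - G (Complex x (a + real j * h))) \<le> h * m j"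
      using Suc.prems h by (intro step) (auto simp: algebra_simps)
    moreover have "cmod (G (Complex x (a + real j * h)) - G (Complex x a)) \<le> h * (\<Sum>i<j. m i)"
      using Suc by simp
    ultimately show ?case
      using norm_triangle_ineq[of "G (Complex x (a + real (Suc j) * h)) - G (Complex x (a + real j * h))"
          "G (Complex x (a + real j * h)) - G (Complex x a)"] by (simp add: algebra_simps)
  qed simp
  have all: "cmod (G (Complex x y) - G (Complex x a)) \<le> h * (\<Sum>j<k. m j)"
    if y: "a \<le> y" "y \<le> a + real k * h" for y
  \<comment> \<open>At the upper end the floor would be \<open>k\<close>, which is not the index of
    a piece.\<close>
  proof (cases "y = a + real k * h")
    case True
    then show ?thesis using base[of k] by simp
  next
    case False
    define j where "j = nat \<lfloor>(y - a) / h\<rfloor>"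
    have j: "real j * h \<le> y - a" "y - a < real j * h + h"
      unfolding j_def using nat_floor_divide[of "y - a" h] y h by auto
    have "real j * h < real k * h" using j(1) y(2) False by linarith
    then have jk: "j < k" using h by simp
    have "cmod (G (Complex x y) - G (Complex x (a + real j * h))) \<le> h * m j"
      using j by (intro step jk) (auto simp: algebra_simps)
    moreover have "cmod (G (Complex x (a + real j * h)) - G (Complex x a)) \<le> h * (\<Sum>i<j. m i)"
      using base jk by simp
    ultimately have "cmod (G (Complex x y) - G (Complex x a)) \<le> h * (\<Sum>i<Suc j. m i)"
      using norm_triangle_ineq[of "G (Complex x y) - G (Complex x (a + real j * h))"
          "G (Complex x (a + real j * h)) - G (Complex x a)"] by (simp add: algebra_simps)
    also have "\<dots> \<le> h * (\<Sum>i<k. m i)"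
      using h m0 jk by (intro mult_left_mono sum_mono2) auto
    finally show ?thesis .
  qed
  show thesis
  proof (rule that[of \<eta>])
    show "a + real j * h \<le> \<eta> j \<and> \<eta> j \<le> a + real (Suc j) * h" if "j < k" for j using \<eta>[OF that] by blast
    show "cmod (G (Complex x y) - G (Complex x y')) \<le> 2 * (h * (\<Sum>j<k. cmod (deriv G (Complex x (\<eta> j)))))"
      if "a \<le> y" "y \<le> a + real k * h" "a \<le> y'" "y' \<le> a + real k * h" for y y'
      using all[OF that(1,2)] all[OF that(3,4)]
        norm_triangle_ineq4[of "G (Complex x y) - G (Complex x a)" "G (Complex x y') - G (Complex x a)"]
      by (simp add: m_def)
  qed
qed

text \<open>Discs of a fixed radius around sample points must fit into the strip, so the large
  oscillation has to be seen at a distance \<delta> from its edges, uniformly in \<open>x\<close>.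
  If this failed for every \<delta>, the bad abscissae would accumulate at some \<open>x\<close>;
  two interior points that witness the oscillation at this \<open>x\<close> do so at nearby
  abscissae too.\<close>

lemma strip_segments_bounded_below:
  fixes G :: "complex \<Rightarrow> complex"
  assumes cont: "continuous_on {w. Re w < 0 \<and> 0 < Im w \<and> Im w < pi} G" and "x0 < 0"
    and big: "\<And>x. x \<in> {x1..x0} \<Longrightarrow> \<exists>y\<in>{0<..<pi}. \<exists>y'\<in>{0<..<pi}. c < cmod (G (Complex x y) - G (Complex x y'))"
  shows "\<exists>\<delta>>0. 2 * \<delta> < pi \<and> (\<forall>x\<in>{x1..x0}. \<exists>y\<in>{\<delta>..pi-\<delta>}. \<exists>y'\<in>{\<delta>..pi-\<delta>}. c < cmod (G (Complex x y) - G (Complex x y')))"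
proof (rule ccontr)
  assume contra: "\<not> ?thesis"
  define d where "d n = 1 / (real n + 2)" for n
  have d: "d n > 0" "2 * d n < pi" for n
  proof -
    show "d n > 0" by (simp add: d_def)
    have "2 * d n \<le> 1" by (simp add: d_def field_simps)
    then show "2 * d n < pi" using pi_gt3 by simp
  qed
  have "\<exists>x\<in>{x1..x0}. \<forall>y\<in>{d n..pi-d n}. \<forall>y'\<in>{d n..pi-d n}. cmod (G (Complex x y) - G (Complex x y')) \<le> c" for n
    using contra d[of n] by (meson not_le)
  then obtain X where X: "\<And>n. X n \<in> {x1..x0}"
    "\<And>n y y'. y \<in> {d n..pi-d n} \<Longrightarrow> y' \<in> {d n..pi-d n} \<Longrightarrow> cmod (G (Complex (X n) y) - G (Complex (X n) y')) \<le> c"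
    by metis
  obtain x r where x: "x \<in> {x1..x0}" "strict_mono r" "(X \<circ> r) \<longlonglongrightarrow> x"
    using compact_Icc[of x1 x0] X(1) unfolding compact_def by metis
  obtain y y' where y: "y \<in> {0<..<pi}" "y' \<in> {0<..<pi}" "c < cmod (G (Complex x y) - G (Complex x y'))"
    using big[OF x(1)] by blast
  have lim: "(\<lambda>n. G (Complex ((X \<circ> r) n) u)) \<longlonglongrightarrow> G (Complex x u)" if u: "u \<in> {0<..<pi}" for u
  proof (rule continuous_on_tendsto_compose[OF cont])
    show "(\<lambda>n. Complex ((X \<circ> r) n) u) \<longlonglongrightarrow> Complex x u"
      unfolding Complex_eq using x(3) by (intro tendsto_intros)
    have "(X \<circ> r) n < 0" for n using X(1)[of "r n"] \<open>x0 < 0\<close> by simp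
    then show "\<forall>\<^sub>F n in sequentially. Complex ((X \<circ> r) n) u \<in> {w. Re w < 0 \<and> 0 < Im w \<and> Im w < pi}"
      using u by simp
    show "Complex x u \<in> {w. Re w < 0 \<and> 0 < Im w \<and> Im w < pi}" using u x(1) \<open>x0 < 0\<close> by auto
  qed
  have "(\<lambda>n. cmod (G (Complex ((X \<circ> r) n) y) - G (Complex ((X \<circ> r) n) y'))) \<longlonglongrightarrow> cmod (G (Complex x y) - G (Complex x y'))"
    by (intro tendsto_intros lim y)
  then have ev1: "\<forall>\<^sub>F n in sequentially. c < cmod (G (Complex ((X \<circ> r) n) y) - G (Complex ((X \<circ> r) n) y'))"
    using y(3) by (rule order_tendstoD)
  have "(\<lambda>n. d (r n)) \<longlonglongrightarrow> 0"
  proof -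
    have "d \<longlonglongrightarrow> 0" unfolding d_def by real_asymp
    then have "(d \<circ> r) \<longlonglongrightarrow> 0" using x(2) by (rule LIMSEQ_subseq_LIMSEQ)
    then show ?thesis by (simp add: o_def)
  qed
  moreover have "0 < Min {y, y', pi - y, pi - y'}" using y by simp
  ultimately have ev2: "\<forall>\<^sub>F n in sequentially. d (r n) < Min {y, y', pi - y, pi - y'}"
    by (rule order_tendstoD)
  obtain n where n: "c < cmod (G (Complex (X (r n)) y) - G (Complex (X (r n)) y'))" "d (r n) < Min {y, y', pi - y, pi - y'}"
    using eventually_happens[OF eventually_conj[OF ev1 ev2]] by auto
  then have "y \<in> {d (r n)..pi - d (r n)}" "y' \<in> {d (r n)..pi - d (r n)}" by auto
  from X(2)[OF this] n(1) show False by simp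
qed

lemma nat_mult_sep:
  assumes "j + 1 \<le> (i::nat)" "h > 0"
  shows "real j * h + h \<le> real i * h"
proof -
  have "(real j + 1) * h \<le> real i * h" using assms by (intro mult_right_mono) auto
  then show ?thesis by (simp add: algebra_simps)
qed

text \<open>The length-area principle on a grid. If every segment with abscissa in an interval of
  length \<open>M\<close> had oscillation above \<open>c\<close>, the Cauchy--Schwarz inequality
  would bound the sum of squared derivatives from below by a multiple of \<open>M\<close>, while
  disjointness of the image discs bounds it from above independently of \<open>M\<close>.\<close>

theorem strip_short_crosscut:
  fixes G :: "complex \<Rightarrow> complex"
  defines "S \<equiv> {w. Re w < 0 \<and> 0 < Im w \<and> Im w < pi}"
  assumes hol: "G holomorphic_on S" and inj: "inj_on G S"
    and bd: "\<And>w. w \<in> S \<Longrightarrow> cmod (G w) \<le> R" and "c > 0"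
  shows "\<exists>x<b. x < 0 \<and> (\<forall>y\<in>{0<..<pi}. \<forall>y'\<in>{0<..<pi}. cmod (G (Complex x y) - G (Complex x y')) \<le> c)"
proof (rule ccontr)
  assume contra: "\<not> ?thesis"
  define x0 where "x0 = min b 0 - 1"
  have x0: "x0 < b" "x0 \<le> -1" by (auto simp: x0_def)
  have big: "\<exists>y\<in>{0<..<pi}. \<exists>y'\<in>{0<..<pi}. c < cmod (G (Complex x y) - G (Complex x y'))" if "x \<le> x0" for x
    using contra that x0 by (meson not_le le_less_trans order.strict_trans2 neg_less_0_iff_less zero_less_one)
  have "open S"
  proof -
    have "S = {w. Re w < 0} \<inter> {w. 0 < Im w} \<inter> {w. Im w < pi}" by (auto simp: S_def)
    then show ?thesis by (auto intro!: open_Int open_halfspace_Re_lt open_halfspace_Im_lt open_halfspace_Im_gt)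
  qed
  have "Complex (-1) 1 \<in> S" using pi_gt3 by (simp add: S_def)
  then have "R \<ge> 0" using bd norm_ge_zero order_trans by blast
  \<comment> \<open>A sample contributes \<open>(h * m l j)\<^sup>2 / 576\<close>, where
    \<open>576 = 24\<^sup>2\<close> comes from the radius \<open>h/2\<close> and the constant
    \<open>12\<close>; two parity classes give \<open>1152\<close>. The columns cover a length of at
    least \<open>M - 1\<close>, and the summand \<open>2\<close> makes even this length too large by
    \<open>1\<close>.\<close>
  define M where "M = 2 + 4 * pi * 1152 * R\<^sup>2 / c\<^sup>2"
  obtain \<delta> where \<delta>: "\<delta> > 0" "2 * \<delta> < pi"
    "\<And>x. x \<in> {x0-M..x0} \<Longrightarrow> \<exists>y\<in>{\<delta>..pi-\<delta>}. \<exists>y'\<in>{\<delta>..pi-\<delta>}. c < cmod (G (Complex x y) - G (Complex x y'))"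
    using strip_segments_bounded_below[of G x0 "x0-M" c] holomorphic_on_imp_continuous_on[OF hol] x0 big
    unfolding S_def by auto
  define w where "w = pi - 2 * \<delta>"
  have w: "w > 0" using \<delta>(2) by (simp add: w_def)
  \<comment> \<open>This makes the mesh \<open>h\<close> smaller than \<delta> and than
    \<open>1\<close>, so that balls of radius \<open>h/2\<close> around the sample points stay
    within the strip vertically and, as \<open>x0 \<le> -1\<close>, left of the imaginary
    axis.\<close>
  obtain k :: nat where k: "w / min \<delta> 1 < real k" using reals_Archimedean2 by blast
  have "w / min \<delta> 1 > 0" using w \<delta>(1) by simp
  then have k0: "real k > 0" using k by linarith
  define h where "h = w / real k"
  have h: "h > 0" "real k * h = w" using w k0 by (auto simp: h_def)
  have h1: "h < min \<delta> 1" 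
  proof -
    have "min \<delta> 1 > 0" using \<delta>(1) by simp
    then have "w < real k * min \<delta> 1" using k by (simp only: pos_divide_less_eq)
    then show ?thesis using k0 by (simp only: h_def pos_divide_less_eq mult.commute)
  qed
  define N where "N = nat \<lfloor>M / h\<rfloor>"
  have M2: "M \<ge> 2" by (simp add: M_def)
  have N: "real N * h \<le> M" "M < real N * h + h"
    unfolding N_def using nat_floor_divide[of M h] M2 h by auto
  define X where "X l = x0 - real l * h" for l
  have Xin: "X l \<in> {x0-M..x0}" if "l < N" for l
  proof -
    have "real l * h \<le> real N * h" "0 \<le> real l * h" using that h by (auto intro!: mult_right_mono)
    then show ?thesis using N unfolding X_def atLeastAtMost_iff by linarith
  qed
  have vs: "\<exists>\<eta>. (\<forall>j<k. \<delta> + real j * h \<le> \<eta> j \<and> \<eta> j \<le> \<delta> + real (Suc j) * h) \<and>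
      (\<forall>y\<in>{\<delta>..pi-\<delta>}. \<forall>y'\<in>{\<delta>..pi-\<delta>}. cmod (G (Complex (X l) y) - G (Complex (X l) y'))
         \<le> 2 * (h * (\<Sum>j<k. cmod (deriv G (Complex (X l) (\<eta> j))))))" if "l < N" for l
  proof -
    have e: "\<delta> + real k * h = pi - \<delta>" using h by (simp add: w_def)
    have "Complex (X l) y \<in> S" if "\<delta> \<le> y" "y \<le> \<delta> + real k * h" for y
      using that Xin[OF \<open>l < N\<close>] x0 \<delta>(1) e by (simp add: S_def)
    from vertical_segment_variation[OF hol \<open>open S\<close> h(1) this] e show ?thesis
      by (metis atLeastAtMost_iff)
  qed
  then obtain \<eta> where \<eta>: "\<And>l j. l < N \<Longrightarrow> j < k \<Longrightarrow> \<delta> + real j * h \<le> \<eta> l j \<and> \<eta> l j \<le> \<delta> + real (Suc j) * h"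
    and var: "\<And>l y y'. l < N \<Longrightarrow> y \<in> {\<delta>..pi-\<delta>} \<Longrightarrow> y' \<in> {\<delta>..pi-\<delta>} \<Longrightarrow>
        cmod (G (Complex (X l) y) - G (Complex (X l) y')) \<le> 2 * (h * (\<Sum>j<k. cmod (deriv G (Complex (X l) (\<eta> l j)))))"
    by metis
  define m where "m l j = cmod (deriv G (Complex (X l) (\<eta> l j)))" for l j
  \<comment> \<open>Cauchy--Schwarz with \<open>k\<close> terms; multiplied by \<open>h\<close>, the
    factor \<open>real k\<close> becomes the length \<open>w\<close>, which is at most
    \<open>pi\<close>.\<close>
  have column: "c\<^sup>2 * h / (4 * pi) \<le> (\<Sum>j<k. (h * m l j)\<^sup>2)" if lN: "l < N" for l
  proof -
    obtain y y' where "y \<in> {\<delta>..pi-\<delta>}" "y' \<in> {\<delta>..pi-\<delta>}" "c < cmod (G (Complex (X l) y) - G (Complex (X l) y'))"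
      using \<delta>(3)[OF Xin[OF lN]] by blast
    then have "c / 2 \<le> (\<Sum>j<k. h * m l j)" using var[OF lN, of y y'] by (simp add: m_def flip: sum_distrib_left)
    then have "(c / 2)\<^sup>2 \<le> (\<Sum>j<k. h * m l j)\<^sup>2" using \<open>c > 0\<close> by (intro power_mono) auto
    also have "\<dots> \<le> (\<Sum>j<k. (h * m l j)\<^sup>2) * real k"
      using Cauchy_Schwarz_ineq_sum[of "\<lambda>j. h * m l j" "\<lambda>_. 1" "{..<k}"] by simp
    finally have "(c / 2)\<^sup>2 * h \<le> ((\<Sum>j<k. (h * m l j)\<^sup>2) * real k) * h" using h by (intro mult_right_mono) auto
    also have "\<dots> = (\<Sum>j<k. (h * m l j)\<^sup>2) * w" using h(2) by simp
    also have "\<dots> \<le> (\<Sum>j<k. (h * m l j)\<^sup>2) * pi"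
      using \<delta>(1) by (intro mult_left_mono sum_nonneg) (auto simp: w_def)
    finally show ?thesis by (simp add: field_simps power2_eq_square)
  qed
  \<comment> \<open>Samples in adjacent pieces of a column may coincide. Within one parity class
    they are at least \<open>h\<close> apart, so that the balls of radius \<open>h/2\<close> are
    disjoint.\<close>
  have par: "(\<Sum>(l, j)\<in>{..<N} \<times> {j. j < k \<and> j mod 2 = p}. (h * m l j)\<^sup>2) \<le> 576 * R\<^sup>2" for p
  proof -
    let ?I = "{..<N} \<times> {j. j < k \<and> j mod 2 = p}"
    let ?z = "\<lambda>q. Complex (X (fst q)) (\<eta> (fst q) (snd q))"
    have sep: "h \<le> dist (?z q) (?z q')" if q: "q \<in> ?I" "q' \<in> ?I" and "q \<noteq> q'" for q q'
    proof (cases "fst q = fst q'")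
      case False
      have "h \<le> \<bar>real (fst q) * h - real (fst q') * h\<bar>"
        using nat_mult_sep[of "fst q" "fst q'" h] nat_mult_sep[of "fst q'" "fst q" h] False h(1)
        by (cases "fst q < fst q'") auto
      also have "\<dots> = \<bar>Re (?z q - ?z q')\<bar>" by (simp add: X_def)
      also have "\<dots> \<le> dist (?z q) (?z q')" unfolding dist_norm by (rule abs_Re_le_cmod)
      finally show ?thesis .
    next
      case True
      then have ne: "snd q \<noteq> snd q'" using \<open>q \<noteq> q'\<close> by (simp add: prod_eq_iff)
      have md: "snd q mod 2 = snd q' mod 2" using q by auto
      have "snd q + 2 \<le> snd q' \<or> snd q' + 2 \<le> snd q" using ne md by presburger
      then have "real (Suc (snd q)) * h + h \<le> real (snd q') * h \<or> real (Suc (snd q')) * h + h \<le> real (snd q) * h"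
        using nat_mult_sep[of "Suc (snd q)" "snd q'" h] nat_mult_sep[of "Suc (snd q')" "snd q" h] h(1) by auto
      then have "h \<le> \<bar>\<eta> (fst q) (snd q) - \<eta> (fst q') (snd q')\<bar>"
        using \<eta>[of "fst q" "snd q"] \<eta>[of "fst q'" "snd q'"] q True by auto
      also have "\<dots> = \<bar>Im (?z q - ?z q')\<bar>" by simp
      also have "\<dots> \<le> dist (?z q) (?z q')" unfolding dist_norm by (rule abs_Im_le_cmod)
      finally show ?thesis .
    qed
    have "(\<Sum>q\<in>?I. (h / 2 * cmod (deriv G (?z q)) / 12)\<^sup>2) \<le> R\<^sup>2"
    proof (rule sum_deriv_squares_le[OF hol inj bd \<open>R \<ge> 0\<close>])
      show "ball (?z q) (h/2) \<subseteq> S" if "q \<in> ?I" for q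
      proof
        fix u assume "u \<in> ball (?z q) (h/2)"
        then have u: "cmod (?z q - u) < h/2" by (simp add: dist_norm)
        have l: "fst q < N" "snd q < k" using that by auto
        have "\<bar>Re (?z q - u)\<bar> < h/2" "\<bar>Im (?z q - u)\<bar> < h/2"
          using u abs_Re_le_cmod[of "?z q - u"] abs_Im_le_cmod[of "?z q - u"] by linarith+
        then have "Re u < X (fst q) + h/2" "\<eta> (fst q) (snd q) - h/2 < Im u" "Im u < \<eta> (fst q) (snd q) + h/2"
          unfolding abs_less_iff by simp_all
        moreover have "X (fst q) \<le> x0" using Xin[OF l(1)] by simp
        moreover have "\<delta> \<le> \<eta> (fst q) (snd q)" "\<eta> (fst q) (snd q) \<le> pi - \<delta>"
        proof -
          have "0 \<le> real (snd q) * h" "real (Suc (snd q)) * h \<le> w"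
            unfolding h(2)[symmetric] using h(1) l(2) by (auto intro!: mult_right_mono)
          then show "\<delta> \<le> \<eta> (fst q) (snd q)" "\<eta> (fst q) (snd q) \<le> pi - \<delta>"
            using \<eta>[OF l] by (auto simp: w_def)
        qed
        moreover have "h < \<delta>" "h < 1" using h1 by auto
        ultimately have "Re u < 0" "0 < Im u" "Im u < pi" using x0 h(1) by auto
        then show "u \<in> S" by (simp add: S_def)
      qed
      show "ball (?z q) (h/2) \<inter> ball (?z q') (h/2) = {}" if "q \<in> ?I" "q' \<in> ?I" "q \<noteq> q'" for q q'
        using sep[OF that] by (intro disjoint_ballI) auto
    qed (use h in auto)
    moreover have eq: "(h / 2 * cmod (deriv G (?z q)) / 12)\<^sup>2 = (case q of (l, j) \<Rightarrow> (h * m l j)\<^sup>2) / 576" for q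
      by (simp add: m_def case_prod_unfold power2_eq_square)
    ultimately have "(\<Sum>q\<in>?I. (case q of (l, j) \<Rightarrow> (h * m l j)\<^sup>2) / 576) \<le> R\<^sup>2" by (simp only: eq)
    then have "(\<Sum>q\<in>?I. (case q of (l, j) \<Rightarrow> (h * m l j)\<^sup>2)) / 576 \<le> R\<^sup>2" by (simp only: sum_divide_distrib)
    then show ?thesis by simp
  qed
  have "real N * (c\<^sup>2 * h / (4 * pi)) \<le> (\<Sum>l<N. \<Sum>j<k. (h * m l j)\<^sup>2)"
    using sum_mono[of "{..<N}" "\<lambda>_. c\<^sup>2 * h / (4 * pi)" "\<lambda>l. \<Sum>j<k. (h * m l j)\<^sup>2"] column by simp
  also have "\<dots> = (\<Sum>(l, j)\<in>{..<N} \<times> {..<k}. (h * m l j)\<^sup>2)" by (rule sum.cartesian_product)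
  also have "{..<N} \<times> {..<k} = {..<N} \<times> {j. j < k \<and> j mod 2 = 0} \<union> {..<N} \<times> {j. j < k \<and> j mod 2 = 1}"
    by auto
  also have "(\<Sum>(l, j)\<in>\<dots>. (h * m l j)\<^sup>2) = (\<Sum>(l, j)\<in>{..<N} \<times> {j. j < k \<and> j mod 2 = 0}. (h * m l j)\<^sup>2)
      + (\<Sum>(l, j)\<in>{..<N} \<times> {j. j < k \<and> j mod 2 = 1}. (h * m l j)\<^sup>2)"
    by (rule sum.union_disjoint) auto
  also have "\<dots> \<le> 1152 * R\<^sup>2" using par[of 0] par[of 1] by simp
  finally have "(real N * h) * (c\<^sup>2 / (4 * pi)) \<le> 1152 * R\<^sup>2" by (simp add: mult_ac)
  moreover have "(M - 1) * (c\<^sup>2 / (4 * pi)) \<le> (real N * h) * (c\<^sup>2 / (4 * pi))"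
    using N h1 by (intro mult_right_mono) auto
  ultimately have "(M - 1) * (c\<^sup>2 / (4 * pi)) \<le> 1152 * R\<^sup>2" by linarith
  moreover have "(M - 1) * (c\<^sup>2 / (4 * pi)) = c\<^sup>2 / (4 * pi) + 1152 * R\<^sup>2"
    using \<open>c > 0\<close> by (simp add: M_def field_simps)
  ultimately show False using \<open>c > 0\<close> by (simp add: field_simps)
qed


subsection \<open>The inverted boundary\<close>

lemma locally_connected_nbhd:
  fixes S :: "'a :: metric_space set"
  assumes "locally connected S" "p \<in> S" "e > 0"
  obtains d E where "d > 0" "connected E" "E \<subseteq> S \<inter> ball p e" "S \<inter> ball p d \<subseteq> E"
proof -
  have "openin (top_of_set S) (S \<inter> ball p e)" by (simp add: openin_open_Int)
  moreover have "p \<in> S \<inter> ball p e" using assms by simp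
  ultimately obtain u v where u: "openin (top_of_set S) u" "connected v" "p \<in> u" "u \<subseteq> v" "v \<subseteq> S \<inter> ball p e"
    using assms(1) unfolding locally_def by meson
  obtain O' where O': "open O'" "u = S \<inter> O'" using u(1) by (auto simp: openin_open)
  then obtain d where "d > 0" "ball p d \<subseteq> O'" using u(3) openE by blast
  with u O' show thesis by (intro that[of d v]) auto
qed

text \<open>The image of \<open>\<Omega> - {a}\<close> under the inversion \<open>z \<mapsto> 1 / (z - a)\<close>; the point at infinity
  of the sphere becomes \<open>0\<close>.\<close>

definition inverted :: "complex set \<Rightarrow> complex \<Rightarrow> complex set" where
  "inverted \<Omega> a = {q. q \<noteq> 0 \<and> a + 1 / q \<in> \<Omega>}"

lemma open_inverted: "open \<Omega> \<Longrightarrow> open (inverted \<Omega> a)"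
proof -
  assume "open \<Omega>"
  have "continuous_on (- {0}) (\<lambda>q. a + 1 / q)" by (intro continuous_intros) auto
  then have "open (- {0} \<inter> (\<lambda>q. a + 1 / q) -` \<Omega>)"
    using \<open>open \<Omega>\<close> by (intro continuous_open_preimage) auto
  also have "- {0} \<inter> (\<lambda>q. a + 1 / q) -` \<Omega> = inverted \<Omega> a" by (auto simp: inverted_def)
  finally show ?thesis .
qed

lemma closure_inverted_iff:
  assumes "q \<noteq> 0"
  shows "q \<in> closure (inverted \<Omega> a) \<longleftrightarrow> a + 1 / q \<in> closure \<Omega>"
proof
  assume "q \<in> closure (inverted \<Omega> a)"
  then obtain u where u: "\<And>n. u n \<in> inverted \<Omega> a" "u \<longlonglongrightarrow> q" unfolding closure_sequential by blast
  have "(\<lambda>n. a + 1 / u n) \<longlonglongrightarrow> a + 1 / q" using u(2) assms by (intro tendsto_intros)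
  moreover have "a + 1 / u n \<in> \<Omega>" for n using u(1)[of n] by (simp add: inverted_def)
  ultimately show "a + 1 / q \<in> closure \<Omega>" unfolding closure_sequential by (intro exI[of _ "\<lambda>n. a + 1 / u n"]) simp
next
  assume "a + 1 / q \<in> closure \<Omega>"
  then obtain z where z: "\<And>n. z n \<in> \<Omega>" "z \<longlonglongrightarrow> a + 1 / q" unfolding closure_sequential by blast
  have "(\<lambda>n. 1 / (z n - a)) \<longlonglongrightarrow> 1 / ((a + 1 / q) - a)" using z(2) assms by (intro tendsto_intros) auto
  then have lim: "(\<lambda>n. 1 / (z n - a)) \<longlonglongrightarrow> q" by simp
  have "\<forall>\<^sub>F n in sequentially. z n \<noteq> a"
    using z(2) by (rule tendsto_imp_eventually_ne) (use assms in auto)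
  then have "\<forall>\<^sub>F n in sequentially. 1 / (z n - a) \<in> closure (inverted \<Omega> a)"
  proof eventually_elim
    case (elim n)
    then have "1 / (z n - a) \<in> inverted \<Omega> a" using z(1)[of n] by (simp add: inverted_def)
    then show ?case using closure_subset by blast
  qed
  then show "q \<in> closure (inverted \<Omega> a)"
    using lim by (intro Lim_in_closed_set[of "closure (inverted \<Omega> a)" "\<lambda>n. 1 / (z n - a)" sequentially q]) auto
qed

lemma frontier_inverted_iff:
  assumes "open \<Omega>" "q \<noteq> 0"
  shows "q \<in> frontier (inverted \<Omega> a) \<longleftrightarrow> a + 1 / q \<in> frontier \<Omega>"
  using closure_inverted_iff[OF assms(2)] open_inverted[OF assms(1)] assms
  by (simp add: frontier_def interior_open inverted_def)

lemma zero_in_closure_inverted: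
  assumes "0 \<in> closure (inverted \<Omega> a)"
  shows "\<not> bounded \<Omega>"
proof
  assume "bounded \<Omega>"
  then obtain B where B: "B > 0" "\<And>z. z \<in> \<Omega> \<Longrightarrow> cmod z \<le> B" unfolding bounded_pos by blast
  define M where "M = B + cmod a"
  have "M > 0" using B(1) norm_ge_zero[of a] unfolding M_def by linarith
  then obtain q where q: "q \<in> inverted \<Omega> a" "dist q 0 < 1 / M"
    using assms unfolding closure_approachable by (metis zero_less_divide_1_iff)
  then have "q \<noteq> 0" "a + 1 / q \<in> \<Omega>" by (auto simp: inverted_def)
  then have "cmod (1 / q) \<le> M" using B(2)[of "a + 1 / q"] norm_triangle_ineq4[of "a + 1 / q" a] by (simp add: M_def)
  with q(2) \<open>q \<noteq> 0\<close> \<open>M > 0\<close> show False by (simp add: norm_divide field_simps)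
qed

lemma homeomorphic_frontier_inverted:
  assumes "open \<Omega>" "a \<in> \<Omega>"
  shows "(frontier (inverted \<Omega> a) - {0}) homeomorphic frontier \<Omega>"
proof -
  have af: "z \<noteq> a" if "z \<in> frontier \<Omega>" for z
    using that assms by (auto simp: frontier_def interior_open)
  have "homeomorphism (frontier (inverted \<Omega> a) - {0}) (frontier \<Omega>) (\<lambda>q. a + 1 / q) (\<lambda>z. 1 / (z - a))"
  proof (rule homeomorphismI)
    show "continuous_on (frontier (inverted \<Omega> a) - {0}) (\<lambda>q. a + 1 / q)" by (intro continuous_intros) auto
    show "continuous_on (frontier \<Omega>) (\<lambda>z. 1 / (z - a))" using af by (intro continuous_intros) auto
    show "(\<lambda>q. a + 1 / q) ` (frontier (inverted \<Omega> a) - {0}) \<subseteq> frontier \<Omega>"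
      using frontier_inverted_iff[OF assms(1)] by auto
    show "(\<lambda>z. 1 / (z - a)) ` frontier \<Omega> \<subseteq> frontier (inverted \<Omega> a) - {0}"
      using frontier_inverted_iff[OF assms(1)] af by auto
  qed (use af in auto)
  then show ?thesis unfolding homeomorphic_def by blast
qed

lemma locally_connected_frontier_inverted:
  assumes "open \<Omega>" "a \<in> \<Omega>"
  shows "locally connected (frontier (inverted \<Omega> a) - {0}) \<longleftrightarrow> locally connected (frontier \<Omega>)"
  by (rule homeomorphic_locally[OF homeomorphic_frontier_inverted[OF assms]]) (rule homeomorphic_connectedness)

text \<open>A relatively clopen set contains the boundary component of each of its points, and
  simple connectedness of the unbounded set \<Omega> makes all boundary components
  unbounded.\<close>

lemma bounded_clopen_frontier_empty:
  fixes \<Omega> :: "complex set"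
  assumes \<Omega>: "open \<Omega>" "simply_connected \<Omega>" "\<not> bounded \<Omega>"
    and H: "openin (top_of_set (frontier \<Omega>)) H" "compact H"
  shows "H = {}"
proof (rule ccontr)
  assume "H \<noteq> {}"
  then obtain z where z: "z \<in> H" by blast
  then have zf: "z \<in> frontier \<Omega>" using H(1) openin_imp_subset by blast
  define C where "C = connected_component_set (frontier \<Omega>) z"
  have C: "C \<in> components (frontier \<Omega>)" unfolding C_def components_def using zf by blast
  have "H \<subseteq> frontier \<Omega>" using H(1) openin_imp_subset by blast
  have "closedin (top_of_set C) (C \<inter> H)"
    using H(2) compact_imp_closed closedin_closed_Int by blast
  moreover have "openin (top_of_set C) (C \<inter> H)"
    using H(1) in_components_subset[OF C] by (auto simp: openin_open)
  ultimately have "C \<inter> H = {} \<or> C \<inter> H = C"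
    using in_components_connected[OF C] unfolding connected_clopen by blast
  moreover have "z \<in> C \<inter> H" using z zf by (simp add: C_def)
  ultimately have "C \<subseteq> H" by blast
  then have "bounded C" using H(2) compact_imp_bounded bounded_subset by blast
  with C show False using simply_connected_eq_frontier_properties[OF \<Omega>(1)] \<Omega>(2,3) by auto
qed

text \<open>A component of the inverted boundary near \<open>0\<close> that avoids \<open>0\<close> has to leave each small
  ball, since otherwise the boundary of \<open>\<Omega>\<close> would have a bounded component. Infinitely many of
  them would accumulate at a point different from \<open>0\<close>, where the boundary is locally connected.\<close>

lemma frontier_inverted_im_kleinen_zero:
  fixes \<Omega> :: "complex set"
  assumes \<Omega>: "open \<Omega>" "simply_connected \<Omega>" "a \<in> \<Omega>" and lc: "locally connected (frontier \<Omega>)"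
    and 0: "0 \<in> frontier (inverted \<Omega> a)" and "e > 0"
  shows "\<exists>d>0. \<exists>E. connected E \<and> E \<subseteq> frontier (inverted \<Omega> a) \<inter> cball 0 e \<and> frontier (inverted \<Omega> a) \<inter> ball 0 d \<subseteq> E"
proof (rule ccontr)
  assume contra: "\<not> ?thesis"
  define F where "F = frontier (inverted \<Omega> a)"
  define A where "A = F \<inter> cball 0 e"
  have "closed F" by (simp add: F_def)
  then have cA: "compact A" by (auto simp: A_def intro: closed_Int_compact)
  have unb: "\<not> bounded \<Omega>" using 0 zero_in_closure_inverted by (auto simp: frontier_def)
  have 0: "0 \<in> F" using 0 by (simp add: F_def)
  have lcF: "locally connected (F - {0})"
    using locally_connected_frontier_inverted[OF \<Omega>(1,3)] lc by (simp add: F_def)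
  have "\<exists>q. q \<in> F \<inter> ball 0 (e / 2 / (real n + 1)) \<and> q \<notin> connected_component_set A 0" for n
  proof (rule ccontr)
    assume "\<nexists>q. q \<in> F \<inter> ball 0 (e / 2 / (real n + 1)) \<and> q \<notin> connected_component_set A 0"
    then have "F \<inter> ball 0 (e / 2 / (real n + 1)) \<subseteq> connected_component_set A 0" by blast
    moreover have "connected_component_set A 0 \<subseteq> F \<inter> cball 0 e"
      using connected_component_subset by (auto simp: A_def)
    moreover have "e / 2 / (real n + 1) > 0" using \<open>e > 0\<close> by simp
    ultimately show False using contra connected_connected_component unfolding F_def by blast
  qed
  then obtain q where q: "\<And>n. q n \<in> F" "\<And>n. cmod (q n) < e / 2 / (real n + 1)" "\<And>n. q n \<notin> connected_component_set A 0"
    by (metis IntE mem_ball_0)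
  have qe: "cmod (q n) < e / 2" for n
  proof -
    have "e / 2 / (real n + 1) \<le> e / 2" using \<open>e > 0\<close> by (simp add: field_simps)
    then show ?thesis using q(2)[of n] by linarith
  qed
  have qA: "q n \<in> A" for n using q(1) qe[of n] \<open>e > 0\<close> by (simp add: A_def)
  have q0: "q \<longlonglongrightarrow> 0"
  proof (rule Lim_null_comparison)
    show "\<forall>\<^sub>F n in sequentially. norm (q n) \<le> e / 2 / (real n + 1)" using q(2) by (simp add: less_imp_le)
    show "(\<lambda>n. e / 2 / (real n + 1)) \<longlonglongrightarrow> 0" by real_asymp
  qed
  define Q where "Q n = connected_component_set A (q n)" for n
  have Qc: "Q n \<in> components A" for n unfolding Q_def components_def using qA by blast
  have qQ: "q n \<in> Q n" for n using qA by (simp add: Q_def)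
  have Q0: "0 \<notin> Q n" for n
    using q(3)[of n] connected_component_sym unfolding Q_def by (metis mem_Collect_eq)
  have "\<not> Q n \<subseteq> ball 0 (e/2)" for n
  proof
    assume Qb: "Q n \<subseteq> ball 0 (e/2)"
    \<comment> \<open>By the Sura-Bura theorem the compact component \<open>Q n\<close> has a
      compact neighbourhood in \<open>A\<close>, relatively open and still contained in this
      punctured ball. Being well inside \<open>cball 0 e\<close>, it is relatively open in
      \<open>F\<close> as well.\<close>
    have "open (ball 0 (e/2) - {0::complex})" by (simp add: open_delete)
    moreover have "Q n \<subseteq> ball 0 (e/2) - {0}" using Qb Q0 by blast
    ultimately obtain K where K: "openin (top_of_set A) K" "compact K" "Q n \<subseteq> K" "K \<subseteq> ball 0 (e/2) - {0}"
      by (rule Sura_Bura_clopen_subset[OF closed_imp_locally_compact[OF compact_imp_closed[OF cA]] Qc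
            compact_components[OF cA Qc]])
    obtain V where V: "open V" "K = A \<inter> V" using K(1) by (auto simp: openin_open)
    define V' where "V' = V \<inter> (ball 0 (e/2) - {0})"
    have V': "open V'" unfolding V'_def using V(1) by (intro open_Int open_delete) auto
    have KV: "K = F \<inter> V'" using V(2) K(4) \<open>e > 0\<close> by (auto simp: V'_def A_def)
    \<comment> \<open>As \<open>K\<close> avoids \<open>0\<close>, undoing the inversion gives a
      compact, relatively open part of the boundary of \<Omega>, which must be empty.\<close>
    define H where "H = (\<lambda>q. a + 1 / q) ` K"
    have "compact H" unfolding H_def using K(2,4)
      by (intro compact_continuous_image continuous_intros) auto
    moreover have "openin (top_of_set (frontier \<Omega>)) H"
    proof -
      have "open (- {a} \<inter> (\<lambda>z. 1 / (z - a)) -` V')"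
        using V' by (intro continuous_open_preimage continuous_intros) auto
      moreover have "H = frontier \<Omega> \<inter> (- {a} \<inter> (\<lambda>z. 1 / (z - a)) -` V')"
      proof
        show "H \<subseteq> frontier \<Omega> \<inter> (- {a} \<inter> (\<lambda>z. 1 / (z - a)) -` V')"
        proof
          fix z assume "z \<in> H"
          then obtain k where k: "k \<in> K" "z = a + 1 / k" by (auto simp: H_def)
          then have "k \<noteq> 0" "k \<in> F" "k \<in> V'" using K(4) KV by auto
          then show "z \<in> frontier \<Omega> \<inter> (- {a} \<inter> (\<lambda>z. 1 / (z - a)) -` V')"
            using frontier_inverted_iff[OF \<Omega>(1)] k(2) by (simp add: F_def)
        qed
        show "frontier \<Omega> \<inter> (- {a} \<inter> (\<lambda>z. 1 / (z - a)) -` V') \<subseteq> H"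
        proof
          fix z assume z: "z \<in> frontier \<Omega> \<inter> (- {a} \<inter> (\<lambda>z. 1 / (z - a)) -` V')"
          define k where "k = 1 / (z - a)"
          have k: "k \<noteq> 0" "a + 1 / k = z" "k \<in> V'" using z by (auto simp: k_def)
          then have "k \<in> F" using frontier_inverted_iff[OF \<Omega>(1) k(1)] z by (simp add: F_def)
          with k show "z \<in> H" unfolding H_def KV by blast
        qed
      qed
      ultimately show ?thesis by (auto simp: openin_open)
    qed
    ultimately have "H = {}" by (intro bounded_clopen_frontier_empty[OF \<Omega>(1,2) unb])
    then show False using K(3) qQ[of n] by (auto simp: H_def)
  qed
  then have nb: "Q n - ball 0 (e/2) \<noteq> {}" for n by blast
  have "\<exists>r. r \<in> Q n \<inter> sphere 0 (e/2)" for n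
  proof -
    have "q n \<in> Q n \<inter> ball 0 (e/2)" using qQ[of n] qe[of n] by simp
    then have "Q n \<inter> frontier (ball 0 (e/2)) \<noteq> {}"
      using connected_Int_frontier[OF in_components_connected[OF Qc] _ nb[of n]] by blast
    then show ?thesis using \<open>e > 0\<close> by (auto simp: frontier_ball)
  qed
  then obtain r where r: "\<And>n. r n \<in> Q n" "\<And>n. r n \<in> sphere 0 (e/2)" by (metis IntE)
  obtain l s where l: "l \<in> sphere 0 (e/2)" "strict_mono s" "(r \<circ> s) \<longlonglongrightarrow> l"
    using compact_sphere[of "0::complex" "e/2"] r(2) unfolding compact_def by metis
  have rA: "r n \<in> A" for n using r(1) in_components_subset[OF Qc] by blast
  have "l \<in> F"
    by (rule closed_sequentially[OF \<open>closed F\<close> _ l(3)]) (use rA in \<open>auto simp: A_def\<close>)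
  then have "l \<in> F - {0}" using l(1) \<open>e > 0\<close> by auto
  \<comment> \<open>Since \<open>l\<close> has modulus \<open>e/2\<close>, the set \<open>E\<close>
    stays inside \<open>cball 0 e\<close> and lies in one component of \<open>A\<close>. Every
    \<open>Q (s n)\<close> that comes close to \<open>l\<close> is this component, so it is closed
    and contains points tending to \<open>0\<close>, contrary to \<open>Q0\<close>.\<close>
  then obtain d E where dE: "d > 0" "connected E" "E \<subseteq> (F - {0}) \<inter> ball l (e/2)" "(F - {0}) \<inter> ball l d \<subseteq> E"
    using locally_connected_nbhd[OF lcF, of l "e/2"] \<open>e > 0\<close> by auto
  have EA: "E \<subseteq> A"
  proof
    fix x assume x: "x \<in> E"
    then have "cmod (l - x) < e/2" using dE(3) by (auto simp: dist_norm)
    then have "cmod x \<le> e" using norm_triangle_ineq4[of l "l - x"] l(1) by simp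
    with x dE(3) show "x \<in> A" by (auto simp: A_def)
  qed
  have lE: "l \<in> E" using dE(1,4) \<open>l \<in> F - {0}\<close> by auto
  have "\<forall>\<^sub>F n in sequentially. dist ((r \<circ> s) n) l < d" using tendstoD[OF l(3) dE(1)] .
  then have ev: "\<forall>\<^sub>F n in sequentially. Q (s n) = connected_component_set A l"
  proof eventually_elim
    case (elim n)
    have "r (s n) \<noteq> 0" using r(2)[of "s n"] \<open>e > 0\<close> by auto
    then have "r (s n) \<in> E" using elim dE(4) rA[of "s n"] by (auto simp: A_def dist_commute)
    then have "connected_component A l (r (s n))"
      unfolding connected_component_def using dE(2) EA lE by blast
    moreover have "connected_component A (q (s n)) (r (s n))" using r(1)[of "s n"] by (simp add: Q_def)
    ultimately show ?case unfolding Q_def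
      by (metis connected_component_eq mem_Collect_eq)
  qed
  then have "\<forall>\<^sub>F n in sequentially. (q \<circ> s) n \<in> connected_component_set A l"
    by eventually_elim (use qQ in auto)
  moreover have "closed (connected_component_set A l)"
    using closed_connected_component compact_imp_closed[OF cA] by blast
  moreover have "(q \<circ> s) \<longlonglongrightarrow> 0" using q0 l(2) by (rule LIMSEQ_subseq_LIMSEQ)
  ultimately have "0 \<in> connected_component_set A l"
    by (intro Lim_in_closed_set[of "connected_component_set A l" "q \<circ> s" sequentially 0]) auto
  moreover obtain n where "Q (s n) = connected_component_set A l" using eventually_happens[OF ev] by auto
  ultimately show False using Q0[of "s n"] by blast
qed

text \<open>Connectedness im kleinen: \<open>E\<close> is a connected neighbourhood that need not be
  open. This is the form in which \<open>cap_image_subset\<close> joins boundary points near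
  \<open>p\<close>.\<close>

lemma frontier_inverted_im_kleinen:
  fixes \<Omega> :: "complex set"
  assumes \<Omega>: "open \<Omega>" "simply_connected \<Omega>" "a \<in> \<Omega>" and lc: "locally connected (frontier \<Omega>)"
    and p: "p \<in> frontier (inverted \<Omega> a)" and "e > 0"
  obtains d E where "d > 0" "connected E" "E \<subseteq> frontier (inverted \<Omega> a) \<inter> cball p e"
    "frontier (inverted \<Omega> a) \<inter> ball p d \<subseteq> E"
proof (cases "p = 0")
  case True
  then show ?thesis using frontier_inverted_im_kleinen_zero[OF \<Omega> lc] p \<open>e > 0\<close> that by blast
next
  case False
  have "locally connected (frontier (inverted \<Omega> a) - {0})"
    using locally_connected_frontier_inverted[OF \<Omega>(1,3)] lc by simp
  moreover have "p \<in> frontier (inverted \<Omega> a) - {0}" using p False by simp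
  ultimately obtain d E where dE: "d > 0" "connected E" "E \<subseteq> (frontier (inverted \<Omega> a) - {0}) \<inter> ball p e"
      "(frontier (inverted \<Omega> a) - {0}) \<inter> ball p d \<subseteq> E"
    using locally_connected_nbhd \<open>e > 0\<close> by metis
  show ?thesis
  \<comment> \<open>The radius \<open>cmod p\<close> keeps \<open>0\<close> out of the ball, where
    nothing is known from the punctured boundary.\<close>
  proof (rule that[of "min d (cmod p)" E])
    show "frontier (inverted \<Omega> a) \<inter> ball p (min d (cmod p)) \<subseteq> E" using dE(4) by auto
    show "E \<subseteq> frontier (inverted \<Omega> a) \<inter> cball p e" using dE(3) ball_subset_cball by blast
  qed (use dE False in auto)
qed


subsection \<open>The exterior map\<close>

context riemann_map
begin

text \<open>The map has a pole at \<open>0\<close>, where division by zero assigns it the default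
  value \<open>0\<close>; hence the conditions \<open>z \<noteq> 0\<close> below.\<close>

definition inv_f :: "complex \<Rightarrow> complex" where
  "inv_f z = 1 / (f z - f 0)"

abbreviation "inv_dom \<equiv> inverted \<Omega> (f 0)"

abbreviation inv_h :: "complex \<Rightarrow> complex" where
  "inv_h q \<equiv> h (f 0 + 1 / q)"

lemma f_neq_f0: "cmod z < 1 \<Longrightarrow> z \<noteq> 0 \<Longrightarrow> f z - f 0 \<noteq> 0"
  using h_f[of z] h_f[of 0] by auto

lemma inv_f_in: "cmod z < 1 \<Longrightarrow> z \<noteq> 0 \<Longrightarrow> inv_f z \<in> inv_dom"
  using f_neq_f0[of z] f_in[of z] by (simp add: inverted_def inv_f_def)

lemma inv_h_inv_f: "cmod z < 1 \<Longrightarrow> z \<noteq> 0 \<Longrightarrow> inv_h (inv_f z) = z"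
  using f_neq_f0[of z] h_f[of z] by (simp add: inv_f_def)

lemma inv_h_in: "q \<in> inv_dom \<Longrightarrow> cmod (inv_h q) < 1 \<and> inv_h q \<noteq> 0"
  using h_in f_h[of "f 0 + 1 / q"] by (auto simp: inverted_def)

lemma inv_f_inv_h: "q \<in> inv_dom \<Longrightarrow> inv_f (inv_h q) = q"
  using f_h[of "f 0 + 1 / q"] by (simp add: inverted_def inv_f_def)

lemma continuous_on_inv_h: "continuous_on inv_dom inv_h"
  by (rule continuous_on_compose2[OF holomorphic_on_imp_continuous_on[OF hol_h]])
     (auto intro!: continuous_intros simp: inverted_def)

lemma hol_inv_f: "inv_f holomorphic_on ball 0 1 - {0}"
  unfolding inv_f_def using f_neq_f0 holomorphic_on_subset[OF hol_f]
  by (intro holomorphic_intros) auto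

lemma inj_inv_f: "inj_on inv_f (ball 0 1 - {0})"
  by (rule inj_on_inverseI[where g = inv_h]) (auto simp: inv_h_inv_f)

lemma connected_inv_dom: "connected inv_dom"
proof -
  have "inv_dom = inv_f ` (ball 0 1 - {0})"
  proof
    show "inv_dom \<subseteq> inv_f ` (ball 0 1 - {0})"
    proof
      fix q assume q: "q \<in> inv_dom"
      then have "inv_h q \<in> ball 0 1 - {0}" using inv_h_in by simp
      then show "q \<in> inv_f ` (ball 0 1 - {0})" using inv_f_inv_h[OF q] by (metis image_eqI)
    qed
    show "inv_f ` (ball 0 1 - {0}) \<subseteq> inv_dom"
    proof (rule image_subsetI)
      fix z :: complex assume "z \<in> ball 0 1 - {0}"
      then show "inv_f z \<in> inv_dom" by (intro inv_f_in) auto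
    qed
  qed
  moreover have "connected (ball 0 1 - {0::complex})"
    by (rule connected_open_delete) auto
  ultimately show ?thesis
    using connected_continuous_image holomorphic_on_imp_continuous_on[OF hol_inv_f] by metis
qed

lemma inv_f_bounded:
  assumes "0 < \<rho>" "\<rho> \<le> 1"
  obtains B where "B > 0" "\<And>z. \<rho> \<le> cmod z \<Longrightarrow> cmod z < 1 \<Longrightarrow> cmod (inv_f z) \<le> B"
proof -
  have sub: "ball 0 \<rho> \<subseteq> ball 0 (1::real)" "ball (0::complex) \<rho> \<subseteq> ball 0 1" using assms by (auto simp: ball_def)
  have "open (f ` ball 0 \<rho>)"
    using holomorphic_on_subset[OF hol_f sub(2)] inj_on_subset[OF inj_f sub(2)] by (intro open_mapping_thm3) auto
  moreover have "f 0 \<in> f ` ball 0 \<rho>" using assms by auto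
  ultimately obtain c where c: "c > 0" "ball (f 0) c \<subseteq> f ` ball 0 \<rho>" using openE by blast
  show thesis
  proof (rule that[of "1 / c"])
    fix z assume z: "\<rho> \<le> cmod z" "cmod z < 1"
    have "f z \<notin> f ` ball 0 \<rho>"
    proof
      assume "f z \<in> f ` ball 0 \<rho>"
      then obtain w where w: "f z = f w" "w \<in> ball 0 \<rho>" by blast
      then have "w \<in> ball 0 1" using sub by blast
      then have "z = w" using inj_onD[OF inj_f w(1)] z by simp
      with w z show False by simp
    qed
    then have "f z \<notin> ball (f 0) c" using c(2) by blast
    then have "c \<le> cmod (f z - f 0)" by (simp add: dist_norm norm_minus_commute)
    then show "cmod (inv_f z) \<le> 1 / c" using c(1) by (simp add: inv_f_def norm_divide frac_le)
  qed (use c in simp)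
qed

text \<open>If \<open>p\<close> belonged to the open set \<open>inv_dom\<close>, continuity of the
  inverse map would make the points \<open>z n\<close> converge inside the disc.\<close>

lemma inv_f_escape:
  assumes z: "\<And>n. cmod (z n) < 1" "\<And>n. z n \<noteq> 0" and lim: "(\<lambda>n. cmod (z n)) \<longlonglongrightarrow> 1" "(\<lambda>n. inv_f (z n)) \<longlonglongrightarrow> p"
  shows "p \<in> frontier inv_dom"
proof -
  have "p \<in> closure inv_dom"
    unfolding closure_sequential using inv_f_in[OF z] lim(2) by (intro exI[of _ "\<lambda>n. inv_f (z n)"]) simp
  moreover have "p \<notin> inv_dom"
  proof
    assume p: "p \<in> inv_dom"
    have "(\<lambda>n. inv_h (inv_f (z n))) \<longlonglongrightarrow> inv_h p"
      by (rule continuous_on_tendsto_compose[OF continuous_on_inv_h lim(2) p]) (use inv_f_in[OF z] in simp)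
    then have "z \<longlonglongrightarrow> inv_h p" by (simp add: inv_h_inv_f[OF z])
    then have "(\<lambda>n. cmod (z n)) \<longlonglongrightarrow> cmod (inv_h p)" by (rule tendsto_norm)
    then have "cmod (inv_h p) = 1" using lim(1) LIMSEQ_unique by blast
    then show False using inv_h_in[OF p] by simp
  qed
  ultimately show ?thesis using open_inverted[OF open_domain] by (simp add: frontier_def interior_open)
qed

lemma inv_f_at_0: "\<exists>d>0. \<forall>z. z \<noteq> 0 \<longrightarrow> cmod z < d \<longrightarrow> B < cmod (inv_f z)"
proof -
  have "continuous_on (ball 0 1) f" by (rule holomorphic_on_imp_continuous_on[OF hol_f])
  then have "isCont f 0" by (simp add: continuous_on_eq_continuous_at)
  moreover define e where "e = 1 / (\<bar>B\<bar> + 1)"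
  have "e > 0" by (simp add: e_def)
  ultimately obtain d where d: "d > 0" "\<And>z. dist z 0 < d \<Longrightarrow> dist (f z) (f 0) < e"
    unfolding continuous_at_eps_delta by (metis dist_commute)
  have "B < cmod (inv_f z)" if z: "z \<noteq> 0" "cmod z < min d 1" for z
  proof -
    have "0 < cmod (f z - f 0)" "cmod (f z - f 0) < e"
      using f_neq_f0[of z] d(2)[of z] z by (auto simp: dist_norm)
    then have "\<bar>B\<bar> + 1 < cmod (inv_f z)" by (simp add: inv_f_def norm_divide e_def field_simps)
    then show ?thesis by linarith
  qed
  then show ?thesis using d(1) by (intro exI[of _ "min d 1"]) auto
qed

end

subsection \<open>Crosscuts\<close>

text \<open>The exponential followed by a Cayley transform maps the half strip onto a neighbourhood of
  \<open>\<xi>\<close> in the disc, and the vertical segments onto circular crosscuts around \<open>\<xi>\<close>.\<close>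

definition strip_map :: "complex \<Rightarrow> complex \<Rightarrow> complex" where
  "strip_map \<xi> w = \<xi> * (\<i> - exp w) / (\<i> + exp w)"

text \<open>An Apollonius arc with respect to \<open>\<xi>\<close> and \<open>- \<xi>\<close>. In
  this form the two sides of the crosscut are distinguished by the sign of a continuous
  function.\<close>

definition crosscut :: "complex \<Rightarrow> real \<Rightarrow> complex set" where
  "crosscut \<xi> r = {z. cmod z < 1 \<and> cmod (\<xi> - z) = r * cmod (\<xi> + z)}"

context
  fixes w :: complex
  assumes w: "0 < Im w" "Im w < pi"
begin

lemma Im_exp_strip: "Im (exp w) > 0"
  using w by (simp add: Im_exp sin_gt_zero)

lemma i_plus_exp_neq_0: "\<i> + exp w \<noteq> 0"
proof
  assume "\<i> + exp w = 0"
  then have "Im (\<i> + exp w) = 0" by simp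
  then show False using Im_exp_strip by simp
qed

text \<open>The exponential takes \<open>w\<close> to the upper half-plane, whose points are closer
  to \<open>\<i>\<close> than to \<open>- \<i>\<close>.\<close>

lemma norm_strip_map:
  assumes "cmod \<xi> = 1"
  shows "cmod (strip_map \<xi> w) < 1"
proof -
  have "(cmod (\<i> - exp w))\<^sup>2 < (cmod (\<i> + exp w))\<^sup>2"
    using Im_exp_strip unfolding cmod_power2 by (simp add: power2_eq_square algebra_simps)
  then have "cmod (\<i> - exp w) < cmod (\<i> + exp w)" by (rule power_less_imp_less_base) simp
  then show ?thesis using assms i_plus_exp_neq_0 by (simp add: strip_map_def norm_mult norm_divide)
qed

lemma strip_map_dist:
  assumes "cmod \<xi> = 1"
  shows "cmod (\<xi> - strip_map \<xi> w) = exp (Re w) * cmod (\<xi> + strip_map \<xi> w)"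
proof -
  have "\<xi> - strip_map \<xi> w = \<xi> * (2 * exp w) / (\<i> + exp w)" "\<xi> + strip_map \<xi> w = \<xi> * (2 * \<i>) / (\<i> + exp w)"
    using i_plus_exp_neq_0 by (simp_all add: strip_map_def field_simps)
  then show ?thesis using assms by (simp add: norm_mult norm_divide)
qed

end

lemma inj_on_strip_map:
  assumes "cmod \<xi> = 1"
  shows "inj_on (strip_map \<xi>) {w. 0 < Im w \<and> Im w < pi}"
proof (rule inj_onI)
  fix v w assume vw: "v \<in> {w. 0 < Im w \<and> Im w < pi}" "w \<in> {w. 0 < Im w \<and> Im w < pi}" "strip_map \<xi> v = strip_map \<xi> w"
  have nz: "\<xi> \<noteq> 0" "\<i> + exp v \<noteq> 0" "\<i> + exp w \<noteq> 0" using assms vw i_plus_exp_neq_0 by auto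
  then have "(\<i> - exp v) * (\<i> + exp w) = (\<i> - exp w) * (\<i> + exp v)"
    using vw(3) by (simp add: strip_map_def frac_eq_eq)
  then have "2 * \<i> * (exp w - exp v) = 0" by (simp add: algebra_simps)
  then have "exp v = exp w" by simp
  moreover have "0 < Im v" "Im v < pi" "0 < Im w" "Im w < pi" using vw(1,2) by auto
  then have "\<bar>Im v - Im w\<bar> < 2 * pi" by linarith
  ultimately show "v = w" by (rule exp_complex_eqI[rotated])
qed

lemma crosscut_eq_strip_map_image:
  assumes \<xi>: "cmod \<xi> = 1"
  shows "crosscut \<xi> (exp x) = (\<lambda>y. strip_map \<xi> (Complex x y)) ` {0<..<pi}"
proof
  show "(\<lambda>y. strip_map \<xi> (Complex x y)) ` {0<..<pi} \<subseteq> crosscut \<xi> (exp x)"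
    using norm_strip_map[OF _ _ \<xi>] strip_map_dist[OF _ _ \<xi>] by (auto simp: crosscut_def)
  show "crosscut \<xi> (exp x) \<subseteq> (\<lambda>y. strip_map \<xi> (Complex x y)) ` {0<..<pi}"
  proof
    fix z assume "z \<in> crosscut \<xi> (exp x)"
    then have z: "cmod z < 1" "cmod (\<xi> - z) = exp x * cmod (\<xi> + z)" by (auto simp: crosscut_def)
    have nz: "\<xi> + z \<noteq> 0"
    proof
      assume "\<xi> + z = 0"
      then have "\<xi> = - z" by (simp add: add_eq_0_iff2)
      then show False using \<xi> z(1) by simp
    qed
    \<comment> \<open>The inverse of the Cayley transform. It takes \<open>z\<close> to the upper
      half-plane, where \<open>Ln\<close> has imaginary part between \<open>0\<close> and
      \<open>pi\<close>.\<close>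
    define u where "u = \<i> * (\<xi> - z) / (\<xi> + z)"
    have "cnj (\<xi> + z) \<noteq> 0" using nz by (simp only: complex_cnj_zero_iff) simp
    then have "u = \<i> * (\<xi> - z) * cnj (\<xi> + z) / of_real ((cmod (\<xi> + z))\<^sup>2)"
      unfolding u_def complex_norm_square by (rule nonzero_mult_divide_mult_cancel_right[symmetric])
    then have "u = \<i> * ((\<xi> - z) * cnj (\<xi> + z)) / of_real ((cmod (\<xi> + z))\<^sup>2)" by (simp only: mult.assoc)
    then have "Im u = Re ((\<xi> - z) * cnj (\<xi> + z)) / (cmod (\<xi> + z))\<^sup>2" by simp
    also have "Re ((\<xi> - z) * cnj (\<xi> + z)) = (cmod \<xi>)\<^sup>2 - (cmod z)\<^sup>2"
      unfolding cmod_power2 by (simp add: power2_eq_square algebra_simps)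
    finally have "Im u > 0" using nz z(1) \<xi> by (simp add: abs_square_less_1)
    then have L: "0 < Im (Ln u)" "Im (Ln u) < pi" "u \<noteq> 0" using Im_Ln_pos_lt_imp by auto
    have "cmod u = exp x" using z(2) nz by (simp add: u_def norm_mult norm_divide)
    then have "Re (Ln u) = x" using L(3) by simp
    then have "Ln u = Complex x (Im (Ln u))" by (simp add: complex_eq_iff)
    moreover have "strip_map \<xi> (Ln u) = z"
    proof -
      have "\<i> + u = 2 * \<i> * \<xi> / (\<xi> + z)" "\<i> - u = 2 * \<i> * z / (\<xi> + z)"
        using nz by (simp_all add: u_def field_simps)
      then show ?thesis using nz \<xi> L(3) by (auto simp: strip_map_def)
    qed
    ultimately show "z \<in> (\<lambda>y. strip_map \<xi> (Complex x y)) ` {0<..<pi}"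
      using L by (metis greaterThanLessThan_iff image_eqI)
  qed
qed

text \<open>Moving down the vertical segment makes \<open>exp w\<close> tend to the positive real
  \<open>r\<close>, which has equal distances from \<open>\<i>\<close> and
  \<open>- \<i>\<close>.\<close>

lemma crosscut_escaping_sequence:
  assumes \<xi>: "cmod \<xi> = 1" and "r > 0"
  obtains z where "\<And>n. z n \<in> crosscut \<xi> r" "(\<lambda>n. cmod (z n)) \<longlonglongrightarrow> 1"
proof -
  define x where "x = ln r"
  have r: "r = exp x" using \<open>r > 0\<close> by (simp add: x_def)
  define z where "z n = strip_map \<xi> (Complex x (1 / real (Suc n)))" for n
  have "z n \<in> crosscut \<xi> r" for n
  proof -
    have "1 / real (Suc n) \<le> 1" by simp
    then have "1 / real (Suc n) < pi" using pi_gt3 by linarith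
    then show ?thesis unfolding r crosscut_eq_strip_map_image[OF \<xi>] z_def by auto
  qed
  moreover have "(\<lambda>n. cmod (z n)) \<longlonglongrightarrow> 1"
  proof -
    have "(\<lambda>n. Complex x (1 / real (Suc n))) \<longlonglongrightarrow> Complex x 0"
      unfolding Complex_eq by (intro tendsto_intros LIMSEQ_Suc lim_1_over_n)
    then have l: "(\<lambda>n. exp (Complex x (1 / real (Suc n)))) \<longlonglongrightarrow> of_real r"
      using tendsto_exp[of "\<lambda>n. Complex x (1 / real (Suc n))" "Complex x 0"] by (simp add: r Complex_eq exp_of_real)
    have nz: "\<i> + complex_of_real r \<noteq> 0" by (simp add: complex_eq_iff)
    have "(\<lambda>n. cmod (z n)) \<longlonglongrightarrow> cmod (\<xi> * (\<i> - of_real r) / (\<i> + of_real r))"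
      unfolding z_def strip_map_def by (intro tendsto_intros l nz)
    also have "cmod (\<i> - of_real r) = cmod (\<i> + of_real r)" by (simp add: cmod_def)
    then have "cmod (\<xi> * (\<i> - of_real r) / (\<i> + of_real r)) = 1" using \<xi> nz by (simp add: norm_mult norm_divide)
    finally show ?thesis .
  qed
  ultimately show thesis by (rule that)
qed

lemma (in riemann_map) short_crosscut:
  assumes \<xi>: "cmod \<xi> = 1" and "c > 0" "r0 > 0"
  obtains r where "0 < r" "r < r0" "r < 1/2"
    "\<And>z w. z \<in> crosscut \<xi> r \<Longrightarrow> w \<in> crosscut \<xi> r \<Longrightarrow> cmod (inv_f z - inv_f w) \<le> c"
proof -
  define S where "S = {w. Re w < 0 \<and> 0 < Im w \<and> Im w < pi}"
  \<comment> \<open>After the shift by \<open>1\<close> the ratio of the distances to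
    \<open>\<xi>\<close> and \<open>- \<xi>\<close> is at most \<open>exp (-1) \<le> 1/2\<close>.
    This keeps the image at modulus at least \<open>1/3\<close>, away from the pole, so that
    \<open>inv_f\<close> is bounded and injective on it.\<close>
  define E where "E w = strip_map \<xi> (w - 1)" for w
  have E1: "cmod (E w) < 1" "1/3 \<le> cmod (E w)" if "w \<in> S" for w
  proof -
    have w: "0 < Im (w - 1)" "Im (w - 1) < pi" "Re (w - 1) < - 1" using that by (auto simp: S_def)
    show "cmod (E w) < 1" unfolding E_def by (rule norm_strip_map[OF w(1,2) \<xi>])
    have "cmod (\<xi> - E w) = exp (Re (w - 1)) * cmod (\<xi> + E w)"
      unfolding E_def by (rule strip_map_dist[OF w(1,2) \<xi>])
    also have "\<dots> \<le> 1/2 * cmod (\<xi> + E w)"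
    proof (rule mult_right_mono)
      have "exp (Re (w - 1)) \<le> exp (-1)" using w by simp
      also have "\<dots> \<le> (1/2 :: real)" using exp_ge_add_one_self[of 1] by (simp add: exp_minus field_simps)
      finally show "exp (Re (w - 1)) \<le> 1/2" .
    qed simp
    finally show "1/3 \<le> cmod (E w)"
      using norm_triangle_ineq2[of \<xi> "E w"] norm_triangle_ineq[of \<xi> "E w"] \<xi> by simp
  qed
  have E2: "E ` S \<subseteq> ball 0 1 - {0}"
  proof (rule image_subsetI)
    fix w assume "w \<in> S"
    from E1[OF this] show "E w \<in> ball 0 1 - {0}" by auto
  qed
  obtain B where B: "B > 0" "\<And>z. 1/3 \<le> cmod z \<Longrightarrow> cmod z < 1 \<Longrightarrow> cmod (inv_f z) \<le> B"
    by (rule inv_f_bounded[of "1/3"]) auto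
  have nz: "\<i> + exp (w - 1) \<noteq> 0" if "w \<in> S" for w
    using that i_plus_exp_neq_0[of "w - 1"] by (simp add: S_def)
  have "E holomorphic_on S"
    unfolding E_def strip_map_def by (intro holomorphic_intros nz)
  then have hol: "(inv_f \<circ> E) holomorphic_on S"
    by (rule holomorphic_on_compose_gen[OF _ hol_inv_f E2])
  have "inj_on E S"
  proof (rule inj_onI)
    fix v w assume vw: "v \<in> S" "w \<in> S" "E v = E w"
    have "v - 1 = w - 1"
      by (rule inj_onD[OF inj_on_strip_map[OF \<xi>]]) (use vw in \<open>auto simp: S_def E_def\<close>)
    then show "v = w" by simp
  qed
  then have inj: "inj_on (inv_f \<circ> E) S"
    by (rule comp_inj_on) (rule inj_on_subset[OF inj_inv_f E2])
  have bd: "cmod ((inv_f \<circ> E) w) \<le> B" if "w \<in> S" for w using B(2) E1[OF that] by simp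
  obtain x where x: "x < ln r0" "x < 0"
    "\<And>y y'. y \<in> {0<..<pi} \<Longrightarrow> y' \<in> {0<..<pi} \<Longrightarrow> cmod ((inv_f \<circ> E) (Complex x y) - (inv_f \<circ> E) (Complex x y')) \<le> c"
    using strip_short_crosscut[OF hol[unfolded S_def] inj[unfolded S_def] bd[unfolded S_def] \<open>c > 0\<close>] by metis
  define r where "r = exp (x - 1)"
  show thesis
  proof (rule that[of r])
    show "0 < r" by (simp add: r_def)
    have "exp (x - 1) < exp (ln r0)" using x(1) by (subst exp_less_cancel_iff) simp
    then show "r < r0" using \<open>r0 > 0\<close> by (simp add: r_def)
    have "exp (x - 1) < exp (-1)" using x(2) by simp
    also have "\<dots> \<le> (1/2 :: real)" using exp_ge_add_one_self[of 1] by (simp add: exp_minus field_simps)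
    finally show "r < 1/2" by (simp add: r_def)
    fix z w assume "z \<in> crosscut \<xi> r" "w \<in> crosscut \<xi> r"
    then obtain y y' where y: "y \<in> {0<..<pi}" "z = strip_map \<xi> (Complex (x - 1) y)"
      "y' \<in> {0<..<pi}" "w = strip_map \<xi> (Complex (x - 1) y')"
      unfolding r_def crosscut_eq_strip_map_image[OF \<xi>] by auto
    have "Complex (x - 1) t = Complex x t - 1" for t by (simp add: complex_eq_iff)
    then show "cmod (inv_f z - inv_f w) \<le> c" using x(3)[OF y(1,3)] y(2,4) by (simp add: E_def)
  qed
qed


subsection \<open>Continuous extension to the boundary\<close>

context riemann_map
begin

text \<open>An intermediate value argument: the difference of the two sides of the crosscut
  equation, pulled back by \<open>inv_h\<close>, is continuous and changes sign, and it vanishes in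
  \<open>inv_dom\<close> only on the image of the crosscut.\<close>

lemma crosscut_separates:
  assumes z: "cmod z < 1" "z \<noteq> 0" "cmod (\<xi> - z) < r * cmod (\<xi> + z)"
    and w: "cmod w < 1" "w \<noteq> 0" "r * cmod (\<xi> + w) < cmod (\<xi> - w)"
  shows "\<not> connected_component (inv_dom - inv_f ` crosscut \<xi> r) (inv_f z) (inv_f w)"
proof
  assume "connected_component (inv_dom - inv_f ` crosscut \<xi> r) (inv_f z) (inv_f w)"
  then obtain W where W: "connected W" "W \<subseteq> inv_dom - inv_f ` crosscut \<xi> r" "inv_f z \<in> W" "inv_f w \<in> W"
    unfolding connected_component_def by blast
  define \<phi> where "\<phi> q = cmod (\<xi> - inv_h q) - r * cmod (\<xi> + inv_h q)" for q
  have "continuous_on W inv_h" using continuous_on_subset[OF continuous_on_inv_h] W(2) by blast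
  then have "continuous_on W \<phi>" unfolding \<phi>_def by (intro continuous_intros)
  then have "connected (\<phi> ` W)" using W(1) by (rule connected_continuous_image)
  then have "{\<phi> (inv_f z)..\<phi> (inv_f w)} \<subseteq> \<phi> ` W"
    by (rule connected_contains_Icc) (use W in auto)
  moreover have "0 \<in> {\<phi> (inv_f z)..\<phi> (inv_f w)}"
    using z w inv_h_inv_f[OF z(1,2)] inv_h_inv_f[OF w(1,2)] by (simp add: \<phi>_def)
  ultimately obtain q where q: "q \<in> W" "\<phi> q = 0" by (metis imageE subsetD)
  then have qi: "q \<in> inv_dom" using W(2) by blast
  then have "inv_h q \<in> crosscut \<xi> r" using q(2) inv_h_in[OF qi] by (simp add: crosscut_def \<phi>_def)
  then have "q \<in> inv_f ` crosscut \<xi> r" using inv_f_inv_h[OF qi] by (metis image_eqI)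
  then show False using q(1) W(2) by blast
qed

lemma crosscut_norm_ge:
  assumes "cmod \<xi> = 1" "r < 1/2" "z \<in> crosscut \<xi> r"
  shows "1/3 \<le> cmod z" "cmod z < 1"
proof -
  have "1 - cmod z \<le> cmod (\<xi> - z)" using norm_triangle_ineq2[of \<xi> z] assms by simp
  also have "\<dots> = r * cmod (\<xi> + z)" using assms by (simp add: crosscut_def)
  also have "\<dots> \<le> 1/2 * cmod (\<xi> + z)" using assms by (intro mult_right_mono) auto
  also have "\<dots> \<le> 1/2 * (1 + cmod z)" using norm_triangle_ineq[of \<xi> z] assms by simp
  finally show "1/3 \<le> cmod z" by simp
  show "cmod z < 1" using assms by (simp add: crosscut_def)
qed

text \<open>An end of the crosscut supplies the boundary point: the values of \<open>inv_f\<close>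
  along a sequence tending to the circle accumulate at some \<open>p\<close>, and all of the image
  is within \<open>c\<close> of it.\<close>

lemma crosscut_limit_point:
  assumes \<xi>: "cmod \<xi> = 1" and r: "0 < r" "r < 1/2"
    and small: "\<And>z w. z \<in> crosscut \<xi> r \<Longrightarrow> w \<in> crosscut \<xi> r \<Longrightarrow> cmod (inv_f z - inv_f w) \<le> c"
    and B: "\<And>z. 1/3 \<le> cmod z \<Longrightarrow> cmod z < 1 \<Longrightarrow> cmod (inv_f z) \<le> B"
  obtains p where "p \<in> frontier inv_dom" "cmod p \<le> B" "inv_f ` crosscut \<xi> r \<subseteq> cball p c"
proof -
  obtain z where z: "\<And>n. z n \<in> crosscut \<xi> r" "(\<lambda>n. cmod (z n)) \<longlonglongrightarrow> 1"
    using crosscut_escaping_sequence[OF \<xi> r(1)] by blast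
  note zn = crosscut_norm_ge[OF \<xi> r(2) z(1)]
  have "inv_f (z n) \<in> cball 0 B" for n using B zn by simp
  then obtain p s where p: "p \<in> cball 0 B" "strict_mono s" "((\<lambda>n. inv_f (z n)) \<circ> s) \<longlonglongrightarrow> p"
    using compact_cball[of 0 B] unfolding compact_def by (metis (no_types, lifting))
  have "z n \<noteq> 0" for n using zn(1)[of n] by auto
  moreover have "(\<lambda>n. cmod (z (s n))) \<longlonglongrightarrow> 1" using LIMSEQ_subseq_LIMSEQ[OF z(2) p(2)] by (simp add: o_def)
  ultimately have "p \<in> frontier inv_dom"
    using p(3) zn(2) by (intro inv_f_escape[of "\<lambda>n. z (s n)"]) (auto simp: o_def)
  moreover have "inv_f ` crosscut \<xi> r \<subseteq> cball p c"
  proof (rule image_subsetI)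
    fix w assume w: "w \<in> crosscut \<xi> r"
    have "(\<lambda>n. cmod (inv_f (z (s n)) - inv_f w)) \<longlonglongrightarrow> cmod (p - inv_f w)"
      using p(3) by (intro tendsto_intros) (simp add: o_def)
    then have "cmod (p - inv_f w) \<le> c"
      by (rule Lim_bounded) (use small z(1) w in auto)
    then show "inv_f w \<in> cball p c" by (simp add: dist_norm)
  qed
  ultimately show thesis using p(1) by (intro that[of p]) auto
qed

text \<open>If some point beyond the crosscut were mapped outside \<open>cball p e\<close>, Janiszewski's theorem would
  apply to the union \<open>S\<close> of the crosscut's image with a connected piece of the boundary containing
  its end points, and the complement \<open>T\<close> of the exterior domain: neither separates the image point
  from infinity, and their intersection is connected, but their union separates.\<close>

lemma cap_image_subset:
  assumes \<xi>: "cmod \<xi> = 1" and r: "r < 1/2"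
    and E: "connected E" "E \<subseteq> frontier inv_dom \<inter> cball p e" "frontier inv_dom \<inter> ball p d \<subseteq> E"
    and d: "d' < d" "d \<le> e" and cc: "inv_f ` crosscut \<xi> r \<subseteq> cball p d'"
    and z: "cmod z < 1" "cmod (\<xi> - z) < r * cmod (\<xi> + z)"
  shows "inv_f z \<in> cball p e"
proof (rule ccontr)
  assume nin: "inv_f z \<notin> cball p e"
  define \<gamma> where "\<gamma> = inv_f ` crosscut \<xi> r"
  define S where "S = closure E \<union> closure \<gamma>"
  define T where "T = - inv_dom"
  have "open inv_dom" by (rule open_inverted[OF open_domain])
  then have Fr: "frontier inv_dom = closure inv_dom \<inter> T" by (auto simp: frontier_def interior_open T_def)
  have \<gamma>U: "\<gamma> \<subseteq> inv_dom"
    unfolding \<gamma>_def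
  proof (rule image_subsetI)
    fix x assume "x \<in> crosscut \<xi> r"
    from crosscut_norm_ge[OF \<xi> r this] show "inv_f x \<in> inv_dom" by (intro inv_f_in) auto
  qed
  have clE: "closure E \<subseteq> frontier inv_dom \<inter> cball p e"
    using E(2) by (intro closure_minimal) (auto intro!: closed_Int)
  have cl\<gamma>: "closure \<gamma> \<subseteq> cball p d'" using cc unfolding \<gamma>_def by (intro closure_minimal) auto
  have Se: "S \<subseteq> cball p e" using clE cl\<gamma> d by (auto simp: S_def)
  have cS: "compact S"
    using bounded_subset[OF bounded_cball Se] unfolding compact_eq_bounded_closed
    by (simp add: S_def closed_Un)
  have cT: "closed T" unfolding T_def by (rule closed_Compl) fact
  have "S \<inter> T = closure E"
  proof
    show "closure E \<subseteq> S \<inter> T" using clE Fr by (auto simp: S_def)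
    \<comment> \<open>The closed crosscut meets the complement of the domain only in boundary
      points, and \<open>d' < d\<close> puts these into the range covered by
      \<open>E\<close>.\<close>
    have "closure \<gamma> \<inter> T \<subseteq> frontier inv_dom \<inter> ball p d"
    proof -
      have "closure \<gamma> \<subseteq> closure inv_dom" by (rule closure_mono[OF \<gamma>U])
      moreover have "cball p d' \<subseteq> ball p d" using d(1) by auto
      ultimately show ?thesis using cl\<gamma> Fr by blast
    qed
    also have "\<dots> \<subseteq> closure E" using E(3) closure_subset[of E] by blast
    finally show "S \<inter> T \<subseteq> closure E" unfolding S_def by blast
  qed
  then have conST: "connected (S \<inter> T)" using E(1) by (simp add: connected_imp_connected_closure)
  obtain d0 where d0: "d0 > 0" "\<And>w. w \<noteq> 0 \<Longrightarrow> cmod w < d0 \<Longrightarrow> cmod p + e < cmod (inv_f w)"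
    using inv_f_at_0[of "cmod p + e"] by blast
  \<comment> \<open>A point near the pole stands in for infinity: the bound \<open>d0\<close> puts
    its image outside \<open>cball p e\<close>, and modulus below \<open>1/3\<close> puts
    \<open>w\<close> on the far side of the crosscut.\<close>
  define w where "w = complex_of_real (min d0 (1/3) / 2)"
  have w: "w \<noteq> 0" "cmod w < d0" "cmod w < 1/3" using d0(1) by (auto simp: w_def simp del: of_real_divide)
  have wB: "r * cmod (\<xi> + w) < cmod (\<xi> - w)"
  proof -
    have "r * cmod (\<xi> + w) \<le> 1/2 * cmod (\<xi> + w)" using r by (intro mult_right_mono) auto
    also have "\<dots> \<le> 1/2 * (1 + cmod w)" using norm_triangle_ineq[of \<xi> w] \<xi> by simp
    also have "\<dots> < 1 - cmod w" using w(3) by simp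
    also have "\<dots> \<le> cmod (\<xi> - w)" using norm_triangle_ineq2[of \<xi> w] \<xi> by simp
    finally show ?thesis .
  qed
  have "inv_f w \<notin> cball p e"
    using d0(2)[OF w(1,2)] norm_triangle_ineq2[of "inv_f w" p] by (auto simp: dist_norm norm_minus_commute)
  have "connected (- cball p e)" by (intro connected_complement_bounded_convex) auto
  then have ccS: "connected_component (- S) (inv_f z) (inv_f w)"
    unfolding connected_component_def using Se nin \<open>inv_f w \<notin> cball p e\<close>
    by (intro exI[of _ "- cball p e"]) auto
  have z0: "z \<noteq> 0"
  proof
    assume "z = 0"
    then show False using z(2) \<xi> r by simp
  qed
  have ccT: "connected_component (- T) (inv_f z) (inv_f w)"
    unfolding connected_component_def T_def using connected_inv_dom inv_f_in[OF z(1) z0] inv_f_in[of w] w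
    by (intro exI[of _ inv_dom]) auto
  have "connected_component (- (S \<union> T)) (inv_f z) (inv_f w)"
    by (rule Janiszewski[OF cS cT conST ccS ccT])
  moreover have "- (S \<union> T) \<subseteq> inv_dom - inv_f ` crosscut \<xi> r"
    using closure_subset[of \<gamma>] by (auto simp: S_def T_def \<gamma>_def)
  ultimately have "connected_component (inv_dom - inv_f ` crosscut \<xi> r) (inv_f z) (inv_f w)"
    by (meson connected_component_of_subset)
  with crosscut_separates[OF z(1) z0 z(2) _ w(1) wB] w(3) show False by simp
qed

text \<open>The limit \<open>p\<close> is a cluster point of boundary points \<open>P n\<close> next
  to crosscut images that shrink with \<open>n\<close>. For each \<open>e\<close> a single crosscut
  close to \<open>p\<close> suffices, whatever its radius, because what lies beyond it is a
  neighbourhood of \<open>\<xi>\<close> in the disc.\<close>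

theorem inv_f_boundary_limit:
  assumes sc: "simply_connected \<Omega>" and lc: "locally connected (frontier \<Omega>)" and \<xi>: "cmod \<xi> = 1"
  obtains p where "p \<in> frontier inv_dom" "(inv_f \<longlongrightarrow> p) (at \<xi> within ball 0 1)"
proof -
  obtain B where B: "B > 0" "\<And>z. 1/3 \<le> cmod z \<Longrightarrow> cmod z < 1 \<Longrightarrow> cmod (inv_f z) \<le> B"
    by (rule inv_f_bounded[of "1/3"]) auto
  have "\<exists>r P. 0 < r \<and> r < 1/2 \<and> P \<in> frontier inv_dom \<and> cmod P \<le> B \<and> inv_f ` crosscut \<xi> r \<subseteq> cball P (1 / real (Suc n))" for n
  proof -
    have "0 < 1 / real (Suc n)" by simp
    from short_crosscut[OF \<xi> this zero_less_one] obtain r where r: "0 < r" "r < 1/2"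
      "\<And>z w. z \<in> crosscut \<xi> r \<Longrightarrow> w \<in> crosscut \<xi> r \<Longrightarrow> cmod (inv_f z - inv_f w) \<le> 1 / real (Suc n)"
      by metis
    from crosscut_limit_point[OF \<xi> r(1,2) r(3) B(2)] r show ?thesis by metis
  qed
  then obtain r P where r: "\<And>n. 0 < r n" "\<And>n. r n < 1/2" and P: "\<And>n. P n \<in> frontier inv_dom" "\<And>n. cmod (P n) \<le> B"
    and cc: "\<And>n. inv_f ` crosscut \<xi> (r n) \<subseteq> cball (P n) (1 / real (Suc n))"
    by metis
  have "compact (frontier inv_dom \<inter> cball 0 B)" by (intro closed_Int_compact) auto
  then obtain p s where p: "p \<in> frontier inv_dom \<inter> cball 0 B" "strict_mono s" "(P \<circ> s) \<longlonglongrightarrow> p"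
    using P unfolding compact_def by (metis IntI mem_cball_0)
  have main: "\<exists>d>0. \<forall>z\<in>ball 0 1. dist z \<xi> < d \<longrightarrow> dist (inv_f z) p \<le> e" if "e > 0" for e
  proof -
    obtain d0 E where E: "d0 > 0" "connected E" "E \<subseteq> frontier inv_dom \<inter> cball p e" "frontier inv_dom \<inter> ball p d0 \<subseteq> E"
      using frontier_inverted_im_kleinen[OF open_domain sc _ lc _ \<open>e > 0\<close>, of "f 0" p] f_in[of 0] p(1) by auto
    define d where "d = min d0 e"
    have d: "d > 0" "d \<le> e" "frontier inv_dom \<inter> ball p d \<subseteq> E" using E \<open>e > 0\<close> by (auto simp: d_def)
    have "(\<lambda>n. dist ((P \<circ> s) n) p + 1 / real (Suc (s n))) \<longlonglongrightarrow> 0 + 0"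
    proof (intro tendsto_add)
      show "(\<lambda>n. dist ((P \<circ> s) n) p) \<longlonglongrightarrow> 0" using p(3) by (rule iffD1[OF tendsto_dist_iff])
      show "(\<lambda>n. 1 / real (Suc (s n))) \<longlonglongrightarrow> 0"
        using LIMSEQ_subseq_LIMSEQ[OF LIMSEQ_Suc[OF lim_1_over_n[where 'a = real]] p(2)] by (simp add: o_def)
    qed
    then have "\<forall>\<^sub>F n in sequentially. dist ((P \<circ> s) n) p + 1 / real (Suc (s n)) < d"
      by (rule order_tendstoD) (use d in simp)
    then obtain n where n: "dist ((P \<circ> s) n) p + 1 / real (Suc (s n)) < d" using eventually_happens'[OF sequentially_bot] by blast
    define d' where "d' = dist ((P \<circ> s) n) p + 1 / real (Suc (s n))"
    have cc': "inv_f ` crosscut \<xi> (r (s n)) \<subseteq> cball p d'"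
    proof
      fix q assume "q \<in> inv_f ` crosscut \<xi> (r (s n))"
      then have "q \<in> cball (P (s n)) (1 / real (Suc (s n)))" using cc by blast
      then have "dist (P (s n)) q \<le> 1 / real (Suc (s n))" by simp
      then show "q \<in> cball p d'" using dist_triangle2[of p q "P (s n)"]
        by (simp add: d'_def dist_commute)
    qed
    show ?thesis
    proof (intro exI[of _ "r (s n)"] conjI ballI impI)
      show "0 < r (s n)" by (rule r(1))
      fix z :: complex assume z: "z \<in> ball 0 1" "dist z \<xi> < r (s n)"
      then have zr: "cmod (\<xi> - z) < r (s n)" by (simp add: dist_norm norm_minus_commute)
      \<comment> \<open>Near \<open>\<xi>\<close> the factor \<open>cmod (\<xi> + z)\<close> is at
        least \<open>1\<close>, so distance less than the ratio \<open>r (s n)\<close> puts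
        \<open>z\<close> beyond the crosscut.\<close>
      have "\<xi> + z = 2 * \<xi> - (\<xi> - z)" by simp
      then have "2 - cmod (\<xi> - z) \<le> cmod (\<xi> + z)" using norm_triangle_ineq2[of "2 * \<xi>" "\<xi> - z"] \<xi> by (simp add: norm_mult)
      then have "1 \<le> cmod (\<xi> + z)" using zr r(2)[of "s n"] by linarith
      then have "r (s n) * 1 \<le> r (s n) * cmod (\<xi> + z)" using r(1)[of "s n"] by (intro mult_left_mono) auto
      with zr have "cmod (\<xi> - z) < r (s n) * cmod (\<xi> + z)" by simp
      with cap_image_subset[OF \<xi> r(2) E(2,3) d(3) _ d(2) cc'] n z(1)
      have "inv_f z \<in> cball p e" by (simp add: d'_def)
      then show "dist (inv_f z) p \<le> e" by (simp add: dist_commute)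
    qed
  qed
  have "(inv_f \<longlongrightarrow> p) (at \<xi> within ball 0 1)"
    unfolding Lim_within
  proof (intro allI impI)
    fix e :: real assume "e > 0"
    then obtain d where "d > 0" "\<forall>z\<in>ball 0 1. dist z \<xi> < d \<longrightarrow> dist (inv_f z) p \<le> e / 2" using main[of "e/2"] by auto
    moreover have "e / 2 < e" using \<open>e > 0\<close> by simp
    ultimately show "\<exists>d>0. \<forall>x\<in>ball 0 1. 0 < dist x \<xi> \<and> dist x \<xi> < d \<longrightarrow> dist (inv_f x) p < e"
      by (meson le_less_trans)
  qed
  with p(1) show thesis using that by blast
qed

end


subsection \<open>The end compactification\<close>

text \<open>Take the frontier point of the segment nearest to \<open>y\<close>. A point outside the
  closure in front of it would have another frontier point between itself and
  \<open>y\<close>.\<close>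

lemma segment_to_frontier:
  fixes S :: "'a :: euclidean_space set"
  assumes "y \<in> S" "x \<in> frontier S"
  obtains q where "q \<in> frontier S" "q \<in> closed_segment y x" "closed_segment y q \<subseteq> closure S"
proof -
  have "closed (closed_segment y x \<inter> frontier S)" by (intro closed_Int) auto
  moreover have "closed_segment y x \<inter> frontier S \<noteq> {}" using assms(2) by auto
  ultimately obtain q where q: "q \<in> closed_segment y x \<inter> frontier S"
    "\<And>u. u \<in> closed_segment y x \<inter> frontier S \<Longrightarrow> dist y q \<le> dist y u"
    using distance_attains_inf by blast
  have "closed_segment y q \<subseteq> closure S"
  proof
    fix w assume w: "w \<in> closed_segment y q"
    show "w \<in> closure S"
    proof (rule ccontr)
      assume nw: "w \<notin> closure S"
      then have "w \<notin> S" using closure_subset by blast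
      then have "closed_segment y w \<inter> S \<noteq> {}" "closed_segment y w - S \<noteq> {}"
        using assms(1) by auto
      then obtain u where u: "u \<in> closed_segment y w" "u \<in> frontier S"
        using connected_Int_frontier[of "closed_segment y w" S] by auto
      have "w \<in> closed_segment y x" using w q(1) subset_closed_segment[of y q y x] by auto
      then have "u \<in> closed_segment y x" using u(1) subset_closed_segment[of y w y x] by auto
      then have "dist y q \<le> dist y u" using q(2) u(2) by blast
      moreover have "dist y w \<le> dist y q" using dist_in_closed_segment[OF w] by (simp add: dist_commute)
      ultimately have le: "dist y w \<le> dist y u" by linarith
      obtain s where s: "0 \<le> s" "s \<le> 1" "u = (1 - s) *\<^sub>R y + s *\<^sub>R w" using u(1) by (auto simp: in_segment)
      have "u - y = s *\<^sub>R (w - y)" by (simp add: s(3) algebra_simps)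
      then have "dist y u = s * dist y w" using s(1) by (metis abs_of_nonneg dist_commute dist_norm norm_scaleR)
      with le have "dist y w * (1 - s) \<le> 0" by (simp add: algebra_simps)
      then have "dist y w = 0 \<or> s = 1" using s(2) by (smt (verit, best) mult_pos_pos zero_le_dist)
      then have "u = w" using s(3) by auto
      then show False using u(2) nw by (simp add: frontier_def)
    qed
  qed
  with q(1) that show thesis by blast
qed

text \<open>Near a boundary point \<open>x\<close>, a point of \<open>S\<close> is joined to the
  boundary by a piece of the segment towards \<open>x\<close>, and from there to \<open>x\<close>
  within a small connected part of the boundary.\<close>

lemma locally_connected_closure:
  fixes S :: "'a :: euclidean_space set"
  assumes "open S" "locally connected (frontier S)"
  shows "locally connected (closure S)"
  unfolding locally_connected_im_kleinen
proof (intro allI impI)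
  fix V x assume "openin (top_of_set (closure S)) V \<and> x \<in> V"
  then obtain e where e: "e > 0" "closure S \<inter> ball x e \<subseteq> V" and x: "x \<in> closure S"
    unfolding openin_contains_ball by (metis Int_commute subsetD)
  show "\<exists>U. openin (top_of_set (closure S)) U \<and> x \<in> U \<and> U \<subseteq> V \<and> (\<forall>y. y \<in> U \<longrightarrow> (\<exists>c. connected c \<and> c \<subseteq> V \<and> x \<in> c \<and> y \<in> c))"
  proof (cases "x \<in> S")
    case True
    then obtain d where d: "d > 0" "ball x d \<subseteq> S" using \<open>open S\<close> openE by blast
    define U where "U = closure S \<inter> ball x (min d e)"
    have "U = ball x (min d e)" using d closure_subset[of S] by (auto simp: U_def)
    then have "connected U" by simp
    moreover have "openin (top_of_set (closure S)) U" by (simp add: U_def openin_open_Int)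
    moreover have "x \<in> U" "U \<subseteq> V" using x d e by (auto simp: U_def)
    ultimately show ?thesis by blast
  next
    case False
    then have xf: "x \<in> frontier S" using x \<open>open S\<close> by (simp add: frontier_def interior_open)
    have "openin (top_of_set (frontier S)) (frontier S \<inter> ball x e)" by (simp add: openin_open_Int)
    moreover have "x \<in> frontier S \<inter> ball x e" using xf e by simp
    ultimately obtain u E where u: "openin (top_of_set (frontier S)) u" "connected E" "x \<in> u" "u \<subseteq> E" "E \<subseteq> frontier S \<inter> ball x e"
      using assms(2) unfolding locally_def by meson
    obtain d where d: "d > 0" "ball x d \<inter> frontier S \<subseteq> u" using u(1,3) unfolding openin_contains_ball by blast
    define U where "U = closure S \<inter> ball x (min d e)"
    have fV: "frontier S \<inter> ball x e \<subseteq> V" using e(2) by (auto simp: frontier_def)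
    have "\<exists>c. connected c \<and> c \<subseteq> V \<and> x \<in> c \<and> y \<in> c" if y: "y \<in> U" for y
    proof (cases "y \<in> frontier S")
      case True
      then have "y \<in> E" using y d(2) u(4) by (auto simp: U_def)
      then show ?thesis using u fV by blast
    next
      case False
      then have "y \<in> S" using y \<open>open S\<close> by (simp add: U_def frontier_def interior_open)
      then obtain q where q: "q \<in> frontier S" "q \<in> closed_segment y x" "closed_segment y q \<subseteq> closure S"
        using segment_to_frontier xf by blast
      have "closed_segment y x \<subseteq> ball x (min d e)"
        using y d e by (intro closed_segment_subset) (auto simp: U_def)
      then have qb: "q \<in> ball x (min d e)" using q(2) by blast
      then have "q \<in> E" using d(2) q(1) u(4) by auto
      have "closed_segment y q \<subseteq> ball x (min d e)"
        using y qb by (intro closed_segment_subset) (auto simp: U_def)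
      also have "\<dots> \<subseteq> ball x e" by auto
      finally have sV: "closed_segment y q \<subseteq> V" using q(3) e(2) by blast
      have "connected (closed_segment y q \<union> E)"
        using u(2) \<open>q \<in> E\<close> by (intro connected_Un) auto
      then show ?thesis using u fV sV by (intro exI[of _ "closed_segment y q \<union> E"]) auto
    qed
    moreover have "openin (top_of_set (closure S)) U" by (simp add: U_def openin_open_Int)
    moreover have "x \<in> U" "U \<subseteq> V" using x d e by (auto simp: U_def)
    ultimately show ?thesis by blast
  qed
qed

lemma compact_exhaustion_mono:
  assumes "compact_exhaustion X K" "i \<le> j"
  shows "K i \<subseteq> K j"
proof -
  have "K n \<subseteq> K (Suc n)" for n
    using assms(1) interior_of_subset[of "top_of_set X" "K (Suc n)"] unfolding compact_exhaustion_def by blast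
  then show ?thesis using assms(2) by (rule lift_Suc_mono_le)
qed

lemma compact_exhaustion_covers:
  assumes K: "compact_exhaustion X K" and C: "compact C" "C \<subseteq> X"
  obtains j where "C \<subseteq> K j"
proof -
  have "\<exists>O'. open O' \<and> top_of_set X interior_of K (Suc j) = X \<inter> O'" for j
    using openin_interior_of[of "top_of_set X" "K (Suc j)"] unfolding openin_open by blast
  then obtain O' where O': "\<And>j. open (O' j)" "\<And>j. top_of_set X interior_of K (Suc j) = X \<inter> O' j" by metis
  have sub: "X \<inter> O' j \<subseteq> K (Suc j)" for j using O'(2) interior_of_subset by metis
  have "C \<subseteq> (\<Union>j\<in>UNIV. O' j)"
  proof
    fix x assume "x \<in> C"
    then obtain j where "x \<in> K j" using K C(2) unfolding compact_exhaustion_def by blast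
    then have "x \<in> X \<inter> O' j" using K O'(2)[of j] unfolding compact_exhaustion_def by blast
    then show "x \<in> (\<Union>j\<in>UNIV. O' j)" by blast
  qed
  then obtain J where J: "finite J" "C \<subseteq> (\<Union>j\<in>J. O' j)"
    using compactE_image[OF C(1), of UNIV O'] O'(1) by metis
  have "C \<subseteq> K (Suc (Max (insert 0 J)))"
  proof
    fix x assume x: "x \<in> C"
    then obtain j where j: "j \<in> J" "x \<in> O' j" using J(2) by blast
    then have "x \<in> K (Suc j)" using sub[of j] x C(2) by blast
    moreover have "Suc j \<le> Suc (Max (insert 0 J))" using J(1) j(1) by simp
    ultimately show "x \<in> K (Suc (Max (insert 0 J)))" using compact_exhaustion_mono[OF K] by blast
  qed
  then show thesis by (rule that)
qed

text \<open>Countable neighbourhood bases with a common index allow points and ends to be treated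
  alike in sequential arguments.\<close>

fun basic_nbhd :: "complex set \<Rightarrow> (nat \<Rightarrow> complex set) \<Rightarrow> end_point \<Rightarrow> nat \<Rightarrow> end_point set" where
  "basic_nbhd \<Omega> K (Pt z) n = Pt ` (ball z (1 / real (Suc n)) \<inter> closure \<Omega>)"
| "basic_nbhd \<Omega> K (End F) n = end_nbhd \<Omega> K F n"

lemma in_basic_nbhd: "\<zeta> \<in> end_carrier \<Omega> K \<Longrightarrow> \<zeta> \<in> basic_nbhd \<Omega> K \<zeta> n"
  by (cases \<zeta>) (auto simp: end_carrier_def end_nbhd_def split: if_splits)

text \<open>Local connectedness makes the components of \<open>closure \<Omega> - K j\<close>
  relatively open, so that the basic neighbourhoods of ends are open in
  \<open>end_topology\<close>.\<close>

locale end_space =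
  fixes \<Omega> :: "complex set" and K :: "nat \<Rightarrow> complex set"
  assumes exh: "compact_exhaustion (closure \<Omega>) K"
    and lc: "locally connected (closure \<Omega>)"
begin

abbreviation "ES \<equiv> end_topology \<Omega> K"

lemma compact_K: "compact (K j)"
  using exh by (simp add: compact_exhaustion_def)

lemma end_component: "F \<in> ends (closure \<Omega>) K \<Longrightarrow> F j \<in> components (closure \<Omega> - K j)"
  by (simp add: ends_def)

lemma end_antimono: "F \<in> ends (closure \<Omega>) K \<Longrightarrow> i \<le> j \<Longrightarrow> F j \<subseteq> F i"
  using lift_Suc_antimono_le[of F i j] by (auto simp: ends_def)

lemma openin_end_component:
  assumes "F \<in> ends (closure \<Omega>) K"
  shows "openin (top_of_set (closure \<Omega>)) (F j)"
proof -
  have "openin (top_of_set (closure \<Omega>)) (closure \<Omega> - K j)"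
    using compact_K[THEN compact_imp_closed] by (simp add: openin_diff closed_subset closedin_closed_Int Diff_eq openin_open_Int open_Compl)
  moreover from this have "openin (top_of_set (closure \<Omega> - K j)) (F j)"
    using locally_open_subset[OF lc] end_component[OF assms] by (intro openin_components_locally_connected) auto
  ultimately show ?thesis using openin_trans by blast
qed

lemma end_unique:
  assumes F: "F \<in> ends (closure \<Omega>) K" and G: "G \<in> ends (closure \<Omega>) K" and "F \<nu> \<noteq> G \<nu>"
  shows "F \<nu> \<inter> G \<nu> = {}"
  using components_nonoverlap[OF end_component[OF F] end_component[OF G]] assms(3) by blast

lemma bounded_subset_K:
  obtains j where "closure \<Omega> \<inter> cball c R \<subseteq> K j"
  by (rule compact_exhaustion_covers[OF exh, of "closure \<Omega> \<inter> cball c R"]) (auto intro: closed_Int_compact)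

lemma openin_basic_nbhd:
  assumes \<zeta>: "\<zeta> \<in> end_carrier \<Omega> K"
  shows "openin ES (basic_nbhd \<Omega> K \<zeta> n)"
  unfolding openin_end_topology
proof (cases \<zeta>)
  case (Pt z)
  show "end_open \<Omega> K (basic_nbhd \<Omega> K \<zeta> n)"
    unfolding end_open_def
  proof (intro conjI allI impI)
    show "basic_nbhd \<Omega> K \<zeta> n \<subseteq> end_carrier \<Omega> K" by (auto simp: Pt end_carrier_def)
  next
    fix w assume "Pt w \<in> basic_nbhd \<Omega> K \<zeta> n"
    then have "w \<in> ball z (1 / real (Suc n))" by (auto simp: Pt)
    then obtain r where "r > 0" "ball w r \<subseteq> ball z (1 / real (Suc n))" using openE[OF open_ball] by blast
    then show "\<exists>r>0. Pt ` (ball w r \<inter> closure \<Omega>) \<subseteq> basic_nbhd \<Omega> K \<zeta> n" by (intro exI[of _ r]) (auto simp: Pt)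
  qed (auto simp: Pt)
next
  case (End F)
  then have F: "F \<in> ends (closure \<Omega>) K" and unb: "\<not> bounded \<Omega>"
    using \<zeta> by (auto simp: end_carrier_def split: if_splits)
  show "end_open \<Omega> K (basic_nbhd \<Omega> K \<zeta> n)"
    unfolding end_open_def
  proof (intro conjI allI impI)
    have "F n \<subseteq> closure \<Omega>" using in_components_subset[OF end_component[OF F]] by blast
    then show "basic_nbhd \<Omega> K \<zeta> n \<subseteq> end_carrier \<Omega> K"
      using unb by (auto simp: End end_carrier_def end_nbhd_def)
  next
    fix w assume "Pt w \<in> basic_nbhd \<Omega> K \<zeta> n"
    then have "w \<in> F n" by (auto simp: End end_nbhd_def)
    then obtain r where "r > 0" "ball w r \<inter> closure \<Omega> \<subseteq> F n"
      using openin_end_component[OF F, of n] unfolding openin_contains_ball by blast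
    then show "\<exists>r>0. Pt ` (ball w r \<inter> closure \<Omega>) \<subseteq> basic_nbhd \<Omega> K \<zeta> n"
      by (intro exI[of _ r]) (auto simp: End end_nbhd_def)
  next
    fix G assume "End G \<in> basic_nbhd \<Omega> K \<zeta> n"
    then have G: "\<forall>\<nu>\<le>n. G \<nu> = F \<nu>" by (auto simp: End end_nbhd_def)
    then show "\<exists>j. end_nbhd \<Omega> K G j \<subseteq> basic_nbhd \<Omega> K \<zeta> n"
      by (intro exI[of _ n]) (auto simp: End end_nbhd_def)
  qed
qed

lemma in_closure_of_basic_nbhd:
  assumes "\<eta> \<in> ES closure_of S"
  shows "\<eta> \<in> end_carrier \<Omega> K" "basic_nbhd \<Omega> K \<eta> m \<inter> S \<noteq> {}"
proof -
  have c: "\<eta> \<in> topspace ES" and a: "\<And>T. \<eta> \<in> T \<Longrightarrow> openin ES T \<Longrightarrow> \<exists>y. y \<in> S \<and> y \<in> T"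
    using assms unfolding in_closure_of by simp_all
  then show c': "\<eta> \<in> end_carrier \<Omega> K" by (simp add: topspace_end_topology)
  show "basic_nbhd \<Omega> K \<eta> m \<inter> S \<noteq> {}"
    using a[OF in_basic_nbhd[OF c'] openin_basic_nbhd[OF c'], of m] by blast
qed

text \<open>No end is adherent to a bounded set, because that set is contained in some
  \<open>K j\<close>, which the sets of an end eventually avoid.\<close>

lemma closure_of_basic_nbhd_Pt:
  "ES closure_of basic_nbhd \<Omega> K (Pt z) n \<subseteq> Pt ` (cball z (1 / real (Suc n)) \<inter> closure \<Omega>)"
proof
  fix \<eta> assume \<eta>: "\<eta> \<in> ES closure_of basic_nbhd \<Omega> K (Pt z) n"
  note c = in_closure_of_basic_nbhd(1)[OF \<eta>] and meets = in_closure_of_basic_nbhd(2)[OF \<eta>]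
  show "\<eta> \<in> Pt ` (cball z (1 / real (Suc n)) \<inter> closure \<Omega>)"
  proof (cases \<eta>)
    case (Pt w)
    have "dist z w \<le> 1 / real (Suc n) + 1 / real (Suc m)" for m
    proof -
      obtain u where "u \<in> ball w (1 / real (Suc m))" "u \<in> ball z (1 / real (Suc n))"
        using meets[of m] by (auto simp: Pt)
      then show ?thesis using dist_triangle2[of z w u] by (simp add: dist_commute)
    qed
    moreover have "(\<lambda>m. 1 / real (Suc n) + 1 / real (Suc m)) \<longlonglongrightarrow> 1 / real (Suc n) + 0"
      by (intro tendsto_add tendsto_const LIMSEQ_Suc lim_1_over_n)
    ultimately have "dist z w \<le> 1 / real (Suc n) + 0" by (intro LIMSEQ_le_const) auto
    moreover have "w \<in> closure \<Omega>" using c by (auto simp: Pt end_carrier_def split: if_splits)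
    ultimately show ?thesis by (auto simp: Pt)
  next
    case (End G)
    then have G: "G \<in> ends (closure \<Omega>) K" using c by (auto simp: end_carrier_def split: if_splits)
    obtain j where j: "closure \<Omega> \<inter> cball z (1 / real (Suc n)) \<subseteq> K j" by (rule bounded_subset_K)
    have "G j \<inter> K j = {}" using in_components_subset[OF end_component[OF G]] by blast
    moreover obtain u where "u \<in> G j" "u \<in> ball z (1 / real (Suc n))" "u \<in> closure \<Omega>"
      using meets[of j] by (auto simp: End end_nbhd_def)
    ultimately show ?thesis using j by auto
  qed
qed

text \<open>The closure costs one index. A limit point \<open>w\<close> of \<open>F (Suc n)\<close>
  is not in \<open>K n\<close>, which lies in the relative interior of \<open>K (Suc n)\<close>;
  since \<open>insert w (F n)\<close> is connected, \<open>w\<close> belongs to the component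
  \<open>F n\<close>.\<close>

lemma closure_of_basic_nbhd_End:
  assumes F: "F \<in> ends (closure \<Omega>) K"
  shows "ES closure_of basic_nbhd \<Omega> K (End F) (Suc n) \<subseteq> end_nbhd \<Omega> K F n"
proof
  fix \<eta> assume \<eta>: "\<eta> \<in> ES closure_of basic_nbhd \<Omega> K (End F) (Suc n)"
  note c = in_closure_of_basic_nbhd(1)[OF \<eta>] and meets = in_closure_of_basic_nbhd(2)[OF \<eta>]
  show "\<eta> \<in> end_nbhd \<Omega> K F n"
  proof (cases \<eta>)
    case (Pt w)
    have wX: "w \<in> closure \<Omega>" using c by (auto simp: Pt end_carrier_def split: if_splits)
    have ap: "\<exists>u\<in>F (Suc n). dist u w < e" if "e > 0" for e
    proof -
      obtain m where "1 / real (Suc m) < e" using \<open>e > 0\<close> nat_approx_posE by blast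
      moreover obtain u where "u \<in> ball w (1 / real (Suc m))" "u \<in> F (Suc n)"
        using meets[of m] by (auto simp: Pt end_nbhd_def)
      ultimately show ?thesis by (intro bexI[of _ u]) (auto simp: dist_commute)
    qed
    have "w \<notin> K n"
    proof
      assume "w \<in> K n"
      then have "w \<in> top_of_set (closure \<Omega>) interior_of K (Suc n)"
        using exh unfolding compact_exhaustion_def by blast
      moreover have "openin (top_of_set (closure \<Omega>)) (top_of_set (closure \<Omega>) interior_of K (Suc n))"
        by (rule openin_interior_of)
      ultimately obtain e where e: "e > 0" "ball w e \<inter> closure \<Omega> \<subseteq> top_of_set (closure \<Omega>) interior_of K (Suc n)"
        unfolding openin_contains_ball by blast
      obtain u where u: "u \<in> F (Suc n)" "dist u w < e" using ap[OF e(1)] by blast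
      then have "u \<in> closure \<Omega>" "u \<notin> K (Suc n)" using in_components_subset[OF end_component[OF F]] by blast+
      moreover have "u \<in> ball w e" using u(2) by (simp add: dist_commute)
      ultimately show False using e(2) interior_of_subset[of "top_of_set (closure \<Omega>)" "K (Suc n)"] by blast
    qed
    have "w \<in> closure (F n)"
    proof -
      have "w \<in> closure (F (Suc n))" using ap unfolding closure_approachable by blast
      then show ?thesis using closure_mono[OF end_antimono[OF F, of n "Suc n"]] by auto
    qed
    then have "insert w (F n) \<subseteq> closure (F n)" using closure_subset by blast
    then have "connected (insert w (F n))"
      using connected_intermediate_closure[OF in_components_connected[OF end_component[OF F, of n]]] by blast
    moreover have "insert w (F n) \<subseteq> closure \<Omega> - K n"
      using in_components_subset[OF end_component[OF F, of n]] wX \<open>w \<notin> K n\<close> by blast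
    moreover have "F n \<inter> insert w (F n) \<noteq> {}" using in_components_nonempty[OF end_component[OF F]] by blast
    ultimately have "insert w (F n) \<subseteq> F n"
      using components_maximal[OF end_component[OF F, of n]] by blast
    then show ?thesis by (auto simp: Pt end_nbhd_def)
  next
    case (End G)
    then have G: "G \<in> ends (closure \<Omega>) K" using c by (auto simp: end_carrier_def split: if_splits)
    have "G \<nu> = F \<nu>" if "\<nu> \<le> n" for \<nu>
    proof (rule ccontr)
      assume ne: "G \<nu> \<noteq> F \<nu>"
      from meets[of "Suc n"] show False
        unfolding End basic_nbhd.simps end_nbhd_def
      proof (safe, goal_cases)
        case (1 _ u)
        moreover have "G (Suc n) \<subseteq> G \<nu>" "F (Suc n) \<subseteq> F \<nu>"
          using end_antimono[OF G] end_antimono[OF F] \<open>\<nu> \<le> n\<close> by auto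
        ultimately show ?case using end_unique[OF G F ne] by blast
      next
        case (2 _ H)
        then show ?case using ne \<open>\<nu> \<le> n\<close> by (metis le_SucI)
      qed
    qed
    then show ?thesis using G by (auto simp: End end_nbhd_def)
  qed
qed

lemma basic_nbhd_converges:
  assumes c: "\<zeta> \<in> end_carrier \<Omega> K" and x: "\<And>n. Pt (x n) \<in> basic_nbhd \<Omega> K \<zeta> n" and lim: "x \<longlonglongrightarrow> z0"
  shows "\<zeta> = Pt z0"
proof (cases \<zeta>)
  case (Pt z)
  have "x \<longlonglongrightarrow> z"
    unfolding tendsto_dist_iff[of x z]
  proof (rule Lim_null_comparison)
    show "\<forall>\<^sub>F n in sequentially. norm (dist (x n) z) \<le> 1 / real (Suc n)"
    proof (rule always_eventually, rule allI)
      fix n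
      have "x n \<in> ball z (1 / real (Suc n))" using x[of n] by (auto simp: Pt)
      then show "norm (dist (x n) z) \<le> 1 / real (Suc n)" by (simp add: dist_commute)
    qed
    show "(\<lambda>n. 1 / real (Suc n)) \<longlonglongrightarrow> 0" by (intro LIMSEQ_Suc lim_1_over_n)
  qed
  then show ?thesis using LIMSEQ_unique[OF lim] by (simp add: Pt)
next
  case (End F)
  then have F: "F \<in> ends (closure \<Omega>) K" using c by (auto simp: end_carrier_def split: if_splits)
  have xF: "x n \<in> F n" for n using x[of n] by (auto simp: End end_nbhd_def)
  have "bounded (range x)" using lim by (rule convergent_imp_bounded)
  then obtain R where "\<And>n. cmod (x n) \<le> R" unfolding bounded_iff by blast
  moreover obtain j where "closure \<Omega> \<inter> cball 0 R \<subseteq> K j" by (rule bounded_subset_K)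
  ultimately have "x j \<in> closure \<Omega> \<Longrightarrow> x j \<in> K j" by auto
  then show ?thesis using xF[of j] in_components_subset[OF end_component[OF F, of j]] by blast
qed

lemma basic_nbhd_escaping:
  assumes c: "\<zeta> \<in> end_carrier \<Omega> K" and x: "\<And>n. Pt (x n) \<in> basic_nbhd \<Omega> K \<zeta> n"
    and unb: "\<And>R. \<exists>n. R < cmod (x n)"
  obtains F where "\<zeta> = End F" "F \<in> ends (closure \<Omega>) K" "\<And>n. x n \<in> F n"
proof (cases \<zeta>)
  case (Pt z)
  obtain n where n: "cmod z + 1 < cmod (x n)" using unb by blast
  have "x n \<in> ball z (1 / real (Suc n))" using x[of n] by (auto simp: Pt)
  then have "cmod (x n - z) < 1 / real (Suc n)" by (simp add: dist_norm norm_minus_commute)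
  also have "\<dots> \<le> 1" by simp
  finally show ?thesis using n norm_triangle_ineq2[of "x n" z] by linarith
next
  case (End F)
  moreover have "F \<in> ends (closure \<Omega>) K" using c End by (auto simp: end_carrier_def split: if_splits)
  moreover have "x n \<in> F n" for n using x[of n] by (auto simp: End end_nbhd_def)
  ultimately show ?thesis by (rule that)
qed

lemma disjoint_closures_Pt_End:
  assumes F: "F \<in> ends (closure \<Omega>) K"
  shows "\<exists>n. \<forall>m\<ge>n. (ES closure_of basic_nbhd \<Omega> K (Pt z) m) \<inter> (ES closure_of basic_nbhd \<Omega> K (End F) (Suc m)) = {}"
proof -
  obtain j where j: "closure \<Omega> \<inter> cball z 1 \<subseteq> K j" by (rule bounded_subset_K)
  have "(ES closure_of basic_nbhd \<Omega> K (Pt z) m) \<inter> (ES closure_of basic_nbhd \<Omega> K (End F) (Suc m)) = {}" if "j \<le> m" for m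
  proof -
    have "F m \<inter> K j = {}"
      using in_components_subset[OF end_component[OF F, of m]] compact_exhaustion_mono[OF exh that] by blast
    moreover have "cball z (1 / real (Suc m)) \<subseteq> cball z 1" by (rule subset_cball) simp
    ultimately have "Pt ` (cball z (1 / real (Suc m)) \<inter> closure \<Omega>) \<inter> end_nbhd \<Omega> K F m = {}"
      using j by (auto simp: end_nbhd_def)
    then show ?thesis
      using closure_of_basic_nbhd_Pt[of z m] closure_of_basic_nbhd_End[OF F, of m] by blast
  qed
  then show ?thesis by blast
qed

lemma basic_nbhd_antimono:
  assumes "\<zeta> \<in> end_carrier \<Omega> K" "i \<le> j"
  shows "basic_nbhd \<Omega> K \<zeta> j \<subseteq> basic_nbhd \<Omega> K \<zeta> i"
proof (cases \<zeta>)
  case (Pt z)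
  have "1 / real (Suc j) \<le> 1 / real (Suc i)" using assms(2) by (intro divide_left_mono) auto
  then show ?thesis by (auto simp: Pt)
next
  case (End F)
  then have "F \<in> ends (closure \<Omega>) K" using assms(1) by (auto simp: end_carrier_def split: if_splits)
  then show ?thesis using end_nbhd_antimono[OF _ assms(2)] by (simp add: End)
qed

text \<open>Having all large indices allows the neighbourhoods to shrink along a sequence of
  counterexamples.\<close>

lemma disjoint_closures:
  assumes c: "\<zeta> \<in> end_carrier \<Omega> K" "\<eta> \<in> end_carrier \<Omega> K" and "\<zeta> \<noteq> \<eta>"
  obtains n where "\<And>m. n \<le> m \<Longrightarrow>
    (ES closure_of basic_nbhd \<Omega> K \<zeta> m) \<inter> (ES closure_of basic_nbhd \<Omega> K \<eta> m) = {}"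
proof -
  have "\<exists>n. (ES closure_of basic_nbhd \<Omega> K \<zeta> n) \<inter> (ES closure_of basic_nbhd \<Omega> K \<eta> n) = {}"
  proof (cases \<zeta>; cases \<eta>)
    fix z w assume e: "\<zeta> = Pt z" "\<eta> = Pt w"
    then have "dist z w / 2 > 0" using \<open>\<zeta> \<noteq> \<eta>\<close> by simp
    then obtain n where n: "1 / real (Suc n) < dist z w / 2" using nat_approx_posE by blast
    have "cball z (1 / real (Suc n)) \<inter> cball w (1 / real (Suc n)) = {}"
      using n by (intro disjoint_cballI) linarith
    then have "Pt ` (cball z (1 / real (Suc n)) \<inter> closure \<Omega>) \<inter> Pt ` (cball w (1 / real (Suc n)) \<inter> closure \<Omega>) = {}"
      by auto
    then show ?thesis
      using closure_of_basic_nbhd_Pt[of z n] closure_of_basic_nbhd_Pt[of w n] unfolding e by blast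
  next
    fix z F assume e: "\<zeta> = Pt z" "\<eta> = End F"
    then have F: "F \<in> ends (closure \<Omega>) K" using c(2) by (auto simp: end_carrier_def split: if_splits)
    obtain n where "(ES closure_of basic_nbhd \<Omega> K (Pt z) n) \<inter> (ES closure_of basic_nbhd \<Omega> K (End F) (Suc n)) = {}"
      using disjoint_closures_Pt_End[OF F] by blast
    moreover have "ES closure_of basic_nbhd \<Omega> K (Pt z) (Suc n) \<subseteq> ES closure_of basic_nbhd \<Omega> K (Pt z) n"
      using c(1) unfolding e by (intro closure_of_mono basic_nbhd_antimono) auto
    ultimately show ?thesis unfolding e by blast
  next
    fix z F assume e: "\<zeta> = End F" "\<eta> = Pt z"
    then have F: "F \<in> ends (closure \<Omega>) K" using c(1) by (auto simp: end_carrier_def split: if_splits)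
    obtain n where "(ES closure_of basic_nbhd \<Omega> K (Pt z) n) \<inter> (ES closure_of basic_nbhd \<Omega> K (End F) (Suc n)) = {}"
      using disjoint_closures_Pt_End[OF F] by blast
    moreover have "ES closure_of basic_nbhd \<Omega> K (Pt z) (Suc n) \<subseteq> ES closure_of basic_nbhd \<Omega> K (Pt z) n"
      using c(2) unfolding e by (intro closure_of_mono basic_nbhd_antimono) auto
    ultimately show ?thesis unfolding e by blast
  next
    fix F G assume e: "\<zeta> = End F" "\<eta> = End G"
    then have F: "F \<in> ends (closure \<Omega>) K" and G: "G \<in> ends (closure \<Omega>) K"
      using c by (auto simp: end_carrier_def split: if_splits)
    obtain \<nu> where "F \<nu> \<noteq> G \<nu>" using e \<open>\<zeta> \<noteq> \<eta>\<close> by (metis ext)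
    then have "end_nbhd \<Omega> K F \<nu> \<inter> end_nbhd \<Omega> K G \<nu> = {}"
      using end_unique[OF F G] by (auto simp: end_nbhd_def)
    then show ?thesis
      using closure_of_basic_nbhd_End[OF F, of \<nu>] closure_of_basic_nbhd_End[OF G, of \<nu>] unfolding e
      by (intro exI[of _ "Suc \<nu>"]) blast
  qed
  then obtain n where n: "(ES closure_of basic_nbhd \<Omega> K \<zeta> n) \<inter> (ES closure_of basic_nbhd \<Omega> K \<eta> n) = {}" by blast
  show thesis
  proof (rule that)
    fix m assume "n \<le> m"
    then have "ES closure_of basic_nbhd \<Omega> K \<zeta> m \<subseteq> ES closure_of basic_nbhd \<Omega> K \<zeta> n"
      "ES closure_of basic_nbhd \<Omega> K \<eta> m \<subseteq> ES closure_of basic_nbhd \<Omega> K \<eta> n"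
      by (simp_all add: closure_of_mono basic_nbhd_antimono c)
    with n show "(ES closure_of basic_nbhd \<Omega> K \<zeta> m) \<inter> (ES closure_of basic_nbhd \<Omega> K \<eta> m) = {}" by blast
  qed
qed

end


subsection \<open>Locally connected boundary implies visibility\<close>

context riemann_map
begin

lemma inv_f_h: "z \<in> \<Omega> \<Longrightarrow> inv_f (h z) = 1 / (z - f 0)"
  by (simp add: inv_f_def f_h)

lemma compact_subdisc_image:
  assumes "r < 1"
  shows "compact (f ` cball 0 r)" "f ` cball 0 r \<subseteq> \<Omega>"
proof -
  have sub: "cball 0 r \<subseteq> ball (0::complex) 1" using assms by auto
  show "compact (f ` cball 0 r)"
    using continuous_on_subset[OF holomorphic_on_imp_continuous_on[OF hol_f] sub]
    by (rule compact_continuous_image) simp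
  show "f ` cball 0 r \<subseteq> \<Omega>" using sub f_image by blast
qed

text \<open>Almost-geodesics that leave the compact sets \<open>f ` cball 0 (1 - 1 / (n + 2))\<close> have, in the disc,
  diameters tending to \<open>0\<close>; after passing to a subsequence they converge uniformly.\<close>

lemma escaping_almost_geodesics_converge:
  assumes sc: "simply_connected \<Omega>" and lc: "locally connected (frontier \<Omega>)" and "L \<ge> 1"
    and \<sigma>: "\<And>n. almost_geodesic \<Omega> L \<kappa> {0..T n} (\<sigma> n)" and T: "\<And>n. 0 \<le> T n"
    and esc: "\<And>n. \<sigma> n ` {0..T n} \<inter> f ` cball 0 (1 - 1 / (real n + 2)) = {}"
  obtains p s where "strict_mono (s :: nat \<Rightarrow> nat)"
    "\<And>e. e > 0 \<Longrightarrow> \<forall>\<^sub>F n in sequentially. \<forall>t\<in>{0..T (s n)}. dist (1 / (\<sigma> (s n) t - f 0)) p < e"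
proof -
  define \<tau> where "\<tau> n t = h (\<sigma> n t)" for n t
  have \<sigma>in: "\<sigma> n t \<in> \<Omega>" if "t \<in> {0..T n}" for n t using \<sigma>[of n] that by (auto simp: almost_geodesic_def)
  have \<tau>1: "cmod (\<tau> n t) < 1" if "t \<in> {0..T n}" for n t using h_in \<sigma>in[OF that] by (simp add: \<tau>_def)
  have \<tau>2: "1 - 1 / (real n + 2) < cmod (\<tau> n t)" if t: "t \<in> {0..T n}" for n t
  proof (rule ccontr)
    assume "\<not> ?thesis"
    then have "\<tau> n t \<in> cball 0 (1 - 1 / (real n + 2))" by simp
    then have "\<sigma> n t \<in> f ` cball 0 (1 - 1 / (real n + 2))" using f_h[OF \<sigma>in[OF t]] unfolding \<tau>_def by (metis image_eqI)
    then show False using esc[of n] t by blast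
  qed
  define D where "D n = 8 * L\<^sup>2 * sqrt (2 / (real n + 2) * exp \<kappa>)" for n
  have D: "dist (\<tau> n s) (\<tau> n t) \<le> D n" if "s \<in> {0..T n}" "t \<in> {0..T n}" for n s t
    unfolding \<tau>_def D_def
  proof (rule almost_geodesic_diameter[OF \<sigma> \<open>L \<ge> 1\<close> _ that])
    fix u assume u: "u \<in> {0..T n}"
    have "1 - (cmod (\<tau> n u))\<^sup>2 = (1 - cmod (\<tau> n u)) * (1 + cmod (\<tau> n u))" by (simp add: power2_eq_square algebra_simps)
    also have "\<dots> \<le> 1 / (real n + 2) * 2"
      using \<tau>1[OF u] \<tau>2[OF u] by (intro mult_mono) auto
    finally show "1 - (cmod (h (\<sigma> n u)))\<^sup>2 \<le> 2 / (real n + 2)" by (simp add: \<tau>_def)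
  qed
  have D0: "D \<longlonglongrightarrow> 0"
  proof -
    have "(\<lambda>n. 2 / (real n + 2)) \<longlonglongrightarrow> 0" by real_asymp
    then have "D \<longlonglongrightarrow> 8 * L\<^sup>2 * sqrt (0 * exp \<kappa>)" unfolding D_def by (intro tendsto_intros)
    then show ?thesis by simp
  qed
  have z0: "0 \<in> {0..T n}" for n using T by simp
  have "\<tau> n 0 \<in> cball 0 1" for n using \<tau>1[OF z0] by (simp add: less_imp_le)
  then obtain \<xi> s where \<xi>: "strict_mono s" "((\<lambda>n. \<tau> n 0) \<circ> s) \<longlonglongrightarrow> \<xi>"
    using compact_cball[of "0::complex" 1] unfolding compact_def by (metis (no_types, lifting))
  have "(\<lambda>n. cmod (\<tau> n 0)) \<longlonglongrightarrow> 1"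
  proof (rule tendsto_sandwich)
    show "(\<lambda>n. 1 - 1 / (real n + 2)) \<longlonglongrightarrow> 1" by real_asymp
    show "\<forall>\<^sub>F n in sequentially. 1 - 1 / (real n + 2) \<le> cmod (\<tau> n 0)" using \<tau>2[OF z0] by (simp add: less_imp_le)
    show "\<forall>\<^sub>F n in sequentially. cmod (\<tau> n 0) \<le> 1" using \<tau>1[OF z0] by (simp add: less_imp_le)
  qed auto
  then have "((\<lambda>n. cmod (\<tau> n 0)) \<circ> s) \<longlonglongrightarrow> 1" using \<xi>(1) by (rule LIMSEQ_subseq_LIMSEQ)
  moreover have "((\<lambda>n. cmod (\<tau> n 0)) \<circ> s) \<longlonglongrightarrow> cmod \<xi>" using tendsto_norm[OF \<xi>(2)] by (simp add: o_def)
  ultimately have "cmod \<xi> = 1" using LIMSEQ_unique by blast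
  then obtain p where p: "(inv_f \<longlongrightarrow> p) (at \<xi> within ball 0 1)"
    using inv_f_boundary_limit[OF sc lc] by blast
  show thesis
  proof (rule that[OF \<xi>(1)])
    fix e :: real assume "e > 0"
    then obtain d where d: "d > 0" "\<And>x. x \<in> ball 0 1 \<Longrightarrow> 0 < dist x \<xi> \<Longrightarrow> dist x \<xi> < d \<Longrightarrow> dist (inv_f x) p < e"
      using p unfolding Lim_within by metis
    have e1: "\<forall>\<^sub>F n in sequentially. dist (((\<lambda>n. \<tau> n 0) \<circ> s) n) \<xi> < d / 2" by (rule tendstoD[OF \<xi>(2)]) (use d in simp)
    have e2: "\<forall>\<^sub>F n in sequentially. (D \<circ> s) n < d / 2"
      using LIMSEQ_subseq_LIMSEQ[OF D0 \<xi>(1)] by (rule order_tendstoD) (use d in simp)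
    from e1 e2 show "\<forall>\<^sub>F n in sequentially. \<forall>t\<in>{0..T (s n)}. dist (1 / (\<sigma> (s n) t - f 0)) p < e"
    proof eventually_elim
      case (elim n)
      show ?case
      proof
        fix t assume t: "t \<in> {0..T (s n)}"
        have "dist (\<tau> (s n) t) \<xi> \<le> dist (\<tau> (s n) t) (\<tau> (s n) 0) + dist (\<tau> (s n) 0) \<xi>" by (rule dist_triangle)
        also have "\<dots> < d" using D[OF t z0] elim by simp
        finally have "dist (\<tau> (s n) t) \<xi> < d" .
        moreover have "\<tau> (s n) t \<noteq> \<xi>" using \<tau>1[OF t] \<open>cmod \<xi> = 1\<close> by auto
        ultimately have "dist (inv_f (\<tau> (s n) t)) p < e" using \<tau>1[OF t] by (intro d(2)) auto
        then show "dist (1 / (\<sigma> (s n) t - f 0)) p < e" using inv_f_h[OF \<sigma>in[OF t]] by (simp add: \<tau>_def)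
      qed
    qed
  qed
qed

theorem locally_connected_imp_visible_pair:
  assumes sc: "simply_connected \<Omega>" and lcf: "locally connected (frontier \<Omega>)" and "L \<ge> 1"
    and exh: "compact_exhaustion (closure \<Omega>) K"
    and \<zeta>: "\<zeta> \<in> end_boundary \<Omega> K" and \<eta>: "\<eta> \<in> end_boundary \<Omega> K" and "\<zeta> \<noteq> \<eta>"
  shows "visible_pair \<Omega> K L \<kappa> \<zeta> \<eta>"
proof (rule ccontr)
  assume nv: "\<not> visible_pair \<Omega> K L \<kappa> \<zeta> \<eta>"
  interpret end_space \<Omega> K
    by (rule end_space.intro[OF exh locally_connected_closure[OF open_domain lcf]])
  have c: "\<zeta> \<in> end_carrier \<Omega> K" "\<eta> \<in> end_carrier \<Omega> K" using \<zeta> \<eta> by (auto simp: end_boundary_def)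
  obtain n0 where n0: "\<And>m. n0 \<le> m \<Longrightarrow>
      (ES closure_of basic_nbhd \<Omega> K \<zeta> m) \<inter> (ES closure_of basic_nbhd \<Omega> K \<eta> m) = {}"
    using disjoint_closures[OF c \<open>\<zeta> \<noteq> \<eta>\<close>] by blast
  \<comment> \<open>The offset \<open>n0\<close> guarantees disjoint closures, so visibility can
    fail for these neighbourhoods only through an almost-geodesic that misses the compact
    set.\<close>
  have "\<exists>T\<ge>0. \<exists>\<sigma>. almost_geodesic \<Omega> L \<kappa> {0..T} \<sigma> \<and> Pt (\<sigma> 0) \<in> basic_nbhd \<Omega> K \<zeta> (n0 + n) \<and>
      Pt (\<sigma> T) \<in> basic_nbhd \<Omega> K \<eta> (n0 + n) \<and> \<sigma> ` {0..T} \<inter> f ` cball 0 (1 - 1 / (real n + 2)) = {}" for n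
  proof (rule ccontr)
    assume no: "\<not> ?thesis"
    have nb: "is_nbhd ES \<mu> (basic_nbhd \<Omega> K \<mu> (n0 + n))" if "\<mu> \<in> end_carrier \<Omega> K" for \<mu>
      unfolding is_nbhd_def using openin_basic_nbhd[OF that] in_basic_nbhd[OF that] openin_subset by blast
    have cp: "compact (f ` cball 0 (1 - 1 / (real n + 2)))" "f ` cball 0 (1 - 1 / (real n + 2)) \<subseteq> \<Omega>"
      using compact_subdisc_image[of "1 - 1 / (real n + 2)"] by auto
    have "\<forall>T\<ge>0. \<forall>\<sigma>. almost_geodesic \<Omega> L \<kappa> {0..T} \<sigma> \<and> Pt (\<sigma> 0) \<in> basic_nbhd \<Omega> K \<zeta> (n0 + n) \<and>
        Pt (\<sigma> T) \<in> basic_nbhd \<Omega> K \<eta> (n0 + n) \<longrightarrow> \<sigma> ` {0..T} \<inter> f ` cball 0 (1 - 1 / (real n + 2)) \<noteq> {}"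
      using no by blast
    then have "visible_pair \<Omega> K L \<kappa> \<zeta> \<eta>"
      unfolding visible_pair_def using nb[OF c(1)] nb[OF c(2)] n0[OF le_add1] cp by blast
    with nv show False by blast
  qed
  then obtain T \<sigma> where T: "\<And>n. 0 \<le> T n" and \<sigma>: "\<And>n. almost_geodesic \<Omega> L \<kappa> {0..T n} (\<sigma> n)"
    and x: "\<And>n. Pt (\<sigma> n 0) \<in> basic_nbhd \<Omega> K \<zeta> (n0 + n)" and y: "\<And>n. Pt (\<sigma> n (T n)) \<in> basic_nbhd \<Omega> K \<eta> (n0 + n)"
    and esc: "\<And>n. \<sigma> n ` {0..T n} \<inter> f ` cball 0 (1 - 1 / (real n + 2)) = {}"
    by metis
  obtain p s where s: "strict_mono (s :: nat \<Rightarrow> nat)"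
    and lim: "\<And>e. e > 0 \<Longrightarrow> \<forall>\<^sub>F n in sequentially. \<forall>t\<in>{0..T (s n)}. dist (1 / (\<sigma> (s n) t - f 0)) p < e"
    using escaping_almost_geodesics_converge[OF sc lcf \<open>L \<ge> 1\<close> \<sigma> T esc] by blast
  define u v where "u n = \<sigma> (s n) 0" and "v n = \<sigma> (s n) (T (s n))" for n
  have sn: "n \<le> n0 + s n" for n using seq_suble[OF s, of n] by simp
  have u: "Pt (u n) \<in> basic_nbhd \<Omega> K \<zeta> n" and v: "Pt (v n) \<in> basic_nbhd \<Omega> K \<eta> n" for n
    unfolding u_def v_def using x y basic_nbhd_antimono[OF c(1) sn] basic_nbhd_antimono[OF c(2) sn] by blast+
  have limu: "(\<lambda>n. 1 / (u n - f 0)) \<longlonglongrightarrow> p" and limv: "(\<lambda>n. 1 / (v n - f 0)) \<longlonglongrightarrow> p"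
  proof -
    have "\<forall>\<^sub>F n in sequentially. dist (1 / (u n - f 0)) p < e \<and> dist (1 / (v n - f 0)) p < e" if "e > 0" for e
      using lim[OF that] by (rule eventually_mono) (use T in \<open>simp add: u_def v_def\<close>)
    then show "(\<lambda>n. 1 / (u n - f 0)) \<longlonglongrightarrow> p" "(\<lambda>n. 1 / (v n - f 0)) \<longlonglongrightarrow> p"
      by (simp_all add: tendsto_iff eventually_conj_iff)
  qed
  show False
  proof (cases "p = 0")
    case False
    have "(\<lambda>n. f 0 + 1 / (1 / (u n - f 0))) \<longlonglongrightarrow> f 0 + 1 / p" "(\<lambda>n. f 0 + 1 / (1 / (v n - f 0))) \<longlonglongrightarrow> f 0 + 1 / p"
      by (intro tendsto_intros limu limv False)+
    then have "u \<longlonglongrightarrow> f 0 + 1 / p" "v \<longlonglongrightarrow> f 0 + 1 / p" by simp_all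
    then have "\<zeta> = Pt (f 0 + 1 / p)" "\<eta> = Pt (f 0 + 1 / p)"
      using basic_nbhd_converges[OF c(1) u] basic_nbhd_converges[OF c(2) v] by blast+
    with \<open>\<zeta> \<noteq> \<eta>\<close> show False by simp
  next
    case True
    \<comment> \<open>Uniformity in \<open>t\<close> matters: the ends of a curve can be compared
      only if all of the curve stays outside \<open>K \<nu>\<close>.\<close>
    have far: "\<forall>\<^sub>F n in sequentially. \<forall>t\<in>{0..T (s n)}. R < cmod (\<sigma> (s n) t)" for R
    proof -
      define M where "M = \<bar>R\<bar> + cmod (f 0) + 1"
      have M: "M > 0" by (simp add: M_def add_nonneg_pos)
      have "\<forall>\<^sub>F n in sequentially. \<forall>t\<in>{0..T (s n)}. dist (1 / (\<sigma> (s n) t - f 0)) p < 1 / M" using lim[of "1 / M"] M by simp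
      then show ?thesis
      proof eventually_elim
        case (elim n)
        show ?case
        proof
          fix t assume t: "t \<in> {0..T (s n)}"
          \<comment> \<open>At \<open>f 0\<close> the default \<open>1 / 0 = 0\<close> would pass
            for closeness to infinity; the excluded compact set contains \<open>f 0\<close>.\<close>
          have "\<sigma> (s n) t \<noteq> f 0"
          proof
            assume "\<sigma> (s n) t = f 0"
            moreover have "f 0 \<in> f ` cball 0 (1 - 1 / (real (s n) + 2))" by auto
            ultimately show False using esc[of "s n"] t by (metis IntI empty_iff image_eqI)
          qed
          moreover have "cmod (1 / (\<sigma> (s n) t - f 0)) < 1 / M" using elim t True by simp
          ultimately have "M < cmod (\<sigma> (s n) t - f 0)" using M by (simp add: norm_divide field_simps)
          then show "R < cmod (\<sigma> (s n) t)" using norm_triangle_ineq4[of "\<sigma> (s n) t" "f 0"] by (simp add: M_def)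
        qed
      qed
    qed
    have uv: "\<exists>n. R < cmod (u n)" "\<exists>n. R < cmod (v n)" for R
    proof -
      obtain n where "\<forall>t\<in>{0..T (s n)}. R < cmod (\<sigma> (s n) t)"
        using eventually_happens'[OF sequentially_bot far[of R]] by blast
      then have "R < cmod (u n)" "R < cmod (v n)" using T[of "s n"] by (simp_all add: u_def v_def)
      then show "\<exists>n. R < cmod (u n)" "\<exists>n. R < cmod (v n)" by blast+
    qed
    obtain F G where F: "\<zeta> = End F" "F \<in> ends (closure \<Omega>) K" "\<And>n. u n \<in> F n"
      and G: "\<eta> = End G" "G \<in> ends (closure \<Omega>) K" "\<And>n. v n \<in> G n"
      using basic_nbhd_escaping[OF c(1) u uv(1)] basic_nbhd_escaping[OF c(2) v uv(2)] by metis
    obtain \<nu> where \<nu>: "F \<nu> \<noteq> G \<nu>" using F(1) G(1) \<open>\<zeta> \<noteq> \<eta>\<close> by (metis ext)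
    obtain R where R: "K \<nu> \<subseteq> cball 0 R" using compact_imp_bounded[OF compact_K[of \<nu>]] unfolding bounded_iff by (auto simp: subset_eq)
    obtain n where n: "\<nu> \<le> n" "\<forall>t\<in>{0..T (s n)}. R < cmod (\<sigma> (s n) t)"
      using eventually_happens'[OF sequentially_bot eventually_conj[OF eventually_ge_at_top[of \<nu>] far[of R]]] by blast
    define P where "P = \<sigma> (s n) ` {0..T (s n)}"
    have "connected P"
      unfolding P_def using \<sigma>[of "s n"] abs_continuous_on_imp_continuous_on
      by (intro connected_continuous_image) (auto simp: almost_geodesic_def)
    moreover have "P \<subseteq> closure \<Omega> - K \<nu>"
    proof
      fix w assume "w \<in> P"
      then obtain t where t: "t \<in> {0..T (s n)}" "w = \<sigma> (s n) t" by (auto simp: P_def)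
      then have "w \<in> \<Omega>" using \<sigma>[of "s n"] by (auto simp: almost_geodesic_def)
      moreover have "R < cmod w" using n(2) t by blast
      then have "w \<notin> K \<nu>" using R by auto
      ultimately show "w \<in> closure \<Omega> - K \<nu>" using closure_subset by blast
    qed
    moreover have "u n \<in> P" "v n \<in> P" using T[of "s n"] by (auto simp: P_def u_def v_def)
    moreover have "u n \<in> F \<nu>" "v n \<in> G \<nu>"
      using F(3) G(3) end_antimono[OF F(2) n(1)] end_antimono[OF G(2) n(1)] by blast+
    ultimately have "P \<subseteq> F \<nu>" "P \<subseteq> G \<nu>"
      using components_maximal[OF end_component[OF F(2)]] components_maximal[OF end_component[OF G(2)]] by blast+
    then show False using end_unique[OF F(2) G(2) \<nu>] \<open>u n \<in> P\<close> by blast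
  qed
qed

end


subsection \<open>Visibility implies locally connected boundary\<close>

lemma tanh_artanh:
  fixes x :: real
  assumes "0 \<le> x" "x < 1"
  shows "tanh (artanh x) = x"
proof -
  have "exp (- 2 * artanh x) = inverse (exp (ln ((1 + x) / (1 - x))))"
    unfolding exp_minus[symmetric] by (simp add: artanh_def)
  also have "\<dots> = (1 - x) / (1 + x)" using assms by (subst exp_ln) auto
  finally have q: "exp (- 2 * artanh x) = (1 - x) / (1 + x)" .
  have "1 - (1 - x) / (1 + x) = 2 * x / (1 + x)" "1 + (1 - x) / (1 + x) = 2 / (1 + x)"
    using assms by (simp_all add: field_simps)
  then show ?thesis unfolding tanh_real_altdef q using assms by simp
qed

lemma tanh_diff_real:
  fixes s t :: real
  shows "(tanh s - tanh t) / (1 - tanh s * tanh t) = tanh (s - t)"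
  using tanh_add[of s "- t"] cosh_real_pos[of s] cosh_real_pos[of t] by simp

text \<open>The geodesic from \<open>0\<close> to the Moebius image of \<open>w\<close>, a radius
  parametrised by \<open>tanh\<close> at unit hyperbolic speed, is moved back to start at
  \<open>z\<close>. It is defined for all real times, so derivatives at \<open>0\<close> and
  \<open>T\<close> are two-sided.\<close>

lemma disc_geodesic:
  assumes z: "cmod z < 1" and w: "cmod w < 1"
  obtains T \<tau> where "T \<ge> 0" "\<tau> 0 = z" "\<tau> T = w" "\<And>t. cmod (\<tau> t) < 1"
    "\<And>s t. poincare_dist (\<tau> s) (\<tau> t) = \<bar>s - t\<bar>" "abs_continuous_on {0..T} \<tau>"
    "\<And>t. \<exists>v. (\<tau> has_vector_derivative v) (at t) \<and> cmod v = 1 - (cmod (\<tau> t))\<^sup>2"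
proof -
  define m where "m = Moebius_function 0 z w"
  have m: "cmod m < 1" unfolding m_def by (rule Moebius_function_norm_lt_1[OF z w])
  \<comment> \<open>For \<open>z = w\<close> any unit direction will do, whereas
    \<open>sgn 0\<close> is \<open>0\<close>.\<close>
  define e where "e = (if m = 0 then 1 else sgn m)"
  have e: "cmod e = 1" by (simp add: e_def norm_sgn)
  have me: "m = e * of_real (cmod m)" by (simp add: e_def sgn_eq)
  define T where "T = artanh (cmod m)"
  define x where "x t = e * of_real (tanh t)" for t :: real
  define \<tau> where "\<tau> t = Moebius_function 0 (- z) (x t)" for t
  have z': "cmod (- z) < 1" using z by simp
  have nx: "cmod (x t) = \<bar>tanh t\<bar>" for t by (simp add: x_def norm_mult e)
  have x1: "cmod (x t) < 1" for t
    unfolding nx using tanh_real_lt_1[of t] tanh_real_gt_neg1[of t] by (simp add: abs_less_iff)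
  have xdist: "dist (x s) (x t) = \<bar>tanh s - tanh t\<bar>" for s t
  proof -
    have "x s - x t = e * of_real (tanh s - tanh t)" by (simp add: x_def algebra_simps)
    then show ?thesis unfolding dist_norm by (simp only: norm_mult e norm_of_real) simp
  qed
  have xd: "poincare_dist (x s) (x t) = \<bar>s - t\<bar>" for s t
  proof -
    have "cnj e * e = 1" using complex_norm_square[of e] e by (simp add: mult.commute)
    have "cnj (x t) * x s = (cnj e * e) * of_real (tanh t * tanh s)" by (simp add: x_def)
    also have "\<dots> = of_real (tanh t * tanh s)" using \<open>cnj e * e = 1\<close> by simp
    finally have c: "1 - cnj (x t) * x s = of_real (1 - tanh t * tanh s)" by simp
    have "cmod ((x s - x t) / (1 - cnj (x t) * x s)) = \<bar>(tanh s - tanh t) / (1 - tanh s * tanh t)\<bar>"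
      unfolding c norm_divide norm_of_real using xdist[of s t] by (simp add: dist_norm mult.commute)
    also have "\<dots> = tanh \<bar>s - t\<bar>" unfolding tanh_diff_real by (simp add: tanh_real_abs)
    finally have A: "cmod ((x s - x t) / (1 - cnj (x t) * x s)) = tanh \<bar>s - t\<bar>" .
    show ?thesis unfolding poincare_dist_def A by (rule artanh_tanh_real)
  qed
  have tanh': "(tanh has_real_derivative 1 - (tanh t)\<^sup>2) (at t)" for t :: real
    using cosh_real_pos[of t] by (auto intro!: derivative_eq_intros)
  have x': "(x has_vector_derivative e * of_real (1 - (tanh t)\<^sup>2)) (at t)" for t
  proof -
    have "((\<lambda>t. complex_of_real (tanh t)) has_vector_derivative of_real (1 - (tanh t)\<^sup>2)) (at t)"
      by (intro has_vector_derivative_of_real) (simp add: tanh' flip: has_real_derivative_iff_has_vector_derivative)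
    then show ?thesis unfolding x_def by (rule has_vector_derivative_mult_right)
  qed
  have "abs_continuous_on {0..T} x"
  proof (rule abs_continuous_on_lipschitz[where B = 1])
    fix s t :: real
    have "norm (tanh s - tanh t) \<le> 1 * norm (s - t)"
    proof (rule field_differentiable_bound[of UNIV tanh "\<lambda>u. 1 - (tanh u)\<^sup>2"])
      show "(tanh has_real_derivative 1 - (tanh u)\<^sup>2) (at u within UNIV)" for u by (rule tanh')
      show "norm (1 - (tanh u)\<^sup>2) \<le> 1" for u :: real
      proof -
        have "(tanh u)\<^sup>2 < 1" using x1[of u] unfolding nx by (simp add: abs_square_less_1)
        moreover have "0 \<le> (tanh u)\<^sup>2" by simp
        ultimately show ?thesis unfolding real_norm_def abs_le_iff by linarith
      qed
    qed auto
    then show "dist (x s) (x t) \<le> 1 * dist s t" using xdist[of s t] by (simp add: dist_real_def)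
  qed simp
  moreover have "x ` {0..T} \<subseteq> ball 0 1" using x1 by auto
  ultimately have ac: "abs_continuous_on {0..T} \<tau>"
    unfolding \<tau>_def
    by (rule abs_continuous_on_holomorphic_image[OF _ _ open_ball Moebius_function_holomorphic[OF z']])
  have \<tau>': "\<exists>v. (\<tau> has_vector_derivative v) (at t) \<and> cmod v = 1 - (cmod (\<tau> t))\<^sup>2" for t
  proof -
    define D where "D = (1 - cnj (- z) * (- z)) / (1 - cnj (- z) * x t)\<^sup>2"
    have "(Moebius_function 0 (- z) has_field_derivative D) (at (x t))"
      unfolding D_def by (rule Moebius_function_has_field_derivative[OF z' x1])
    then have "((Moebius_function 0 (- z) \<circ> x) has_vector_derivative e * of_real (1 - (tanh t)\<^sup>2) * D) (at t)"
      by (rule field_vector_diff_chain_at[OF x'])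
    moreover have "cmod (e * of_real (1 - (tanh t)\<^sup>2) * D) = 1 - (cmod (\<tau> t))\<^sup>2"
    proof -
      have "1 - cnj (- z) * (- z) = of_real (1 - (cmod (- z))\<^sup>2)"
        using complex_norm_square[of z] by (simp add: mult.commute)
      then have "cmod D = (1 - (cmod (- z))\<^sup>2) / (cmod (1 - cnj (- z) * x t))\<^sup>2"
        unfolding D_def norm_divide norm_power using z by (simp only: norm_of_real) (simp add: abs_square_le_1)
      moreover have "cmod (complex_of_real (1 - (tanh t)\<^sup>2)) = 1 - (cmod (x t))\<^sup>2"
        unfolding norm_of_real nx using x1[of t, unfolded nx] by (simp add: abs_square_le_1)
      ultimately show ?thesis
        unfolding \<tau>_def Moebius_function_norm_sq[OF z' x1] norm_mult e by simp
    qed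
    moreover have "Moebius_function 0 (- z) \<circ> x = \<tau>" by (simp add: \<tau>_def fun_eq_iff)
    ultimately show ?thesis by metis
  qed
  show thesis
  proof (rule that[OF _ _ _ _ _ ac \<tau>'])
    show "T \<ge> 0" unfolding T_def using m by (intro artanh_nonneg) auto
    show "\<tau> 0 = z" by (simp add: \<tau>_def x_def Moebius_function_of_zero)
    have "x T = m" unfolding x_def T_def using m by (subst tanh_artanh) (auto simp flip: me)
    then show "\<tau> T = w" unfolding \<tau>_def m_def using Moebius_function_compose[of z "- z"] 
      Moebius_function_compose[OF _ _ w, of "- z" z] z by simp
    show "cmod (\<tau> t) < 1" for t unfolding \<tau>_def by (rule Moebius_function_norm_lt_1[OF z' x1])
    show "poincare_dist (\<tau> s) (\<tau> t) = \<bar>s - t\<bar>" for s t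
      unfolding \<tau>_def poincare_dist_Moebius_image[OF z' x1 x1] by (rule xd)
  qed
qed

text \<open>The Gromov product of \<open>z\<close> and \<open>w\<close> at \<open>0\<close> bounds the distance of a geodesic from \<open>0\<close>.\<close>

lemma geodesic_point_near_boundary:
  assumes z: "cmod z < 1" and w: "cmod w < 1" and m: "cmod m < 1"
    and geo: "poincare_dist z m + poincare_dist m w = poincare_dist z w"
  shows "1 - cmod m \<le> 4 * cmod (1 - cnj w * z)"
proof -
  \<comment> \<open>The product equals \<open>(1 + cmod u)\<^sup>2\<close>. Applied to
    \<open>z\<close> and \<open>w\<close>, it absorbs the factors
    \<open>1 - (cmod z)\<^sup>2\<close> and \<open>1 - (cmod w)\<^sup>2\<close> of the cross
    estimate.\<close>
  have ge: "1 \<le> exp (2 * poincare_dist u 0) * (1 - (cmod u)\<^sup>2)" if u: "cmod u < 1" for u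
  proof -
    have "exp (2 * poincare_dist u 0) = (1 + cmod u) / (1 - cmod u)"
      using u by (simp add: poincare_dist_0 artanh_def add_pos_nonneg)
    moreover have "1 - (cmod u)\<^sup>2 = (1 - cmod u) * (1 + cmod u)" by (simp add: power2_eq_square algebra_simps)
    ultimately have "exp (2 * poincare_dist u 0) * (1 - (cmod u)\<^sup>2) = (1 + cmod u)\<^sup>2"
      using u by (simp add: power2_eq_square)
    then show ?thesis by (simp add: one_le_power)
  qed
  have d: "1 - (cmod z)\<^sup>2 > 0" "1 - (cmod w)\<^sup>2 > 0" using z w by (simp_all add: abs_square_less_1)
  let ?E = "exp (- (4 * poincare_dist m 0))"
  have "poincare_dist z 0 \<le> poincare_dist z m + poincare_dist m 0"
    "poincare_dist w 0 \<le> poincare_dist m w + poincare_dist m 0"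
    using poincare_dist_triangle[OF z m, of 0] poincare_dist_triangle[OF w m, of 0] poincare_dist_commute[OF m w] by auto
  then have "2 * poincare_dist z 0 + 2 * poincare_dist w 0 + - (4 * poincare_dist m 0) \<le> 2 * poincare_dist z w"
    using geo by linarith
  then have "exp (2 * poincare_dist z 0) * exp (2 * poincare_dist w 0) * ?E \<le> exp (2 * poincare_dist z w)"
    unfolding exp_add[symmetric] by simp
  then have "exp (2 * poincare_dist z 0) * exp (2 * poincare_dist w 0) * ?E * ((1 - (cmod z)\<^sup>2) * (1 - (cmod w)\<^sup>2))
      \<le> exp (2 * poincare_dist z w) * ((1 - (cmod z)\<^sup>2) * (1 - (cmod w)\<^sup>2))"
    using d by (intro mult_right_mono) auto
  also have "\<dots> \<le> 4 * (cmod (1 - cnj w * z))\<^sup>2" by (rule exp_poincare_dist_le_cross[OF z w])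
  finally have "(exp (2 * poincare_dist z 0) * (1 - (cmod z)\<^sup>2)) * (exp (2 * poincare_dist w 0) * (1 - (cmod w)\<^sup>2)) * ?E
      \<le> 4 * (cmod (1 - cnj w * z))\<^sup>2" by (simp only: mult_ac)
  moreover have "1 * 1 * ?E \<le> (exp (2 * poincare_dist z 0) * (1 - (cmod z)\<^sup>2)) * (exp (2 * poincare_dist w 0) * (1 - (cmod w)\<^sup>2)) * ?E"
    using ge[OF z] ge[OF w] by (intro mult_right_mono mult_mono) auto
  ultimately have E: "?E \<le> 4 * (cmod (1 - cnj w * z))\<^sup>2" by linarith
  have "exp (2 * poincare_dist m 0) = (1 + cmod m) / (1 - cmod m)"
    using m by (simp add: poincare_dist_0 artanh_def add_pos_nonneg)
  then have "inverse (exp (2 * poincare_dist m 0)) = (1 - cmod m) / (1 + cmod m)" by simp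
  also have "\<dots> \<ge> (1 - cmod m) / 2" using m by (intro divide_left_mono) (auto simp: add_pos_nonneg)
  finally have "((1 - cmod m) / 2)\<^sup>2 \<le> (inverse (exp (2 * poincare_dist m 0)))\<^sup>2" using m by (intro power_mono) auto
  also have "\<dots> = ?E"
  proof -
    have "?E = exp (2 * (- (2 * poincare_dist m 0)))" by simp
    then show ?thesis unfolding exp_double exp_minus by simp
  qed
  finally have "((1 - cmod m) / 2)\<^sup>2 \<le> (2 * cmod (1 - cnj w * z))\<^sup>2" using E by (simp add: power_mult_distrib)
  then have "(1 - cmod m) / 2 \<le> 2 * cmod (1 - cnj w * z)" by (rule power2_le_imp_le) simp
  then show ?thesis by simp
qed


section \<open>Boundary limits under visibility\<close>

context riemann_map
begin

text \<open>Hyperbolic geodesics are almost-geodesics with multiplicative constant \<open>1\<close>.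
  The last conclusion makes them escape when \<open>z\<close> and \<open>w\<close> tend to the same
  point of the circle.\<close>

lemma almost_geodesic_exists:
  assumes z: "cmod z < 1" and w: "cmod w < 1" and "\<kappa> \<ge> 0"
  obtains T \<tau> where "T \<ge> 0" "\<tau> 0 = z" "\<tau> T = w" "almost_geodesic \<Omega> 1 \<kappa> {0..T} (\<lambda>t. f (\<tau> t))"
    "\<And>t. cmod (\<tau> t) < 1" "\<And>t. t \<in> {0..T} \<Longrightarrow> 1 - cmod (\<tau> t) \<le> 4 * cmod (1 - cnj w * z)"
proof -
  obtain T \<tau> where T: "T \<ge> 0" "\<tau> 0 = z" "\<tau> T = w" and \<tau>1: "\<And>t. cmod (\<tau> t) < 1"
    and d: "\<And>s t. poincare_dist (\<tau> s) (\<tau> t) = \<bar>s - t\<bar>" and ac: "abs_continuous_on {0..T} \<tau>"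
    and v: "\<And>t. \<exists>v. (\<tau> has_vector_derivative v) (at t) \<and> cmod v = 1 - (cmod (\<tau> t))\<^sup>2"
    using disc_geodesic[OF z w] by blast
  have kd: "kobayashi_dist \<Omega> (f (\<tau> s)) (f (\<tau> t)) = \<bar>s - t\<bar>" for s t
    using kobayashi_dist_eq[OF f_in f_in] \<tau>1 d by (simp add: h_f)
  have vd: "\<exists>u. ((\<lambda>t. f (\<tau> t)) has_vector_derivative u) (at t) \<and> kobayashi_metric \<Omega> (f (\<tau> t)) u \<le> 1" for t
  proof -
    obtain v where v: "(\<tau> has_vector_derivative v) (at t)" "cmod v = 1 - (cmod (\<tau> t))\<^sup>2" using v by blast
    have q: "1 - (cmod (\<tau> t))\<^sup>2 > 0" using \<tau>1 by (simp add: abs_square_less_1)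
    have "(f has_field_derivative deriv f (\<tau> t)) (at (\<tau> t))"
      using \<tau>1 by (intro holomorphic_derivI[OF hol_f]) auto
    then have "((f \<circ> \<tau>) has_vector_derivative v * deriv f (\<tau> t)) (at t)"
      by (rule field_vector_diff_chain_at[OF v(1)])
    moreover have "v \<noteq> 0" using v(2) q by auto
    then have "kobayashi_metric \<Omega> (f (\<tau> t)) (deriv f (\<tau> t) * v) \<le> cmod v / (1 - (cmod (\<tau> t))\<^sup>2)"
      using \<tau>1 by (intro kobayashi_metric_le)
    then have "kobayashi_metric \<Omega> (f (\<tau> t)) (v * deriv f (\<tau> t)) \<le> 1" using v(2) q by (simp add: mult.commute)
    ultimately show ?thesis by (auto simp: o_def)
  qed
  have "almost_geodesic \<Omega> 1 \<kappa> {0..T} (\<lambda>t. f (\<tau> t))"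
    unfolding almost_geodesic_def
  proof (intro conjI ballI)
    show "(\<lambda>t. f (\<tau> t)) ` {0..T} \<subseteq> \<Omega>" using f_in \<tau>1 by auto
    show "abs_continuous_on {0..T} (\<lambda>t. f (\<tau> t))"
      using \<tau>1 hol_f by (intro abs_continuous_on_holomorphic_image[OF ac, where \<Omega> = "ball 0 1"]) auto
    show "AE t in lebesgue_on {0..T}. \<exists>v. ((\<lambda>t. f (\<tau> t)) has_vector_derivative v) (at t within {0..T}) \<and>
        kobayashi_metric \<Omega> (f (\<tau> t)) v \<le> 1"
      using vd has_vector_derivative_at_within by (intro AE_I2) blast
  qed (use kd \<open>\<kappa> \<ge> 0\<close> in auto)
  moreover have "1 - cmod (\<tau> t) \<le> 4 * cmod (1 - cnj w * z)" if "t \<in> {0..T}" for t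
  proof (rule geodesic_point_near_boundary[OF z w \<tau>1])
    show "poincare_dist z (\<tau> t) + poincare_dist (\<tau> t) w = poincare_dist z w"
      using d[of 0 t] d[of t T] d[of 0 T] T that by simp
  qed
  ultimately show thesis using that T \<tau>1 by blast
qed

lemma is_nbhd_Pt_tendsto:
  assumes "is_nbhd (end_topology \<Omega> K) (Pt \<zeta>) V" "x \<longlonglongrightarrow> \<zeta>" "\<And>n. x n \<in> \<Omega>"
  shows "\<forall>\<^sub>F n in sequentially. Pt (x n) \<in> V"
proof -
  obtain U where U: "end_open \<Omega> K U" "Pt \<zeta> \<in> U" "U \<subseteq> V"
    using assms(1) unfolding is_nbhd_def openin_end_topology by blast
  then obtain r where r: "r > 0" "Pt ` (ball \<zeta> r \<inter> closure \<Omega>) \<subseteq> U" unfolding end_open_def by blast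
  have "\<forall>\<^sub>F n in sequentially. dist (x n) \<zeta> < r" by (rule tendstoD[OF assms(2) r(1)])
  then show ?thesis
  proof eventually_elim
    case (elim n)
    then have "x n \<in> ball \<zeta> r \<inter> closure \<Omega>" using assms(3)[of n] closure_subset[of \<Omega>] by (auto simp: dist_commute)
    then show ?case using r(2) U(3) by blast
  qed
qed

text \<open>Hyperbolic geodesics joining points that converge to the same \<open>\<xi>\<close> escape every compact set,
  which visibility forbids if the image points converge to different boundary points.\<close>

lemma visible_cluster_unique:
  assumes vis: "\<And>\<zeta> \<eta>. \<zeta> \<in> end_boundary \<Omega> K \<Longrightarrow> \<eta> \<in> end_boundary \<Omega> K \<Longrightarrow> \<zeta> \<noteq> \<eta> \<Longrightarrow> visible_pair \<Omega> K 1 1 \<zeta> \<eta>"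
    and \<xi>: "cmod \<xi> = 1"
    and z: "\<And>n. cmod (z n) < 1" "\<And>n. z n \<noteq> 0" "z \<longlonglongrightarrow> \<xi>" "(\<lambda>n. inv_f (z n)) \<longlonglongrightarrow> p" "p \<noteq> 0"
    and w: "\<And>n. cmod (w n) < 1" "\<And>n. w n \<noteq> 0" "w \<longlonglongrightarrow> \<xi>" "(\<lambda>n. inv_f (w n)) \<longlonglongrightarrow> q" "q \<noteq> 0"
  shows "p = q"
proof (rule ccontr)
  assume "p \<noteq> q"
  have bd: "Pt (f 0 + 1 / u) \<in> end_boundary \<Omega> K" "(\<lambda>n. f (x n)) \<longlonglongrightarrow> f 0 + 1 / u"
    if x: "\<And>n. cmod (x n) < 1" "\<And>n. x n \<noteq> 0" "x \<longlonglongrightarrow> \<xi>" "(\<lambda>n. inv_f (x n)) \<longlonglongrightarrow> u" "u \<noteq> 0" for x u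
  proof -
    have "(\<lambda>n. cmod (x n)) \<longlonglongrightarrow> 1" using tendsto_norm[OF x(3)] \<xi> by simp
    then have "u \<in> frontier inv_dom" using inv_f_escape x(1,2,4) by blast
    then have "f 0 + 1 / u \<in> frontier \<Omega>" using frontier_inverted_iff[OF open_domain x(5)] by blast
    then show "Pt (f 0 + 1 / u) \<in> end_boundary \<Omega> K"
      using open_domain by (auto simp: end_boundary_def end_carrier_def frontier_def interior_open)
    have "(\<lambda>n. f 0 + 1 / inv_f (x n)) \<longlonglongrightarrow> f 0 + 1 / u" by (intro tendsto_intros x(4,5))
    then show "(\<lambda>n. f (x n)) \<longlonglongrightarrow> f 0 + 1 / u" by (simp add: inv_f_def)
  qed
  have "1 / p \<noteq> 1 / q" using \<open>p \<noteq> q\<close> z(5) w(5) by (simp add: field_simps)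
  then have "visible_pair \<Omega> K 1 1 (Pt (f 0 + 1 / p)) (Pt (f 0 + 1 / q))"
    using bd(1)[OF z] bd(1)[OF w] by (intro vis) auto
  then obtain V W C where V: "is_nbhd (end_topology \<Omega> K) (Pt (f 0 + 1 / p)) V"
    and W: "is_nbhd (end_topology \<Omega> K) (Pt (f 0 + 1 / q)) W" and C: "compact C" "C \<subseteq> \<Omega>"
    and hit: "\<And>T \<sigma>. T \<ge> 0 \<Longrightarrow> almost_geodesic \<Omega> 1 1 {0..T} \<sigma> \<Longrightarrow> Pt (\<sigma> 0) \<in> V \<Longrightarrow> Pt (\<sigma> T) \<in> W \<Longrightarrow> \<sigma> ` {0..T} \<inter> C \<noteq> {}"
    unfolding visible_pair_def by metis
  have "\<exists>r<1. \<forall>c\<in>C. cmod (h c) \<le> r"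
  proof (cases "C = {}")
    case False
    have "continuous_on C (\<lambda>c. cmod (h c))"
      by (intro continuous_on_norm continuous_on_subset[OF holomorphic_on_imp_continuous_on[OF hol_h] C(2)])
    then obtain c0 where "c0 \<in> C" "\<forall>c\<in>C. cmod (h c) \<le> cmod (h c0)"
      using continuous_attains_sup[OF C(1) False] by blast
    then show ?thesis using h_in C(2) by blast
  qed (auto intro: exI[of _ 0])
  then obtain r where r: "r < 1" "\<And>c. c \<in> C \<Longrightarrow> cmod (h c) \<le> r" by blast
  \<comment> \<open>The common limit \<open>\<xi>\<close> has modulus \<open>1\<close>, so the bound
    on the distance of the geodesics from the circle tends to \<open>0\<close>.\<close>
  have "(\<lambda>n. 4 * cmod (1 - cnj (w n) * z n)) \<longlonglongrightarrow> 4 * cmod (1 - cnj \<xi> * \<xi>)"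
    by (intro tendsto_intros z(3) w(3))
  moreover have "1 - cnj \<xi> * \<xi> = 0" using complex_norm_square[of \<xi>] \<xi> by (simp add: mult.commute)
  ultimately have "\<forall>\<^sub>F n in sequentially. 4 * cmod (1 - cnj (w n) * z n) < 1 - r"
    using r(1) by (intro order_tendstoD(2)[of _ 0]) auto
  moreover have "\<forall>\<^sub>F n in sequentially. Pt (f (z n)) \<in> V"
    by (rule is_nbhd_Pt_tendsto[OF V bd(2)[OF z]]) (rule f_in[OF z(1)])
  moreover have "\<forall>\<^sub>F n in sequentially. Pt (f (w n)) \<in> W"
    by (rule is_nbhd_Pt_tendsto[OF W bd(2)[OF w]]) (rule f_in[OF w(1)])
  ultimately have "\<forall>\<^sub>F n in sequentially. 4 * cmod (1 - cnj (w n) * z n) < 1 - r \<and> Pt (f (z n)) \<in> V \<and> Pt (f (w n)) \<in> W"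
    by (simp add: eventually_conj_iff)
  then obtain n where n: "4 * cmod (1 - cnj (w n) * z n) < 1 - r" "Pt (f (z n)) \<in> V" "Pt (f (w n)) \<in> W"
    using eventually_happens'[OF sequentially_bot] by blast
  obtain T \<tau> where \<tau>: "T \<ge> 0" "\<tau> 0 = z n" "\<tau> T = w n" "almost_geodesic \<Omega> 1 1 {0..T} (\<lambda>t. f (\<tau> t))"
    "\<And>t. cmod (\<tau> t) < 1" "\<And>t. t \<in> {0..T} \<Longrightarrow> 1 - cmod (\<tau> t) \<le> 4 * cmod (1 - cnj (w n) * z n)"
    using almost_geodesic_exists[OF z(1)[of n] w(1)[of n], of 1] by auto
  have "(\<lambda>t. f (\<tau> t)) ` {0..T} \<inter> C \<noteq> {}" using n(2,3) \<tau>(2,3) by (intro hit[OF \<tau>(1,4)]) auto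
  then obtain t where t: "t \<in> {0..T}" "f (\<tau> t) \<in> C" by blast
  then have "cmod (\<tau> t) \<le> r" using r(2)[OF t(2)] h_f[OF \<tau>(5)] by simp
  then show False using \<tau>(6)[OF t(1)] n(1) by linarith
qed

text \<open>The cluster set at \<open>\<xi>\<close> is a nested intersection of continua, hence a
  continuum. It has at most one element other than \<open>0\<close>, and a finite nonempty connected
  set is a single point.\<close>

lemma visible_boundary_limit:
  assumes vis: "\<And>\<zeta> \<eta>. \<zeta> \<in> end_boundary \<Omega> K \<Longrightarrow> \<eta> \<in> end_boundary \<Omega> K \<Longrightarrow> \<zeta> \<noteq> \<eta> \<Longrightarrow> visible_pair \<Omega> K 1 1 \<zeta> \<eta>"
    and \<xi>: "cmod \<xi> = 1"
  shows "\<exists>p. (inv_f \<longlongrightarrow> p) (at \<xi> within ball 0 1)"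
proof -
  \<comment> \<open>Radius at most \<open>1/2\<close> keeps the pole of \<open>inv_f\<close> away;
    convexity makes the neighbourhoods connected.\<close>
  define N where "N n = ball 0 1 \<inter> ball \<xi> (1 / real (n + 2))" for n
  obtain B where B: "B > 0" "\<And>z. 1/2 \<le> cmod z \<Longrightarrow> cmod z < 1 \<Longrightarrow> cmod (inv_f z) \<le> B"
    by (rule inv_f_bounded[of "1/2"]) auto
  have N: "1/2 \<le> cmod z" "cmod z < 1" "dist z \<xi> < 1 / real (n + 2)" if "z \<in> N n" for z n
  proof -
    show "cmod z < 1" and d: "dist z \<xi> < 1 / real (n + 2)" using that by (auto simp: N_def dist_commute)
    have "1 / real (n + 2) \<le> 1 / 2" by simp
    then have "dist z \<xi> < 1/2" using d by linarith
    then have "cmod (\<xi> - z) < 1/2" by (simp add: dist_norm norm_minus_commute)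
    then show "1/2 \<le> cmod z" using norm_triangle_ineq2[of \<xi> z] \<xi> by simp
  qed
  define CL where "CL n = closure (inv_f ` N n)" for n
  have CLB: "CL n \<subseteq> cball 0 B" for n
    unfolding CL_def using B N by (intro closure_minimal) auto
  have cCL: "compact (CL n)" for n
    using bounded_subset[OF bounded_cball CLB] by (simp add: compact_eq_bounded_closed CL_def)
  have conCL: "connected (CL n)" for n
  proof -
    have "connected (N n)" unfolding N_def by (intro convex_connected convex_Int convex_ball)
    moreover have "N n \<subseteq> ball 0 1 - {0}"
    proof
      fix x assume "x \<in> N n"
      from N(1,2)[OF this] show "x \<in> ball 0 1 - {0}" by auto
    qed
    then have "continuous_on (N n) inv_f"
      by (rule continuous_on_subset[OF holomorphic_on_imp_continuous_on[OF hol_inv_f]])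
    ultimately show ?thesis unfolding CL_def by (intro connected_imp_connected_closure connected_continuous_image)
  qed
  have mono: "CL n \<subseteq> CL m" if "m \<le> n" for m n
  proof -
    have "1 / real (n + 2) \<le> 1 / real (m + 2)" using that by (intro divide_left_mono) auto
    then show ?thesis unfolding CL_def N_def by (intro closure_mono image_mono Int_mono subset_ball order_refl)
  qed
  have ne: "CL n \<noteq> {}" for n
  proof -
    define u where "u = of_real (1 - 1 / real (n + 3)) * \<xi>"
    have "cmod u < 1" using \<xi> by (simp add: u_def norm_mult del: of_real_diff)
    have "\<xi> - u = of_real (1 / real (n + 3)) * \<xi>" by (simp add: u_def algebra_simps)
    then have "cmod (\<xi> - u) = 1 / real (n + 3)" using \<xi> by (simp only: norm_mult norm_of_real) simp
    also have "\<dots> < 1 / real (n + 2)" by (intro divide_strict_left_mono) auto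
    finally have "cmod (\<xi> - u) < 1 / real (n + 2)" .
    with \<open>cmod u < 1\<close> have "u \<in> N n" by (simp add: N_def dist_norm)
    then show ?thesis unfolding CL_def by auto
  qed
  have seq: "\<exists>z. (\<forall>n. z n \<in> N n) \<and> (\<lambda>n. inv_f (z n)) \<longlonglongrightarrow> q" if q: "q \<in> (\<Inter>n. CL n)" for q
  proof -
    have "\<exists>z\<in>N n. dist (inv_f z) q < 1 / real (Suc n)" for n
    proof -
      have "q \<in> closure (inv_f ` N n)" using q unfolding CL_def by blast
      then show ?thesis unfolding closure_approachable by (metis imageE zero_less_divide_1_iff of_nat_0_less_iff zero_less_Suc)
    qed
    then obtain z where z: "\<And>n. z n \<in> N n" "\<And>n. dist (inv_f (z n)) q < 1 / real (Suc n)" by metis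
    have "(\<lambda>n. inv_f (z n)) \<longlonglongrightarrow> q"
      unfolding tendsto_dist_iff[of _ q]
    proof (rule Lim_null_comparison)
      show "\<forall>\<^sub>F n in sequentially. norm (dist (inv_f (z n)) q) \<le> 1 / real (Suc n)"
        by (rule always_eventually) (use z(2) less_imp_le in auto)
      show "(\<lambda>n. 1 / real (Suc n)) \<longlonglongrightarrow> 0" by (intro LIMSEQ_Suc lim_1_over_n)
    qed
    with z(1) show ?thesis by blast
  qed
  have Nlim: "z \<longlonglongrightarrow> \<xi>" if "\<And>n. z n \<in> N n" for z
    unfolding tendsto_dist_iff[of z]
  proof (rule Lim_null_comparison)
    show "\<forall>\<^sub>F n in sequentially. norm (dist (z n) \<xi>) \<le> 1 / real (n + 2)"
      by (rule always_eventually) (use N(3)[OF that] less_imp_le in auto)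
    show "(\<lambda>n. 1 / real (n + 2)) \<longlonglongrightarrow> 0" by real_asymp
  qed
  have uniq: "p = q" if pq: "p \<in> (\<Inter>n. CL n)" "q \<in> (\<Inter>n. CL n)" "p \<noteq> 0" "q \<noteq> 0" for p q
  proof -
    obtain z w where z: "\<And>n. z n \<in> N n" "(\<lambda>n. inv_f (z n)) \<longlonglongrightarrow> p"
      and w: "\<And>n. w n \<in> N n" "(\<lambda>n. inv_f (w n)) \<longlonglongrightarrow> q" using seq pq(1,2) by metis
    have nz: "z n \<noteq> 0" "w n \<noteq> 0" for n using N(1)[OF z(1)[of n]] N(1)[OF w(1)[of n]] by auto
    show ?thesis
      using visible_cluster_unique[OF vis \<xi>, of z p w q] N(2)[OF z(1)] N(2)[OF w(1)] nz
        Nlim[of z, OF z(1)] Nlim[of w, OF w(1)] z(2) w(2) pq(3,4) by blast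
  qed
  have "\<exists>q. (\<Inter>n. CL n) \<subseteq> {0, q}"
  proof (cases "\<exists>q. q \<in> (\<Inter>n. CL n) \<and> q \<noteq> 0")
    case True
    then show ?thesis using uniq by blast
  qed blast
  then have fin: "finite (\<Inter>n. CL n)" using finite_subset by blast
  have conn: "connected (\<Inter>n. CL n)" by (rule connected_nest[OF cCL conCL mono])
  have "(\<Inter>n. CL n) \<noteq> {}" by (rule compact_nest[OF cCL ne mono])
  with connected_finite_iff_sing[OF conn] fin obtain p where p: "(\<Inter>n. CL n) = {p}" by metis
  have "(inv_f \<longlongrightarrow> p) (at \<xi> within ball 0 1)"
    unfolding Lim_within
  proof (intro allI impI)
    fix e :: real assume "e > 0"
    have "\<exists>n. CL n \<subseteq> ball p e"
    proof (rule ccontr)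
      assume "\<nexists>n. CL n \<subseteq> ball p e"
      then have ne': "CL n - ball p e \<noteq> {}" for n by blast
      have cp': "compact (CL n - ball p e)" for n by (intro compact_diff cCL open_ball)
      have mono': "CL n - ball p e \<subseteq> CL m - ball p e" if "m \<le> n" for m n using mono[OF that] by blast
      have "(\<Inter>n. CL n - ball p e) \<noteq> {}" by (rule compact_nest[OF cp' ne' mono'])
      then obtain x where x: "\<And>n. x \<in> CL n - ball p e" by blast
      then have "x \<in> (\<Inter>n. CL n)" by blast
      then have "x = p" using p by simp
      then show False using x[of 0] \<open>e > 0\<close> by simp
    qed
    then obtain n where n: "CL n \<subseteq> ball p e" by blast
    show "\<exists>d>0. \<forall>x\<in>ball 0 1. 0 < dist x \<xi> \<and> dist x \<xi> < d \<longrightarrow> dist (inv_f x) p < e"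
    proof (intro exI[of _ "1 / real (n + 2)"] conjI ballI impI)
      fix x assume "x \<in> ball 0 1" "0 < dist x \<xi> \<and> dist x \<xi> < 1 / real (n + 2)"
      then have "x \<in> N n" by (simp add: N_def dist_commute)
      then have "inv_f x \<in> CL n" unfolding CL_def by (intro subsetD[OF closure_subset] imageI)
      then have "inv_f x \<in> ball p e" using n by blast
      then show "dist (inv_f x) p < e" by (simp add: dist_commute)
    qed simp
  qed
  then show ?thesis by blast
qed

text \<open>The boundary, compactified by the point at infinity, is a continuous image of the circle and
  inherits its local connectedness.\<close>

theorem visible_imp_locally_connected:
  assumes vis: "\<And>\<zeta> \<eta>. \<zeta> \<in> end_boundary \<Omega> K \<Longrightarrow> \<eta> \<in> end_boundary \<Omega> K \<Longrightarrow> \<zeta> \<noteq> \<eta> \<Longrightarrow> visible_pair \<Omega> K 1 1 \<zeta> \<eta>"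
  shows "locally connected (frontier \<Omega>)"
proof -
  have "\<exists>p. \<xi> \<in> sphere 0 1 \<longrightarrow> (inv_f \<longlongrightarrow> p) (at \<xi> within ball 0 1)" for \<xi>
    using visible_boundary_limit[OF vis, of \<xi>] by auto
  then obtain \<Phi> where \<Phi>: "\<And>\<xi>. \<xi> \<in> sphere 0 1 \<Longrightarrow> (inv_f \<longlongrightarrow> \<Phi> \<xi>) (at \<xi> within ball 0 1)" by metis
  have seq\<Phi>: "(\<lambda>n. inv_f (z n)) \<longlonglongrightarrow> \<Phi> \<xi>"
    if \<xi>: "\<xi> \<in> sphere 0 1" and z: "\<And>n. cmod (z n) < 1" "z \<longlonglongrightarrow> \<xi>" for \<xi> z
  proof -
    have "filterlim z (at \<xi> within ball 0 1) sequentially"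
    proof -
      have "z n \<noteq> \<xi>" for n
      proof
        assume "z n = \<xi>"
        then show False using z(1)[of n] \<xi> by simp
      qed
      then show ?thesis unfolding filterlim_at using z by simp
    qed
    then show ?thesis by (rule filterlim_compose[OF \<Phi>[OF \<xi>]])
  qed
  \<comment> \<open>A radial sequence that starts at modulus \<open>1/2\<close> and so avoids the
    pole; it recovers the boundary value at \<open>\<xi>\<close>.\<close>
  define u where "u \<xi> n = of_real (1 - 1 / real (n + 2)) * \<xi>" for \<xi> :: complex and n
  have u: "cmod (u \<xi> n) < 1" "u \<xi> n \<noteq> 0" "u \<xi> \<longlonglongrightarrow> \<xi>" if \<xi>: "\<xi> \<in> sphere 0 1" for \<xi> n
  proof -
    have c: "0 < 1 - 1 / real (n + 2)" "1 - 1 / real (n + 2) < 1" by (simp_all add: field_simps)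
    then show "cmod (u \<xi> n) < 1" using \<xi> by (simp add: u_def norm_mult del: of_real_diff)
    show "u \<xi> n \<noteq> 0" using \<xi> c by (auto simp: u_def simp del: of_real_diff)
    have "(\<lambda>n. 1 - 1 / real (n + 2)) \<longlonglongrightarrow> 1" by real_asymp
    then have "u \<xi> \<longlonglongrightarrow> of_real 1 * \<xi>" unfolding u_def by (intro tendsto_intros)
    then show "u \<xi> \<longlonglongrightarrow> \<xi>" by simp
  qed
  have cont: "continuous_on (sphere 0 1) \<Phi>"
    unfolding continuous_on_iff
  proof (intro ballI allI impI)
    fix \<xi> :: complex and e :: real assume \<xi>: "\<xi> \<in> sphere 0 1" and "e > 0"
    then obtain d where d: "d > 0" "\<And>x. x \<in> ball 0 1 \<Longrightarrow> 0 < dist x \<xi> \<Longrightarrow> dist x \<xi> < d \<Longrightarrow> dist (inv_f x) (\<Phi> \<xi>) < e/2"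
      using \<Phi>[OF \<xi>] unfolding Lim_within by (metis half_gt_zero)
    have "dist (\<Phi> \<xi>') (\<Phi> \<xi>) < e" if \<xi>': "\<xi>' \<in> sphere 0 1" "dist \<xi>' \<xi> < d" for \<xi>'
    proof -
      have "(\<lambda>n. dist (u \<xi>' n) \<xi>) \<longlonglongrightarrow> dist \<xi>' \<xi>" by (intro tendsto_intros u(3) \<xi>')
      then have "\<forall>\<^sub>F n in sequentially. dist (u \<xi>' n) \<xi> < d" using \<xi>'(2) by (rule order_tendstoD)
      then have "\<forall>\<^sub>F n in sequentially. dist (inv_f (u \<xi>' n)) (\<Phi> \<xi>) \<le> e/2"
      proof eventually_elim
        case (elim n)
        have "u \<xi>' n \<noteq> \<xi>" using u(1)[OF \<xi>'(1), of n] \<xi> by auto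
        then show ?case using d(2)[of "u \<xi>' n"] u(1)[OF \<xi>'(1), of n] elim by (simp add: less_imp_le)
      qed
      moreover have "(\<lambda>n. dist (inv_f (u \<xi>' n)) (\<Phi> \<xi>)) \<longlonglongrightarrow> dist (\<Phi> \<xi>') (\<Phi> \<xi>)"
        by (intro tendsto_intros seq\<Phi> u \<xi>')
      ultimately have "dist (\<Phi> \<xi>') (\<Phi> \<xi>) \<le> e/2" by (intro tendsto_upperbound) auto
      then show ?thesis using \<open>e > 0\<close> by simp
    qed
    then show "\<exists>d>0. \<forall>x'\<in>sphere 0 1. dist x' \<xi> < d \<longrightarrow> dist (\<Phi> x') (\<Phi> \<xi>) < e" using d(1) by blast
  qed
  have img: "\<Phi> ` sphere 0 1 = frontier inv_dom"
  proof
    show "\<Phi> ` sphere 0 1 \<subseteq> frontier inv_dom"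
    proof (rule image_subsetI)
      fix \<xi> :: complex assume \<xi>: "\<xi> \<in> sphere 0 1"
      have "(\<lambda>n. cmod (u \<xi> n)) \<longlonglongrightarrow> 1" using tendsto_norm[OF u(3)[OF \<xi>]] \<xi> by simp
      then show "\<Phi> \<xi> \<in> frontier inv_dom"
        using u[OF \<xi>] by (intro inv_f_escape[of "u \<xi>"] seq\<Phi>[OF \<xi>]) auto
    qed
    show "frontier inv_dom \<subseteq> \<Phi> ` sphere 0 1"
    proof
      fix p assume p: "p \<in> frontier inv_dom"
      then have "p \<in> closure inv_dom" "p \<notin> inv_dom"
        using open_inverted[OF open_domain] by (auto simp: frontier_def interior_open)
      then obtain q where q: "\<And>n. q n \<in> inv_dom" "q \<longlonglongrightarrow> p" unfolding closure_sequential by blast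
      define z where "z n = inv_h (q n)" for n
      have z: "cmod (z n) < 1" "z n \<noteq> 0" "inv_f (z n) = q n" for n
        using inv_h_in[OF q(1)] inv_f_inv_h[OF q(1)] by (auto simp: z_def)
      have "z n \<in> cball 0 1" for n using z(1)[of n] by (simp add: less_imp_le)
      then obtain \<xi> s where \<xi>: "\<xi> \<in> cball 0 1" "strict_mono s" "(z \<circ> s) \<longlonglongrightarrow> \<xi>"
        using compact_cball[of "0::complex" 1] unfolding compact_def by metis
      have qs: "(\<lambda>n. inv_f (z (s n))) \<longlonglongrightarrow> p" using LIMSEQ_subseq_LIMSEQ[OF q(2) \<xi>(2)] by (simp add: z o_def)
      \<comment> \<open>Limit points inside the disc are excluded: at \<open>0\<close> the pole
        contradicts convergence of the values, and elsewhere continuity would place \<open>p\<close>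
        in \<open>inv_dom\<close>.\<close>
      have "\<xi> \<noteq> 0"
      proof
        assume "\<xi> = 0"
        obtain d where d: "d > 0" "\<And>z. z \<noteq> 0 \<Longrightarrow> cmod z < d \<Longrightarrow> cmod p + 1 < cmod (inv_f z)"
          using inv_f_at_0[of "cmod p + 1"] by blast
        have "\<forall>\<^sub>F n in sequentially. dist ((z \<circ> s) n) \<xi> < d" by (rule tendstoD[OF \<xi>(3) d(1)])
        moreover have "\<forall>\<^sub>F n in sequentially. dist (inv_f (z (s n))) p < 1" by (rule tendstoD[OF qs]) simp
        ultimately have "\<forall>\<^sub>F n in sequentially. dist ((z \<circ> s) n) \<xi> < d \<and> dist (inv_f (z (s n))) p < 1"
          by (rule eventually_conj)
        then obtain n where n: "cmod (z (s n)) < d" "dist (inv_f (z (s n))) p < 1"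
          using eventually_happens'[OF sequentially_bot] \<open>\<xi> = 0\<close> by fastforce
        then show False using d(2)[OF z(2) n(1)] norm_triangle_ineq2[of "inv_f (z (s n))" p] by (simp add: dist_norm)
      qed
      have "cmod \<xi> = 1"
      proof (rule ccontr)
        assume "cmod \<xi> \<noteq> 1"
        then have \<xi>1: "cmod \<xi> < 1" using \<xi>(1) by simp
        have "(\<lambda>n. inv_f ((z \<circ> s) n)) \<longlonglongrightarrow> inv_f \<xi>"
          by (rule continuous_on_tendsto_compose[OF holomorphic_on_imp_continuous_on[OF hol_inv_f] \<xi>(3)])
             (use z \<xi>1 \<open>\<xi> \<noteq> 0\<close> in auto)
        then have "p = inv_f \<xi>" using qs LIMSEQ_unique by (auto simp: o_def)
        then show False using inv_f_in[OF \<xi>1 \<open>\<xi> \<noteq> 0\<close>] \<open>p \<notin> inv_dom\<close> by simp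
      qed
      then have \<xi>s: "\<xi> \<in> sphere 0 1" by simp
      have "(\<lambda>n. inv_f (z (s n))) \<longlonglongrightarrow> \<Phi> \<xi>" using seq\<Phi>[OF \<xi>s, of "z \<circ> s"] z(1) \<xi>(3) by (simp add: o_def)
      then have "p = \<Phi> \<xi>" using qs LIMSEQ_unique by blast
      then show "p \<in> \<Phi> ` sphere 0 1" using \<xi>s by blast
    qed
  qed
  have "locally connected (\<Phi> ` sphere 0 1)"
  proof (rule locally_connected_quotient_image[OF locally_connected_sphere])
    fix T assume T: "T \<subseteq> \<Phi> ` sphere 0 1"
    show "openin (top_of_set (sphere 0 1)) (sphere 0 1 \<inter> \<Phi> -` T) \<longleftrightarrow> openin (top_of_set (\<Phi> ` sphere 0 1)) T"
      by (rule Abstract_Topology_2.continuous_imp_quotient_map[OF cont refl compact_sphere T])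
  qed
  then have lc: "locally connected (frontier inv_dom)" by (simp add: img)
  have "openin (top_of_set (frontier inv_dom)) (frontier inv_dom - {0})" by (intro openin_delete openin_subtopology_self)
  then have "locally connected (frontier inv_dom - {0})" using locally_open_subset[OF lc] by blast
  then show ?thesis using locally_connected_frontier_inverted[OF open_domain] f_in[of 0] by simp
qed

end

text \<open>The discs \<open>\<lambda>w. R * w\<close> join \<open>0\<close> to \<open>1\<close> at
  cost \<open>artanh (1 / R)\<close>, which tends to \<open>0\<close> for growing radius. This rules
  out the plane, to which the Riemann mapping theorem does not apply.\<close>

lemma not_hyperbolic_UNIV: "\<not> hyperbolic_domain UNIV"
proof
  assume hyp: "hyperbolic_domain UNIV"
  define S where "S = {(\<Sum>i<n. poincare_dist (a i) (b i)) | (n::nat) p f a b.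
            0 < n \<and> p 0 = (0::complex) \<and> p n = 1 \<and>
            (\<forall>i<n. f i \<in> hol_discs UNIV \<and> a i \<in> ball 0 1 \<and> b i \<in> ball 0 1 \<and>
                   f i (a i) = p i \<and> f i (b i) = p (Suc i))}"
  have nonneg: "0 \<le> s" if "s \<in> S" for s
    using that unfolding S_def mem_Collect_eq
    by (elim exE conjE) (hypsubst, intro sum_nonneg poincare_dist_nonneg; simp)
  have mem: "artanh (1 / (real n + 2)) \<in> S" for n
  proof -
    define R where "R = complex_of_real (real n + 2)"
    have R: "cmod (1 / R) = 1 / (real n + 2)" "R \<noteq> 0"
      unfolding R_def norm_divide norm_of_real by (simp_all add: complex_eq_iff)
    have "poincare_dist 0 (1 / R) = artanh (1 / (real n + 2))"
      using R by (simp add: poincare_dist_def)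
    moreover have "(\<lambda>w. R * w) \<in> hol_discs UNIV" by (auto simp: hol_discs_def intro!: holomorphic_intros)
    moreover have "1 / R \<in> ball 0 1" using R by simp
    ultimately show ?thesis unfolding S_def using R(2)
      by (intro CollectI exI[of _ "1::nat"] exI[of _ "\<lambda>i::nat. if i = 0 then 0 else 1"] exI[of _ "\<lambda>_ w. R * w"]
          exI[of _ "\<lambda>_. 0"] exI[of _ "\<lambda>_. 1 / R"]) simp
  qed
  have "bdd_below S" using nonneg by (intro bdd_belowI[of _ 0])
  then have le: "Inf S \<le> artanh (1 / (real n + 2))" for n using mem by (intro cInf_lower)
  have "(\<lambda>n. 1 / (real n + 2)) \<longlonglongrightarrow> 0" by real_asymp
  then have "(\<lambda>n. artanh (1 / (real n + 2))) \<longlonglongrightarrow> artanh 0" by (rule tendsto_artanh) auto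
  then have "Inf S \<le> 0" using le by (intro LIMSEQ_le_const[of _ 0]) auto
  moreover have "0 \<le> Inf S" using mem[of 0] nonneg by (intro cInf_greatest) auto
  ultimately have "kobayashi_dist UNIV 0 1 = 0" by (simp add: kobayashi_dist_def S_def)
  then show False using hyp unfolding hyperbolic_domain_def by (metis UNIV_I zero_neq_one)
qed

theorem theorem1p12:
  fixes \<Omega> :: "complex set" and K :: "nat \<Rightarrow> complex set"
  assumes "hyperbolic_domain \<Omega>"
    and "simply_connected \<Omega>"
    and "compact_exhaustion (closure \<Omega>) K"
  shows "visibility_domain \<Omega> K \<longleftrightarrow> locally connected (frontier \<Omega>)"
proof -
  have "open \<Omega>" "\<Omega> \<noteq> {}" "\<Omega> \<noteq> UNIV"
    using assms(1) not_hyperbolic_UNIV by (auto simp: hyperbolic_domain_def)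
  then obtain h f where "h holomorphic_on \<Omega>" "f holomorphic_on ball 0 1"
    "\<forall>z\<in>\<Omega>. h z \<in> ball 0 1 \<and> f (h z) = z" "\<forall>z\<in>ball 0 1. f z \<in> \<Omega> \<and> h (f z) = z"
    using Riemann_mapping_theorem[of \<Omega>] assms(2) by blast
  with \<open>open \<Omega>\<close> interpret riemann_map \<Omega> f h
    by unfold_locales auto
  show ?thesis
  proof
    assume "visibility_domain \<Omega> K"
    then show "locally connected (frontier \<Omega>)"
      by (intro visible_imp_locally_connected[of K]) (simp add: visibility_domain_def)
  next
    assume "locally connected (frontier \<Omega>)"
    then show "visibility_domain \<Omega> K"
      using assms locally_connected_imp_visible_pair by (simp add: visibility_domain_def)
  qed
qed

end
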